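(* Let $S$ be a semitopological semigroup. An $S$-flow $X$ is wap if and only if $X$ is REFL-approximable.
   Context: A semitopological semigroup is a semigroup with a topology for which multiplication is separately continuous. An $S$-flow is a topological space $X$ with a separately continuous left action $S\times X\to X$; if $S$ is a monoid, its identity acts as the identity transformation. Banach spaces are real. $C(X)$ is the Banach algebra of bounded continuous real functions on $X$ with the sup norm; $(fs)(x)=f(sx)$, $fS=\{fs:s\in S\}$. $\mathrm{WAP}_S(X)$ is the set of $f\in C(X)$ such that $fS$ is relatively weakly compact in $C(X)$. The flow $X$ is wap if $\mathrm{WAP}_S(X)$ separates points and closed subsets of $X$ (i.e. it separates the points of $X$, and for every closed $F\subset X$ and $x\notin F$ there is $f\in\mathrm{WAP}_S(X)$ with $f(x)\notin \overline{f(F)}$). For a Banach space $V$: $\Theta(V)=\{\sigma\in L(V,V):\|\sigma\|\le1\}$; $B(V^* )$ is the closed unit ball of $V^*$ with the weak$^*$ topology. A $V$-representation of $(S,X)$ is a pair $(h,\alpha)$ where $h:S\to\Theta(V)$ is an antihomomorphism ($h(st)=h(t)h(s)$) continuous for the weak operator topology and $\alpha:X\to B(V^* )$ is weak$^*$ continuous and equivariant: $\langle v,\alpha(sx)\rangle=\langle h(s)v,\alpha(x)\rangle$ for all $v\in V$, $s\in S$, $x\in X$. $X$ is REFL-approximable if there is a family $(h_i,\alpha_i)_{i\in I}$ of representations of $(S,X)$ in reflexive Banach spaces $V_i$ which separates points and closed subsets of $X$ (the $\alpha_i$ separate the points of $X$, and for closed $F\subset X$, $x\notin F$, some $i$ satisfies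 $\alpha_i(x)\notin\overline{\alpha_i(F)}$); equivalently, $X$ is a subdirect product (a subflow of a product) of $S$-flows each of which admits a representation in a reflexive space with $\alpha$ a topological embedding. *)

theory Defs
  imports "HOL-Analysis.Analysis" "HOL-Library.Function_Algebras"
begin

section \<open>Function spaces as real vector spaces\<close>

text \<open>Pointwise scalar multiplication complements the pointwise operations of
  \<^theory>\<open>HOL-Library.Function_Algebras\<close>; the dual of a space carried by a type
  \<open>'v\<close> is then a subspace of \<open>'v \<Rightarrow> real\<close>, and the bidual is literally the dual of the dual.\<close>

instantiation "fun" :: (type, real_vector) real_vector
begin

definition scaleR_fun :: "real \<Rightarrow> ('a \<Rightarrow> 'b) \<Rightarrow> 'a \<Rightarrow> 'b"
  where "scaleR_fun c f = (\<lambda>x. c *\<^sub>R f x)"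

instance
  by standard (simp_all add: scaleR_fun_def fun_eq_iff scaleR_add_right scaleR_add_left)

end

section \<open>Topologies\<close>

text \<open>The coarsest topology on the set \<open>A\<close> making all real functions in \<open>\<F>\<close> continuous.
  \<open>A\<close> itself is inserted so that the underlying set is \<open>A\<close> even if \<open>\<F>\<close> is empty.\<close>

definition initial_topology :: "'a set \<Rightarrow> ('a \<Rightarrow> real) set \<Rightarrow> 'a topology"
  where "initial_topology A \<F> =
    topology_generated_by (insert A {A \<inter> f -` U | f U. f \<in> \<F> \<and> open U})"

definition weak_topology :: "'a::real_normed_vector topology"
  where "weak_topology = initial_topology UNIV {\<phi>. bounded_linear \<phi>}"

definition relatively_weakly_compact :: "'a::real_normed_vector set \<Rightarrow> bool"
  where "relatively_weakly_compact A \<longleftrightarrow> compactin weak_topology (weak_topology closure_of A)"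

text \<open>A family \<open>\<alpha> i\<close> of maps into spaces \<open>T i\<close>, indexed by \<open>i \<in> I\<close>, separates points and
  closed subsets.\<close>

definition separates_points_and_closed_sets ::
    "'i set \<Rightarrow> ('i \<Rightarrow> 'c topology) \<Rightarrow> ('i \<Rightarrow> 'x::topological_space \<Rightarrow> 'c) \<Rightarrow> bool"
  where "separates_points_and_closed_sets I T \<alpha> \<longleftrightarrow>
    (\<forall>x y. x \<noteq> y \<longrightarrow> (\<exists>i\<in>I. \<alpha> i x \<noteq> \<alpha> i y)) \<and>
    (\<forall>F x. closed F \<and> x \<notin> F \<longrightarrow> (\<exists>i\<in>I. \<alpha> i x \<notin> T i closure_of (\<alpha> i ` F)))"

section \<open>Semigroups, flows and weakly almost periodic functions\<close>

definition semitopological_semigroup ::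
    "'s::{semigroup_mult, topological_space} itself \<Rightarrow> bool"
  where "semitopological_semigroup _ \<longleftrightarrow>
    (\<forall>t::'s. continuous_on UNIV (\<lambda>s. s * t) \<and> continuous_on UNIV (\<lambda>s. t * s))"

definition flow ::
    "('s::{semigroup_mult, topological_space} \<Rightarrow> 'x::topological_space \<Rightarrow> 'x) \<Rightarrow> bool"
  where "flow act \<longleftrightarrow>
    (\<forall>s t x. act (s * t) x = act s (act t x)) \<and>
    (\<forall>s. continuous_on UNIV (\<lambda>x. act s x)) \<and>
    (\<forall>x. continuous_on UNIV (\<lambda>s. act s x)) \<and>
    (\<forall>e. (\<forall>s. e * s = s \<and> s * e = s) \<longrightarrow> (\<forall>x. act e x = x))"

definition orbit :: "('s \<Rightarrow> 'x \<Rightarrow> 'x) \<Rightarrow> ('x::topological_space \<Rightarrow>\<^sub>C real) \<Rightarrow> ('x \<Rightarrow>\<^sub>C real) set"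
  where "orbit act f = {g. \<exists>s. \<forall>x. apply_bcontfun g x = apply_bcontfun f (act s x)}"

definition WAP :: "('s \<Rightarrow> 'x \<Rightarrow> 'x) \<Rightarrow> ('x::topological_space \<Rightarrow>\<^sub>C real) set"
  where "WAP act = {f. relatively_weakly_compact (orbit act f)}"

definition wap_flow :: "('s \<Rightarrow> 'x \<Rightarrow> 'x::topological_space) \<Rightarrow> bool"
  where "wap_flow act \<longleftrightarrow>
    separates_points_and_closed_sets (WAP act) (\<lambda>_. euclidean) apply_bcontfun"

section \<open>Banach spaces, duals and reflexivity\<close>

text \<open>A normed space is given by a linear subspace \<open>V\<close> of an ambient real vector space and a norm
  \<open>N\<close> on \<open>V\<close>; the ambient type carries no topology and values of \<open>N\<close> outside \<open>V\<close> are irrelevant.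
  Thus a family of unrelated Banach spaces can live on one ambient type: embed
  them in the direct sum of their underlying vector spaces.\<close>

definition normed_space :: "'v::real_vector set \<Rightarrow> ('v \<Rightarrow> real) \<Rightarrow> bool"
  where "normed_space V N \<longleftrightarrow> subspace V \<and>
    (\<forall>v\<in>V. N v \<ge> 0) \<and> (\<forall>v\<in>V. N v = 0 \<longleftrightarrow> v = 0) \<and>
    (\<forall>v\<in>V. \<forall>w\<in>V. N (v + w) \<le> N v + N w) \<and>
    (\<forall>c. \<forall>v\<in>V. N (c *\<^sub>R v) = \<bar>c\<bar> * N v)"

definition banach_space :: "'v::real_vector set \<Rightarrow> ('v \<Rightarrow> real) \<Rightarrow> bool"
  where "banach_space V N \<longleftrightarrow> normed_space V N \<and>
    (\<forall>\<sigma> :: nat \<Rightarrow> 'v. range \<sigma> \<subseteq> V \<and> (\<forall>\<epsilon>>0. \<exists>K. \<forall>m\<ge>K. \<forall>n\<ge>K. N (\<sigma> m - \<sigma> n) < \<epsilon>) \<longrightarrow>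
      (\<exists>v\<in>V. (\<lambda>n. N (\<sigma> n - v)) \<longlonglongrightarrow> 0))"

text \<open>Bounded linear maps from \<open>(V, N)\<close> to \<open>(W, M)\<close>, extended by 0 outside \<open>V\<close> so
  that each such map is represented by exactly one function.\<close>

definition bounded_linear_maps ::
    "'v::real_vector set \<Rightarrow> ('v \<Rightarrow> real) \<Rightarrow> 'w::real_vector set \<Rightarrow> ('w \<Rightarrow> real) \<Rightarrow> ('v \<Rightarrow> 'w) set"
  where "bounded_linear_maps V N W M = {T.
    (\<forall>v\<in>V. T v \<in> W) \<and> (\<forall>v. v \<notin> V \<longrightarrow> T v = 0) \<and>
    (\<forall>v\<in>V. \<forall>w\<in>V. T (v + w) = T v + T w) \<and>
    (\<forall>c. \<forall>v\<in>V. T (c *\<^sub>R v) = c *\<^sub>R T v) \<and>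
    (\<exists>K. \<forall>v\<in>V. M (T v) \<le> K * N v)}"

definition operator_norm ::
    "'v set \<Rightarrow> ('v \<Rightarrow> real) \<Rightarrow> ('w \<Rightarrow> real) \<Rightarrow> ('v \<Rightarrow> 'w) \<Rightarrow> real"
  where "operator_norm V N M T = (SUP v\<in>{v\<in>V. N v \<le> 1}. M (T v))"

definition dual_space :: "'v::real_vector set \<Rightarrow> ('v \<Rightarrow> real) \<Rightarrow> ('v \<Rightarrow> real) set"
  where "dual_space V N = bounded_linear_maps V N UNIV abs"

definition dual_norm :: "'v set \<Rightarrow> ('v \<Rightarrow> real) \<Rightarrow> ('v \<Rightarrow> real) \<Rightarrow> real"
  where "dual_norm V N = operator_norm V N abs"

definition reflexive_banach_space :: "'v::real_vector set \<Rightarrow> ('v \<Rightarrow> real) \<Rightarrow> bool"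
  where "reflexive_banach_space V N \<longleftrightarrow> banach_space V N \<and>
    (\<forall>\<Phi>\<in>dual_space (dual_space V N) (dual_norm V N).
      \<exists>v\<in>V. \<forall>\<phi>\<in>dual_space V N. \<Phi> \<phi> = \<phi> v)"

definition weak_star_dual_ball :: "'v::real_vector set \<Rightarrow> ('v \<Rightarrow> real) \<Rightarrow> ('v \<Rightarrow> real) topology"
  where "weak_star_dual_ball V N =
    initial_topology {\<phi>\<in>dual_space V N. dual_norm V N \<phi> \<le> 1} {\<lambda>\<phi>. \<phi> v | v. v \<in> V}"

definition \<Theta>_wot :: "'v::real_vector set \<Rightarrow> ('v \<Rightarrow> real) \<Rightarrow> ('v \<Rightarrow> 'v) topology"
  where "\<Theta>_wot V N =
    initial_topology {\<sigma>\<in>bounded_linear_maps V N V N. operator_norm V N N \<sigma> \<le> 1}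
      {\<lambda>\<sigma>. \<phi> (\<sigma> v) | \<phi> v. \<phi> \<in> dual_space V N \<and> v \<in> V}"

section \<open>Representations of flows\<close>

text \<open>The continuity conditions include \<open>h s \<in> \<Theta>(V)\<close> and \<open>\<alpha> x \<in> B(V\<^sup>*)\<close>.\<close>

definition representation ::
    "('s::{semigroup_mult, topological_space} \<Rightarrow> 'x::topological_space \<Rightarrow> 'x) \<Rightarrow>
     'v::real_vector set \<Rightarrow> ('v \<Rightarrow> real) \<Rightarrow> ('s \<Rightarrow> 'v \<Rightarrow> 'v) \<Rightarrow> ('x \<Rightarrow> 'v \<Rightarrow> real) \<Rightarrow> bool"
  where "representation act V N h \<alpha> \<longleftrightarrow>
    (\<forall>s t. h (s * t) = h t \<circ> h s) \<and>
    continuous_map euclidean (\<Theta>_wot V N) h \<and>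
    continuous_map euclidean (weak_star_dual_ball V N) \<alpha> \<and>
    (\<forall>v\<in>V. \<forall>s x. \<alpha> (act s x) v = \<alpha> x (h s v))"

text \<open>The family is given as a set \<open>R\<close> of tuples \<open>(V, N, h, \<alpha>)\<close> indexed by itself, so no index type
  is needed. HOL cannot quantify existentially over types, so the type of the ambient vector space is
  a parameter.\<close>

definition REFL_approximable ::
    "'v::real_vector itself \<Rightarrow>
     ('s::{semigroup_mult, topological_space} \<Rightarrow> 'x::topological_space \<Rightarrow> 'x) \<Rightarrow> bool"
  where "REFL_approximable _ act \<longleftrightarrow>
    (\<exists>R :: ('v set \<times> ('v \<Rightarrow> real) \<times> ('s \<Rightarrow> 'v \<Rightarrow> 'v) \<times> ('x \<Rightarrow> 'v \<Rightarrow> real)) set.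
      (\<forall>(V, N, h, \<alpha>)\<in>R. reflexive_banach_space V N \<and> representation act V N h \<alpha>) \<and>
      separates_points_and_closed_sets R
        (\<lambda>(V, N, h, \<alpha>). weak_star_dual_ball V N) (\<lambda>(V, N, h, \<alpha>). \<alpha>))"

end

(* Weak compactness is handled through Grothendieck's double limit condition, with all limits taken
   along one fixed ultrafilter on the natural numbers. A bounded set H of functions on X is relatively
   weakly compact iff double limits of h i (x j) with h i in H can be interchanged. This condition
   passes to convex hulls by an argument with finitely additive measures, which yields both the
   converse half of the criterion and Krein's theorem.

   Given f in WAP(X), the balanced convex hull of f and its orbit is therefore weakly compact, and
   Davis-Figiel-Johnson-Pelczynski interpolation gives a reflexive space V of functions containing f,
   on which S acts by contractions; the point evaluations are the representation. Conversely, in a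
   reflexive representation the coefficients x |-> <v, alpha x> satisfy the double limit condition,
   which is stable under sums and products; sums of squares of shifted coefficients separate points
   from closed sets. *)

theory Submission
  imports Defs
begin

section \<open>Ultrafilter limits\<close>

definition ultra :: "'i filter \<Rightarrow> bool"
  where "ultra F \<longleftrightarrow> F \<noteq> bot \<and> (\<forall>f::'i \<Rightarrow> real. bounded (range f) \<longrightarrow> (\<exists>l. (f \<longlongrightarrow> l) F))"

(* By Tychonoff, the evaluations at the points of the index set cluster in a product of intervals
   indexed by all bounded functions. *)
lemma ex_ultra_le:
  fixes F :: "'i filter"
  assumes "F \<noteq> bot"
  shows "\<exists>G\<le>F. ultra G"
proof -
  define b :: "('i \<Rightarrow> real) \<Rightarrow> real" where
    "b f = (SOME B. bounded (range f) \<longrightarrow> (\<forall>x. \<bar>f x\<bar> \<le> B))" for f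
  have b: "\<bar>f x\<bar> \<le> b f" if "bounded (range f)" for f x
  proof -
    have "\<exists>B. bounded (range f) \<longrightarrow> (\<forall>x. \<bar>f x\<bar> \<le> B)"
      by (auto simp: bounded_iff)
    from someI_ex[OF this] show ?thesis using that unfolding b_def by blast
  qed
  define ev :: "'i \<Rightarrow> ('i \<Rightarrow> real) \<Rightarrow> real" where
    "ev i = (\<lambda>f. if bounded (range f) then f i else 0)" for i
  define K :: "(('i \<Rightarrow> real) \<Rightarrow> real) set" where "K = PiE UNIV (\<lambda>f. {- \<bar>b f\<bar>..\<bar>b f\<bar>})"
  have "compactin (product_topology (\<lambda>_. euclidean) UNIV) K"
    unfolding K_def compactin_PiE by simp
  then have "compact K"
    by (simp add: euclidean_product_topology)
  moreover have "ev i \<in> K" for i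
    unfolding K_def ev_def using b[of _ i]
    by (auto simp: abs_le_iff PiE_UNIV_domain Pi_iff intro: order_trans abs_ge_self; smt (verit))
  then have "eventually (\<lambda>x. x \<in> K) (filtermap ev F)"
    by (simp add: eventually_filtermap)
  moreover have "filtermap ev F \<noteq> bot"
    using assms by (simp add: filtermap_bot_iff)
  ultimately obtain L where L: "inf (nhds L) (filtermap ev F) \<noteq> bot"
    unfolding compact_filter by blast
  define G where "G = inf F (filtercomap ev (nhds L))"
  have "G \<noteq> bot"
  proof
    assume "G = bot"
    then have "eventually (\<lambda>_. False) G" by simp
    then obtain P Q where P: "eventually P F" and Q: "eventually Q (nhds L)"
      and PQ: "\<And>i. P i \<Longrightarrow> Q (ev i) \<Longrightarrow> False"
      unfolding G_def eventually_inf eventually_filtercomap by blast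
    have "eventually (\<lambda>z. \<not> Q z) (filtermap ev F)"
      using P PQ unfolding eventually_filtermap by (auto elim!: eventually_mono)
    then have "eventually (\<lambda>_. False) (inf (nhds L) (filtermap ev F))"
      using Q unfolding eventually_inf by blast
    with L show False by (simp add: eventually_False)
  qed
  moreover have "\<exists>l. (f \<longlongrightarrow> l) G" if f: "bounded (range f)" for f :: "'i \<Rightarrow> real"
  proof (intro exI tendstoI)
    fix e :: real assume "e > 0"
    have "continuous_on UNIV (\<lambda>z::('i \<Rightarrow> real) \<Rightarrow> real. z f)"
      by (rule continuous_on_product_coordinates)
    then have "open ((\<lambda>z::('i \<Rightarrow> real) \<Rightarrow> real. z f) -` ball (L f) e)"
      by (rule open_vimage[OF open_ball])
    from eventually_nhds_in_open[OF this, of L] \<open>e > 0\<close>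
    have "eventually (\<lambda>z. dist (z f) (L f) < e) (nhds L)"
      by (simp add: dist_commute)
    then have "eventually (\<lambda>i. dist (ev i f) (L f) < e) (filtercomap ev (nhds L))"
      unfolding eventually_filtercomap by blast
    then show "eventually (\<lambda>i. dist (f i) (L f) < e) G"
      using f unfolding G_def ev_def by (simp add: filter_leD[OF inf_le2])
  qed
  ultimately show ?thesis
    unfolding ultra_def G_def using inf_le1 by blast
qed

lemma ultra_nontrivial: "ultra F \<Longrightarrow> F \<noteq> bot"
  by (simp add: ultra_def)

lemma ultra_lim_ex:
  fixes f :: "'i \<Rightarrow> real"
  assumes "ultra F" "\<And>i. \<bar>f i\<bar> \<le> B"
  shows "\<exists>l. (f \<longlongrightarrow> l) F"
  using assms unfolding ultra_def bounded_iff by (metis real_norm_def rangeE)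

lemma ultra_tendsto_Lim:
  fixes f :: "'i \<Rightarrow> real"
  assumes "ultra F" "\<And>i. \<bar>f i\<bar> \<le> B"
  shows "(f \<longlongrightarrow> Lim F f) F"
proof -
  obtain l where l: "(f \<longlongrightarrow> l) F" using ultra_lim_ex[where f=f, OF assms] by blast
  then have "Lim F f = l" using tendsto_Lim ultra_nontrivial[OF assms(1)] by blast
  with l show ?thesis by simp
qed

lemma ultra_cases:
  assumes "ultra F"
  shows "eventually P F \<or> eventually (\<lambda>x. \<not> P x) F"
proof -
  have "\<bar>of_bool (P x) :: real\<bar> \<le> 1" for x by simp
  from ultra_lim_ex[where f="\<lambda>x. of_bool (P x)", OF assms this] obtain l :: real where l: "((\<lambda>x. of_bool (P x)) \<longlongrightarrow> l) F"
    by blast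
  then have "eventually (\<lambda>x. dist (of_bool (P x)) l < 1/2) F"
    by (rule tendstoD) simp
  then show ?thesis
  proof (cases "l > 1/2")
    case True
    from \<open>eventually (\<lambda>x. dist (of_bool (P x)) l < 1/2) F\<close> have "eventually P F"
      by (rule eventually_mono) (use True in \<open>auto simp: dist_real_def of_bool_def split: if_splits\<close>)
    then show ?thesis ..
  next
    case False
    from \<open>eventually (\<lambda>x. dist (of_bool (P x)) l < 1/2) F\<close> have "eventually (\<lambda>x. \<not> P x) F"
      by (rule eventually_mono) (use False in \<open>auto simp: dist_real_def of_bool_def split: if_splits\<close>)
    then show ?thesis ..
  qed
qed

definition \<omega> :: "nat filter" where "\<omega> = (SOME G. G \<le> sequentially \<and> ultra G)"

lemma \<omega>_props: "\<omega> \<le> sequentially" "ultra \<omega>"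
  using someI_ex[OF ex_ultra_le[OF sequentially_bot]] unfolding \<omega>_def by auto

lemma \<omega>_bot [simp]: "\<omega> \<noteq> bot"
  using \<omega>_props(2) by (rule ultra_nontrivial)

lemma tendsto_\<omega>I: "f \<longlonglongrightarrow> l \<Longrightarrow> (f \<longlongrightarrow> l) \<omega>"
  using \<omega>_props(1) by (rule tendsto_mono)

lemma tendsto_\<omega>_Lim:
  fixes f :: "nat \<Rightarrow> real"
  shows "(\<And>i. \<bar>f i\<bar> \<le> B) \<Longrightarrow> (f \<longlongrightarrow> Lim \<omega> f) \<omega>"
  by (rule ultra_tendsto_Lim[OF \<omega>_props(2)])

lemma Lim_\<omega>_eq: "(f \<longlongrightarrow> l) \<omega> \<Longrightarrow> Lim \<omega> f = (l::real)"
  by (rule tendsto_Lim[OF \<omega>_bot])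

lemma abs_Lim_\<omega>_le:
  fixes f :: "nat \<Rightarrow> real"
  assumes "\<And>i. \<bar>f i\<bar> \<le> B"
  shows "\<bar>Lim \<omega> f\<bar> \<le> B"
proof (rule tendsto_upperbound)
  show "((\<lambda>i. \<bar>f i\<bar>) \<longlongrightarrow> \<bar>Lim \<omega> f\<bar>) \<omega>"
    using tendsto_\<omega>_Lim[OF assms] by (rule tendsto_rabs)
qed (use assms in auto)

section \<open>Interchangeable double limits\<close>

definition stable :: "'a set \<Rightarrow> 'y set \<Rightarrow> ('a \<Rightarrow> 'y \<Rightarrow> real) \<Rightarrow> bool"
  where "stable A Y p \<longleftrightarrow> (\<forall>a y. range a \<subseteq> A \<and> range y \<subseteq> Y \<longrightarrow>
    Lim \<omega> (\<lambda>i::nat. Lim \<omega> (\<lambda>j::nat. p (a i) (y j))) = Lim \<omega> (\<lambda>j. Lim \<omega> (\<lambda>i. p (a i) (y j))))"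

lemma stable_flip: "stable A Y p \<Longrightarrow> stable Y A (\<lambda>y a. p a y)"
  unfolding stable_def by metis

lemma stableD:
  assumes "stable A Y p" "\<And>i. a i \<in> A" "\<And>j. y j \<in> Y"
    "\<And>i. ((\<lambda>j. p (a i) (y j)) \<longlongrightarrow> r i) \<omega>" "(r \<longlongrightarrow> l) \<omega>"
    "\<And>j. ((\<lambda>i. p (a i) (y j)) \<longlongrightarrow> s j) \<omega>" "(s \<longlongrightarrow> m) \<omega>"
  shows "l = m"
proof -
  have "Lim \<omega> (\<lambda>i. Lim \<omega> (\<lambda>j. p (a i) (y j))) = Lim \<omega> (\<lambda>j. Lim \<omega> (\<lambda>i. p (a i) (y j)))"
    using assms(1-3) unfolding stable_def by blast
  then show ?thesis
    by (simp add: Lim_\<omega>_eq[OF assms(4)] Lim_\<omega>_eq[OF assms(6)] Lim_\<omega>_eq[OF assms(5)] Lim_\<omega>_eq[OF assms(7)])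
qed

locale content =
  fixes \<nu> :: "'a set \<Rightarrow> real"
  assumes \<nu>_nonneg: "0 \<le> \<nu> B"
    and \<nu>_add: "B \<inter> C = {} \<Longrightarrow> \<nu> (B \<union> C) = \<nu> B + \<nu> C"
    and \<nu>_le_1: "\<nu> B \<le> 1"
begin

lemma \<nu>_empty: "\<nu> {} = 0"
  using \<nu>_add[of "{}" "{}"] by simp

lemma \<nu>_mono: "B \<subseteq> C \<Longrightarrow> \<nu> B \<le> \<nu> C"
  using \<nu>_add[of B "C - B"] \<nu>_nonneg[of "C - B"] by (simp add: Un_absorb1)

lemma \<nu>_Un_le: "\<nu> (B \<union> C) \<le> \<nu> B + \<nu> C"
  using \<nu>_add[of B "C - B"] \<nu>_mono[of "C - B" C] by auto

lemma \<nu>_abs: "\<bar>\<nu> B\<bar> \<le> 1"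
  using \<nu>_nonneg[of B] \<nu>_le_1[of B] by simp

(* Otherwise the sets B Int E g could be made almost disjoint, and finitely many of them would have
   total content above 1. *)
lemma ex_good:
  assumes U: "ultra U" and pos: "Lim U (\<lambda>g. \<nu> (B \<inter> E g)) > 0" and ev: "eventually Q U"
  shows "\<exists>g. Q g \<and> Lim U (\<lambda>h. \<nu> (B \<inter> E g \<inter> E h)) > 0"
proof (rule ccontr)
  define d where "d = Lim U (\<lambda>g. \<nu> (B \<inter> E g))"
  have lim: "((\<lambda>h. \<nu> (C \<inter> E h)) \<longlongrightarrow> Lim U (\<lambda>h. \<nu> (C \<inter> E h))) U" for C
    by (rule ultra_tendsto_Lim[OF U \<nu>_abs])
  have limnn: "Lim U (\<lambda>h. \<nu> (C \<inter> E h)) \<ge> 0" for C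
    by (rule tendsto_lowerbound[OF lim]) (auto simp: \<nu>_nonneg ultra_nontrivial[OF U])
  assume "\<not> ?thesis"
  then have zero: "((\<lambda>h. \<nu> (B \<inter> E g \<inter> E h)) \<longlongrightarrow> 0) U" if "Q g" for g
    using limnn lim that by (metis order_antisym not_le)
  have "\<exists>D. \<nu> (B \<inter> D) \<ge> real k * (d/4) \<and> ((\<lambda>h. \<nu> (B \<inter> D \<inter> E h)) \<longlongrightarrow> 0) U" for k :: nat
  proof (induction k)
    case 0
    show ?case by (rule exI[of _ "{}"]) (simp add: \<nu>_empty)
  next
    case (Suc k)
    then obtain D where D: "\<nu> (B \<inter> D) \<ge> real k * (d/4)" "((\<lambda>h. \<nu> (B \<inter> D \<inter> E h)) \<longlongrightarrow> 0) U"
      by blast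
    have "eventually (\<lambda>h. \<nu> (B \<inter> E h) > d/2) U"
      using lim[of B] by (rule order_tendstoD) (use pos d_def in simp)
    moreover have "eventually (\<lambda>h. \<nu> (B \<inter> D \<inter> E h) < d/4) U"
      using D(2) by (rule order_tendstoD) (use pos d_def in simp)
    ultimately have "eventually (\<lambda>h. \<nu> (B \<inter> E h) > d/2 \<and> \<nu> (B \<inter> D \<inter> E h) < d/4 \<and> Q h) U"
      using ev by eventually_elim auto
    then obtain g where g: "\<nu> (B \<inter> E g) > d/2" "\<nu> (B \<inter> D \<inter> E g) < d/4" "Q g"
      using eventually_happens'[OF ultra_nontrivial[OF U]] by blast
    have "\<nu> (B \<inter> E g) \<le> \<nu> (B \<inter> D \<inter> E g) + \<nu> (B \<inter> (E g - D))"
      by (rule order_trans[OF \<nu>_mono \<nu>_Un_le]) blast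
    moreover have "\<nu> (B \<inter> (D \<union> E g)) = \<nu> (B \<inter> D) + \<nu> (B \<inter> (E g - D))"
      by (subst \<nu>_add[symmetric]) (auto intro!: arg_cong[where f=\<nu>])
    ultimately have "\<nu> (B \<inter> (D \<union> E g)) \<ge> real (Suc k) * (d/4)"
      using D(1) g by (simp add: field_simps)
    moreover have "((\<lambda>h. \<nu> (B \<inter> (D \<union> E g) \<inter> E h)) \<longlongrightarrow> 0) U"
    proof (rule tendsto_sandwich)
      show "eventually (\<lambda>h. 0 \<le> \<nu> (B \<inter> (D \<union> E g) \<inter> E h)) U" by (simp add: \<nu>_nonneg)
      show "eventually (\<lambda>h. \<nu> (B \<inter> (D \<union> E g) \<inter> E h) \<le> \<nu> (B \<inter> D \<inter> E h) + \<nu> (B \<inter> E g \<inter> E h)) U"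
        by (rule always_eventually) (metis \<nu>_Un_le inf_sup_distrib1 inf_sup_distrib2)
      show "((\<lambda>h. \<nu> (B \<inter> D \<inter> E h) + \<nu> (B \<inter> E g \<inter> E h)) \<longlongrightarrow> 0) U"
        using tendsto_add[OF D(2) zero[OF g(3)]] by simp
    qed simp
    ultimately show ?case by blast
  qed
  moreover obtain k :: nat where "real k * (d/4) > 1"
    using pos unfolding d_def[symmetric] by (metis ex_less_of_nat_mult zero_less_divide_iff zero_less_numeral)
  ultimately show False
    using \<nu>_le_1 by (metis (no_types, lifting) le_less_trans less_le_not_le)
qed

end

lemma ex_ultra_approx:
  fixes q :: "'g \<Rightarrow> 'd \<Rightarrow> real"
  assumes "\<And>Z e. finite Z \<Longrightarrow> Z \<subseteq> D \<Longrightarrow> e > 0 \<Longrightarrow> \<exists>g\<in>G. \<forall>d\<in>Z. \<bar>q g d - z d\<bar> < e"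
  shows "\<exists>U. ultra U \<and> eventually (\<lambda>g. g \<in> G) U \<and> (\<forall>d\<in>D. ((\<lambda>g. q g d) \<longlongrightarrow> z d) U)"
proof -
  define I where "I = {(Z, e::real). finite Z \<and> Z \<subseteq> D \<and> e > 0}"
  define T where "T = (\<lambda>(Z, e). {g\<in>G. \<forall>d\<in>Z. \<bar>q g d - z d\<bar> < e})"
  define F where "F = (INF i\<in>I. principal (T i))"
  have ev: "eventually P F \<longleftrightarrow> (\<exists>i\<in>I. \<forall>g\<in>T i. P g)" for P
    unfolding F_def
  proof (subst eventually_INF_base)
    show "I \<noteq> {}" by (auto simp: I_def intro!: exI[of _ "{}"] exI[of _ 1])
    fix i j assume "i \<in> I" "j \<in> I"
    then show "\<exists>k\<in>I. principal (T k) \<le> inf (principal (T i)) (principal (T j))"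
      by (intro bexI[of _ "(fst i \<union> fst j, min (snd i) (snd j))"])
        (auto simp: I_def T_def split: prod.splits)
  qed (auto simp: eventually_principal)
  have "F \<noteq> bot"
  proof
    assume "F = bot"
    then have "eventually (\<lambda>_. False) F" by simp
    then obtain Z e where "(Z, e) \<in> I" "T (Z, e) = {}" unfolding ev by auto
    with assms[of Z e] show False by (auto simp: I_def T_def)
  qed
  then obtain U where U: "U \<le> F" "ultra U" using ex_ultra_le by blast
  have "eventually (\<lambda>g. g \<in> G) F"
    unfolding ev by (rule bexI[of _ "({}, 1)"]) (auto simp: T_def I_def)
  moreover have "((\<lambda>g. q g d) \<longlongrightarrow> z d) F" if "d \<in> D" for d
  proof (rule tendstoI)
    fix e :: real assume "e > 0"
    then show "eventually (\<lambda>g. dist (q g d) (z d) < e) F"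
      unfolding ev using that by (intro bexI[of _ "({d}, e)"]) (auto simp: T_def I_def dist_real_def)
  qed
  ultimately show ?thesis
    using U by (metis filter_leD tendsto_mono)
qed

lemma stable_convex_hull_approx:
  fixes p :: "'a::real_vector \<Rightarrow> 'y \<Rightarrow> real"
  assumes stab: "stable A Y p"
    and bd: "\<And>a y. a \<in> A \<Longrightarrow> y \<in> Y \<Longrightarrow> \<bar>p a y\<bar> \<le> M"
    and lin: "\<And>y. y \<in> Y \<Longrightarrow> linear (\<lambda>a. p a y)"
    and \<xi>: "linear \<xi>"
    and F: "ultra F" and c: "\<And>i. c i \<in> convex hull A"
    and GY: "G \<subseteq> Y"
    and appr: "\<And>Z e. finite Z \<Longrightarrow> Z \<subseteq> A \<Longrightarrow> e > 0 \<Longrightarrow> \<exists>g\<in>G. \<forall>a\<in>Z. \<bar>p a g - \<xi> a\<bar> < e"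
    and e: "e > 0"
  shows "\<exists>g\<in>G. eventually (\<lambda>i. \<bar>p (c i) g - \<xi> (c i)\<bar> < e) F"
proof (rule ccontr)
  assume contra: "\<not> ?thesis"
  have "\<exists>S u. finite S \<and> S \<subseteq> A \<and> (\<forall>x\<in>S. 0 \<le> u x) \<and> sum u S = 1 \<and> (\<Sum>v\<in>S. u v *\<^sub>R v) = c i" for i
    using c[of i] unfolding convex_hull_explicit by blast
  then obtain S u where S: "\<And>i. finite (S i)" "\<And>i. S i \<subseteq> A" "\<And>i x. x \<in> S i \<Longrightarrow> 0 \<le> u i x"
    "\<And>i. sum (u i) (S i) = 1" "\<And>i. (\<Sum>v\<in>S i. u i v *\<^sub>R v) = c i"
    by metis
  define w where "w i B = sum (u i) (S i \<inter> B)" for i B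
  have w0: "0 \<le> w i B" for i B
    unfolding w_def using S(3) by (auto intro!: sum_nonneg)
  have "w i B \<le> sum (u i) (S i)" for i B
    unfolding w_def using S(1,3) by (intro sum_mono2) auto
  then have w1: "w i B \<le> 1" for i B
    using S(4) by simp
  have wabs: "\<bar>w i B\<bar> \<le> 1" for i B
    using w0[of i B] w1[of i B] by simp
  define \<nu> where "\<nu> B = Lim F (\<lambda>i. w i B)" for B
  have lim: "((\<lambda>i. w i B) \<longlongrightarrow> \<nu> B) F" for B
    unfolding \<nu>_def by (rule ultra_tendsto_Lim[OF F wabs])
  note Fbot = ultra_nontrivial[OF F]
  interpret content \<nu>
  proof
    show "0 \<le> \<nu> B" for B
      by (rule tendsto_lowerbound[OF lim _ Fbot]) (simp add: w0)
    show "\<nu> B \<le> 1" for B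
      by (rule tendsto_upperbound[OF lim _ Fbot]) (simp add: w1)
    show "\<nu> (B \<union> C) = \<nu> B + \<nu> C" if "B \<inter> C = {}" for B C
    proof -
      have "w i (B \<union> C) = w i B + w i C" for i
        unfolding w_def Int_Un_distrib using S(1) that by (intro sum.union_disjoint) auto
      then show ?thesis
        using tendsto_unique[OF Fbot lim[of "B \<union> C"]] tendsto_add[OF lim[of B] lim[of C]] by simp
    qed
  qed
  define E where "E g = {a\<in>A. \<bar>p a g - \<xi> a\<bar> \<ge> e/2}" for g
  obtain g0 where g0: "g0 \<in> G" using appr[of "{}" 1] by auto
  have \<xi>b: "\<bar>\<xi> a\<bar> \<le> M + 1" if "a \<in> A" for a
  proof -
    obtain g where "g \<in> G" "\<bar>p a g - \<xi> a\<bar> < 1" using appr[of "{a}" 1] \<open>a \<in> A\<close> by auto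
    then show ?thesis using bd[of a g] GY that by force
  qed
  have "A \<noteq> {}" using c by force
  then have M0: "M \<ge> 0" using bd g0 GY by (metis abs_ge_zero all_not_in_conv order_trans subsetD)
  define K where "K = 2 * M + 1"
  have K: "K > 0" using M0 by (simp add: K_def)
  have est: "\<bar>p (c i) g - \<xi> (c i)\<bar> \<le> e/2 + K * w i (E g)" if g: "g \<in> G" for i g
  proof -
    have gY: "g \<in> Y" using g GY by blast
    have "p (c i) g = (\<Sum>v\<in>S i. u i v * p v g)"
      unfolding S(5)[symmetric] using linear_sum[OF lin[OF gY], of "\<lambda>v. u i v *\<^sub>R v" "S i"]
        linear_scale[OF lin[OF gY]] by simp
    moreover have "\<xi> (c i) = (\<Sum>v\<in>S i. u i v * \<xi> v)"
      unfolding S(5)[symmetric] using linear_sum[OF \<xi>, of "\<lambda>v. u i v *\<^sub>R v" "S i"]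
        linear_scale[OF \<xi>] by simp
    ultimately have "\<bar>p (c i) g - \<xi> (c i)\<bar> = \<bar>\<Sum>v\<in>S i. u i v * (p v g - \<xi> v)\<bar>"
      by (simp add: sum_subtractf right_diff_distrib)
    also have "\<dots> \<le> (\<Sum>v\<in>S i. u i v * \<bar>p v g - \<xi> v\<bar>)"
      by (rule order_trans[OF sum_abs]) (simp add: abs_mult S(3) sum_mono)
    also have "\<dots> \<le> (\<Sum>v\<in>S i. u i v * (e/2) + (if v \<in> E g then K * u i v else 0))"
    proof (rule sum_mono)
      fix v assume v: "v \<in> S i"
      then have vA: "v \<in> A" using S(2) by blast
      have "\<bar>p v g - \<xi> v\<bar> \<le> K"
        using bd[OF vA gY] \<xi>b[OF vA] by (simp add: K_def)
      then have "\<bar>p v g - \<xi> v\<bar> \<le> e/2 + (if v \<in> E g then K else 0)"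
        using vA e by (auto simp: E_def)
      from mult_left_mono[OF this S(3)[OF v]]
      show "u i v * \<bar>p v g - \<xi> v\<bar> \<le> u i v * (e/2) + (if v \<in> E g then K * u i v else 0)"
        by (auto simp: algebra_simps split: if_splits)
    qed
    also have "\<dots> = (\<Sum>v\<in>S i. u i v) * (e/2) + K * w i (E g)"
      unfolding sum.distrib w_def sum_distrib_right sum_distrib_left using S(1)[of i]
      by (simp add: sum.If_cases)
    also have "\<dots> = e/2 + K * w i (E g)" by (simp add: S(4))
    finally show ?thesis .
  qed
  define d where "d = e / 2 / K"
  have d: "d > 0" using e K by (simp add: d_def)
  have \<nu>E: "\<nu> (E g) \<ge> d" if g: "g \<in> G" for g
  proof (rule tendsto_lowerbound[OF lim _ Fbot])
    have "\<not> eventually (\<lambda>i. \<bar>p (c i) g - \<xi> (c i)\<bar> < e) F" using contra g by blast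
    then have "eventually (\<lambda>i. \<not> \<bar>p (c i) g - \<xi> (c i)\<bar> < e) F" using ultra_cases[OF F] by blast
    then show "eventually (\<lambda>i. d \<le> w i (E g)) F"
    proof (rule eventually_mono)
      fix i assume "\<not> \<bar>p (c i) g - \<xi> (c i)\<bar> < e"
      with est[OF g, of i] have "e/2 \<le> K * w i (E g)" by simp
      then show "d \<le> w i (E g)" unfolding d_def using K by (simp add: field_simps)
    qed
  qed
  obtain U where U: "ultra U" "eventually (\<lambda>g. g \<in> G) U"
      "\<And>a. a \<in> A \<Longrightarrow> ((\<lambda>g. p a g) \<longlongrightarrow> \<xi> a) U"
    using ex_ultra_approx[of A G "\<lambda>g a. p a g" \<xi>, OF appr] by blast
  let ?good = "\<lambda>B. Lim U (\<lambda>h. \<nu> (B \<inter> E h)) > 0"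
  have good0: "?good UNIV"
  proof (rule less_le_trans[OF d tendsto_lowerbound[OF ultra_tendsto_Lim[OF U(1) \<nu>_abs] _ ultra_nontrivial[OF U(1)]]])
    show "eventually (\<lambda>g. d \<le> \<nu> (UNIV \<inter> E g)) U"
      using U(2) by (rule eventually_mono) (simp add: \<nu>E)
  qed
  have step: "\<exists>g a. g \<in> G \<and> a \<in> B \<inter> E g \<and> (\<forall>z\<in>Z. \<bar>p z g - \<xi> z\<bar> < \<delta>) \<and> ?good (B \<inter> E g)"
    if B: "?good B" and Z: "finite Z" "Z \<subseteq> A" and \<delta>: "\<delta> > 0" for B Z \<delta>
  proof -
    have "eventually (\<lambda>g. \<forall>z\<in>Z. \<bar>p z g - \<xi> z\<bar> < \<delta>) U"
    proof (rule eventually_ball_finite[OF Z(1)], rule ballI)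
      fix z assume "z \<in> Z"
      then show "eventually (\<lambda>g. \<bar>p z g - \<xi> z\<bar> < \<delta>) U"
        using tendstoD[OF U(3) \<delta>, of z] Z(2) by (auto simp: dist_real_def)
    qed
    with U(2) have "eventually (\<lambda>g. g \<in> G \<and> (\<forall>z\<in>Z. \<bar>p z g - \<xi> z\<bar> < \<delta>)) U"
      by (rule eventually_conj)
    from ex_good[OF U(1) B this] obtain g where g: "g \<in> G" "\<forall>z\<in>Z. \<bar>p z g - \<xi> z\<bar> < \<delta>" "?good (B \<inter> E g)"
      by blast
    have "B \<inter> E g \<noteq> {}"
    proof
      assume "B \<inter> E g = {}"
      with g(3) have "Lim U (\<lambda>h. 0::real) > 0" by (simp add: \<nu>_empty)
      moreover have "Lim U (\<lambda>h. 0::real) = 0"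
        by (rule tendsto_Lim[OF ultra_nontrivial[OF U(1)] tendsto_const])
      ultimately show False by simp
    qed
    with g show ?thesis by blast
  qed
  let ?P = "\<lambda>n::nat. \<lambda>(B, Z, g, a). finite Z \<and> Z \<subseteq> A \<and> g \<in> G \<and> a \<in> B \<and> a \<in> Z \<and> B \<subseteq> E g \<and> ?good B"
  let ?Q = "\<lambda>n::nat. \<lambda>(B, Z, g, a). \<lambda>(B', Z', g', a').
     Z \<subseteq> Z' \<and> B' \<subseteq> B \<and> (\<forall>z\<in>Z. \<bar>p z g' - \<xi> z\<bar> < 1 / real (Suc n))"
  have "\<exists>f. \<forall>n. ?P n (f n) \<and> ?Q n (f n) (f (Suc n))"
  proof (rule dependent_nat_choice)
    obtain g a where "g \<in> G" "a \<in> E g" "?good (E g)"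
      using step[OF good0, of "{}" 1] by auto
    then show "\<exists>x. ?P 0 x"
      by (intro exI[of _ "(E g, {a}, g, a)"]) (auto simp: E_def)
  next
    fix x n assume Px: "?P n x"
    obtain B Z g a where x: "x = (B, Z, g, a)" by (cases x)
    have Z: "finite Z" "Z \<subseteq> A" and B: "?good B" using Px x by auto
    obtain g' a' where "g' \<in> G" "a' \<in> B \<inter> E g'" "\<forall>z\<in>Z. \<bar>p z g' - \<xi> z\<bar> < 1 / real (Suc n)"
      "?good (B \<inter> E g')"
      using step[OF B Z, of "1 / real (Suc n)"] by auto
    then show "\<exists>y. ?P (Suc n) y \<and> ?Q n x y"
      using Z x by (intro exI[of _ "(B \<inter> E g', insert a' Z, g', a')"]) (auto simp: E_def)
  qed
  then obtain f where f: "\<forall>n. ?P n (f n) \<and> ?Q n (f n) (f (Suc n))" by (rule exE)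
  define B where "B n = fst (f n)" for n
  define Z where "Z n = fst (snd (f n))" for n
  define g where "g n = fst (snd (snd (f n)))" for n
  define a where "a n = snd (snd (snd (f n)))" for n
  have f_eq: "f n = (B n, Z n, g n, a n)" for n
    by (simp add: B_def Z_def g_def a_def)
  have P: "finite (Z n)" "Z n \<subseteq> A" "g n \<in> G" "a n \<in> B n" "a n \<in> Z n" "B n \<subseteq> E (g n)" for n
    using f[rule_format, of n] by (auto simp: f_eq)
  have Q: "Z n \<subseteq> Z (Suc n)" "B (Suc n) \<subseteq> B n" "\<And>z. z \<in> Z n \<Longrightarrow> \<bar>p z (g (Suc n)) - \<xi> z\<bar> < 1 / real (Suc n)" for n
    using f[rule_format, of n] by (auto simp: f_eq)
  have Zmono: "Z m \<subseteq> Z n" and Bmono: "B n \<subseteq> B m" if "m \<le> n" for m n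
    using lift_Suc_mono_le[of Z, OF Q(1) that] lift_Suc_antimono_le[of B, OF Q(2) that] by auto
  have aA: "a n \<in> A" for n using P(2,5) by blast
  have far: "\<bar>p (a k) (g j) - \<xi> (a k)\<bar> \<ge> e/2" if "j \<le> k" for j k
    using P(4)[of k] Bmono[OF that] P(6)[of j] by (auto simp: E_def)
  have near: "\<bar>p (a k) (g j) - \<xi> (a k)\<bar> < 1 / real j" if "k < j" for j k
    using Q(3)[of "a k" "j - 1"] Zmono[of k "j - 1"] P(5)[of k] that by (cases j) auto
  have pb: "\<bar>p (a k) (g j)\<bar> \<le> M" for j k
    using bd aA P(3) GY by blast
  define c' where "c' = Lim \<omega> (\<lambda>k. \<xi> (a k))"
  define l where "l j = Lim \<omega> (\<lambda>k. p (a k) (g j))" for j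
  have c'l: "((\<lambda>k. \<xi> (a k)) \<longlongrightarrow> c') \<omega>"
    unfolding c'_def by (rule tendsto_\<omega>_Lim[OF \<xi>b[OF aA]])
  have ll: "((\<lambda>k. p (a k) (g j)) \<longlongrightarrow> l j) \<omega>" for j
    unfolding l_def by (rule tendsto_\<omega>_Lim[OF pb])
  have "\<bar>l j\<bar> \<le> M" for j
    unfolding l_def by (rule abs_Lim_\<omega>_le[OF pb])
  then have lL: "(l \<longlongrightarrow> Lim \<omega> l) \<omega>" by (rule tendsto_\<omega>_Lim)
  have lc: "\<bar>l j - c'\<bar> \<ge> e/2" for j
  proof (rule tendsto_lowerbound)
    show "((\<lambda>k. \<bar>p (a k) (g j) - \<xi> (a k)\<bar>) \<longlongrightarrow> \<bar>l j - c'\<bar>) \<omega>"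
      by (intro tendsto_intros ll c'l)
    have "eventually (\<lambda>k. j \<le> k) \<omega>"
      using \<omega>_props(1) eventually_ge_at_top by (rule filter_leD)
    then show "eventually (\<lambda>k. e/2 \<le> \<bar>p (a k) (g j) - \<xi> (a k)\<bar>) \<omega>"
      by (rule eventually_mono) (rule far)
  qed simp
  have Lc: "\<bar>Lim \<omega> l - c'\<bar> \<ge> e/2"
    by (rule tendsto_lowerbound[OF tendsto_rabs[OF tendsto_diff[OF lL tendsto_const]]])
      (use lc in auto)
  have pa: "((\<lambda>j. p (a k) (g j)) \<longlongrightarrow> \<xi> (a k)) \<omega>" for k
  proof (rule tendsto_\<omega>I, rule LIM_zero_cancel, rule Lim_null_comparison)
    show "(\<lambda>j. 1 / real j) \<longlonglongrightarrow> 0" by real_asymp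
    show "eventually (\<lambda>j. norm (p (a k) (g j) - \<xi> (a k)) \<le> 1 / real j) sequentially"
      using eventually_gt_at_top[of k] by (rule eventually_mono) (simp add: near less_imp_le)
  qed
  have "c' = Lim \<omega> l"
    using stableD[OF stab aA _ pa c'l ll lL] P(3) GY by blast
  then show False using Lc e by simp
qed

lemma stable_convex_hull:
  fixes p :: "'a::real_vector \<Rightarrow> 'y \<Rightarrow> real"
  assumes stab: "stable A Y p"
    and bd: "\<And>a y. a \<in> A \<Longrightarrow> y \<in> Y \<Longrightarrow> \<bar>p a y\<bar> \<le> M"
    and lin: "\<And>y. y \<in> Y \<Longrightarrow> linear (\<lambda>a. p a y)"
    and bd': "\<And>a. \<exists>K. \<forall>y\<in>Y. \<bar>p a y\<bar> \<le> K"
  shows "stable (convex hull A) Y p"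
  unfolding stable_def
proof (intro allI impI)
  fix c :: "nat \<Rightarrow> 'a" and y :: "nat \<Rightarrow> 'y"
  assume "range c \<subseteq> convex hull A \<and> range y \<subseteq> Y"
  then have c: "\<And>i. c i \<in> convex hull A" and y: "\<And>j. y j \<in> Y" by auto
  define \<xi> where "\<xi> a = Lim \<omega> (\<lambda>j. p a (y j))" for a
  have \<xi>l: "((\<lambda>j. p a (y j)) \<longlongrightarrow> \<xi> a) \<omega>" for a
  proof -
    obtain K where "\<And>j. \<bar>p a (y j)\<bar> \<le> K" using bd'[of a] y by blast
    then show ?thesis unfolding \<xi>_def by (rule tendsto_\<omega>_Lim)
  qed
  have lin\<xi>: "linear \<xi>"
  proof (rule linearI)
    fix a b :: 'a and r :: real
    have "((\<lambda>j. p (a + b) (y j)) \<longlongrightarrow> \<xi> a + \<xi> b) \<omega>"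
      using tendsto_add[OF \<xi>l[of a] \<xi>l[of b]] linear_add[OF lin[OF y]] by simp
    then show "\<xi> (a + b) = \<xi> a + \<xi> b" using \<xi>l[of "a + b"] tendsto_unique \<omega>_bot by blast
    have "((\<lambda>j. p (r *\<^sub>R a) (y j)) \<longlongrightarrow> r *\<^sub>R \<xi> a) \<omega>"
      using tendsto_mult[OF tendsto_const[of r] \<xi>l[of a]] linear_scale[OF lin[OF y]] by simp
    then show "\<xi> (r *\<^sub>R a) = r *\<^sub>R \<xi> a" using \<xi>l[of "r *\<^sub>R a"] tendsto_unique \<omega>_bot by blast
  qed
  have pM: "\<bar>p a z\<bar> \<le> M" if a: "a \<in> convex hull A" and z: "z \<in> Y" for a z
  proof -
    have "convex hull A \<subseteq> (\<lambda>a. p a z) -` {-M..M}"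
      by (rule hull_minimal)
        (use bd z in \<open>auto simp: abs_le_iff minus_le_iff intro!: convex_linear_vimage[OF lin[OF z]]\<close>)
    from subsetD[OF this a] show ?thesis by (simp add: abs_le_iff)
  qed
  have \<xi>M: "\<bar>\<xi> (c i)\<bar> \<le> M" for i
    unfolding \<xi>_def by (rule abs_Lim_\<omega>_le) (rule pM[OF c y])
  define b where "b j = Lim \<omega> (\<lambda>i. p (c i) (y j))" for j
  have bl: "((\<lambda>i. p (c i) (y j)) \<longlongrightarrow> b j) \<omega>" for j
    unfolding b_def by (rule tendsto_\<omega>_Lim) (rule pM[OF c y])
  have "\<bar>b j\<bar> \<le> M" for j
    unfolding b_def by (rule abs_Lim_\<omega>_le) (rule pM[OF c y])
  then have bL: "(b \<longlongrightarrow> Lim \<omega> b) \<omega>" by (rule tendsto_\<omega>_Lim)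
  have \<xi>L: "((\<lambda>i. \<xi> (c i)) \<longlongrightarrow> Lim \<omega> (\<lambda>i. \<xi> (c i))) \<omega>"
    by (rule tendsto_\<omega>_Lim) (rule \<xi>M)
  have "\<bar>Lim \<omega> (\<lambda>i. \<xi> (c i)) - Lim \<omega> b\<bar> \<le> 2 * e" if e: "e > 0" for e
  proof -
    let ?G = "y ` {j. \<bar>b j - Lim \<omega> b\<bar> < e}"
    have appr: "\<exists>g\<in>?G. \<forall>a\<in>Z. \<bar>p a g - \<xi> a\<bar> < r" if Z: "finite Z" "r > 0" for Z r
    proof -
      have "eventually (\<lambda>j. \<forall>a\<in>Z. \<bar>p a (y j) - \<xi> a\<bar> < r) \<omega>"
        using tendstoD[OF \<xi>l Z(2)] by (intro eventually_ball_finite[OF Z(1)]) (simp add: dist_real_def)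
      moreover have "eventually (\<lambda>j. \<bar>b j - Lim \<omega> b\<bar> < e) \<omega>"
        using tendstoD[OF bL e] by (simp add: dist_real_def)
      ultimately have "eventually (\<lambda>j. (\<forall>a\<in>Z. \<bar>p a (y j) - \<xi> a\<bar> < r) \<and> \<bar>b j - Lim \<omega> b\<bar> < e) \<omega>"
        by (rule eventually_conj)
      from eventually_happens'[OF \<omega>_bot this] show ?thesis by blast
    qed
    have "\<exists>g\<in>?G. eventually (\<lambda>i. \<bar>p (c i) g - \<xi> (c i)\<bar> < e) \<omega>"
      by (rule stable_convex_hull_approx[where Y=Y and A=A and M=M])
        (use stab bd lin lin\<xi> \<omega>_props(2) c y appr e in auto)
    then obtain j where j: "\<bar>b j - Lim \<omega> b\<bar> < e" "eventually (\<lambda>i. \<bar>p (c i) (y j) - \<xi> (c i)\<bar> < e) \<omega>"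
      by blast
    have "\<bar>b j - Lim \<omega> (\<lambda>i. \<xi> (c i))\<bar> \<le> e"
      by (rule tendsto_upperbound[OF tendsto_rabs[OF tendsto_diff[OF bl \<xi>L]]])
        (use j(2) in \<open>auto elim: eventually_mono\<close>)
    with j(1) show ?thesis by simp
  qed
  from this[of "\<bar>Lim \<omega> (\<lambda>i. \<xi> (c i)) - Lim \<omega> b\<bar> / 4"]
  have "Lim \<omega> (\<lambda>i. \<xi> (c i)) = Lim \<omega> b" by fastforce
  then show "Lim \<omega> (\<lambda>i. Lim \<omega> (\<lambda>j. p (c i) (y j))) = Lim \<omega> (\<lambda>j. Lim \<omega> (\<lambda>i. p (c i) (y j)))"
    by (simp add: \<xi>_def b_def[abs_def])
qed

section \<open>Sublinear functionals\<close>

definition sublinear :: "('a::real_vector \<Rightarrow> real) \<Rightarrow> bool"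
  where "sublinear q \<longleftrightarrow> (\<forall>x y. q (x + y) \<le> q x + q y) \<and> (\<forall>t>0. \<forall>x. q (t *\<^sub>R x) \<le> t * q x)"

lemma sublinear_add: "sublinear q \<Longrightarrow> q (x + y) \<le> q x + q y"
  and sublinear_scale_le: "sublinear q \<Longrightarrow> t > 0 \<Longrightarrow> q (t *\<^sub>R x) \<le> t * q x"
  by (auto simp: sublinear_def)

lemma sublinear_0: "sublinear q \<Longrightarrow> q 0 = 0"
  using sublinear_scale_le[of q 2 0] sublinear_scale_le[of q "1/2" 0] by simp

lemma sublinear_scale:
  assumes "sublinear q" "t \<ge> 0"
  shows "q (t *\<^sub>R x) = t * q x"
proof (cases "t = 0")
  case False
  then have t: "t > 0" using assms by simp
  have "q x \<le> (1/t) * q (t *\<^sub>R x)"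
    using sublinear_scale_le[OF assms(1), of "1/t" "t *\<^sub>R x"] t by simp
  then show ?thesis
    using sublinear_scale_le[OF assms(1) t, of x] t by (simp add: field_simps)
qed (simp add: sublinear_0[OF assms(1)])

lemma sublinear_neg: "sublinear q \<Longrightarrow> - q (- x) \<le> q x"
  using sublinear_add[of q x "- x"] sublinear_0[of q] by simp

lemma sublinear_improve:
  fixes q :: "'a::real_vector \<Rightarrow> real" and P :: "('a \<times> real) set"
  assumes q: "sublinear q" and P0: "(0, 0) \<in> P"
    and Padd: "\<And>u r v s. (u, r) \<in> P \<Longrightarrow> (v, s) \<in> P \<Longrightarrow> (u + v, r + s) \<in> P"
    and Pscale: "\<And>u r t. (u, r) \<in> P \<Longrightarrow> t > 0 \<Longrightarrow> (t *\<^sub>R u, t * r) \<in> P"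
    and Pq: "\<And>u r. (u, r) \<in> P \<Longrightarrow> r \<le> q u"
  shows "\<exists>q'. sublinear q' \<and> (\<forall>x. q' x \<le> q x) \<and> (\<forall>(u, r)\<in>P. q' (- u) \<le> - r)"
proof -
  define f where "f x = (\<lambda>(u, r). q (x + u) - r)" for x
  define q' where "q' x = (INF i\<in>P. f x i)" for x
  have "- q (- x) \<le> f x i" if "i \<in> P" for x i
    using Pq[of "fst i" "snd i"] that sublinear_add[OF q, of "x + fst i" "- x"]
    by (auto simp: f_def split: prod.splits)
  then have bdd: "bdd_below (f x ` P)" for x by fast
  have le: "q' x \<le> f x i" if "i \<in> P" for x i
    unfolding q'_def by (rule cINF_lower[OF bdd that])
  have ne: "P \<noteq> {}" using P0 by auto
  have "q' (x + y) \<le> q' x + q' y" for x y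
  proof -
    have "q' (x + y) - f x i \<le> f y j" if "i \<in> P" "j \<in> P" for i j
    proof -
      obtain u r v s where ij: "i = (u, r)" "j = (v, s)" by fastforce
      have "q' (x + y) \<le> f (x + y) (u + v, r + s)" using le Padd that ij by blast
      also have "\<dots> \<le> f x i + f y j"
        using sublinear_add[OF q, of "x + u" "y + v"] by (simp add: f_def ij algebra_simps)
      finally show ?thesis by simp
    qed
    then have "q' (x + y) - f x i \<le> q' y" if "i \<in> P" for i
      unfolding q'_def[of y] using that ne by (intro cINF_greatest) auto
    from this have "q' (x + y) - q' y \<le> f x i" if "i \<in> P" for i
      using that by (metis diff_le_eq diff_le_eq add.commute)
    then have "q' (x + y) - q' y \<le> q' x"
      unfolding q'_def[of x] using ne by (intro cINF_greatest) auto
    then show ?thesis by simp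
  qed
  moreover have "q' (t *\<^sub>R x) \<le> t * q' x" if t: "t > 0" for t x
  proof -
    have "q' (t *\<^sub>R x) / t \<le> f x i" if "i \<in> P" for i
    proof -
      obtain u r where i: "i = (u, r)" by fastforce
      have "q' (t *\<^sub>R x) \<le> f (t *\<^sub>R x) (t *\<^sub>R u, t * r)" using le Pscale that i t by blast
      also have "\<dots> \<le> t * f x i"
        using sublinear_scale_le[OF q t, of "x + u"] by (simp add: f_def i algebra_simps)
      finally show ?thesis using t by (simp add: field_simps)
    qed
    then have "q' (t *\<^sub>R x) / t \<le> q' x"
      unfolding q'_def[of x] using ne by (intro cINF_greatest) auto
    then show ?thesis using t by (simp add: field_simps)
  qed
  ultimately have "sublinear q'" by (auto simp: sublinear_def)
  moreover have "q' x \<le> q x" for x using le[OF P0, of x] by (simp add: f_def)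
  moreover have "q' (- u) \<le> - r" if "(u, r) \<in> P" for u r
    using le[OF that, of "- u"] by (simp add: f_def sublinear_0[OF q])
  ultimately show ?thesis by blast
qed

(* A minimal sublinear functional is linear. *)
lemma Hahn_Banach_sublinear:
  assumes q: "sublinear q"
  shows "\<exists>\<psi>. linear \<psi> \<and> (\<forall>x. \<psi> x \<le> q x)"
proof -
  define A where "A = {q'. sublinear q' \<and> (\<forall>x. q' x \<le> q x)}"
  have "\<exists>m\<in>A. \<forall>a\<in>A. a \<le> m \<longrightarrow> a = m"
  proof (rule predicate_Zorn[where P="\<lambda>a b. b \<le> a"])
    show "partial_order_on A (relation_of (\<lambda>a b. b \<le> a) A)"
      by (rule partial_order_on_relation_ofI) auto
    fix C assume "C \<in> Chains (relation_of (\<lambda>a b. b \<le> a) A)"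
    then have CA: "C \<subseteq> A" and chain: "\<And>a b. a \<in> C \<Longrightarrow> b \<in> C \<Longrightarrow> a \<le> b \<or> b \<le> a"
      by (auto simp: Chains_def relation_of_def)
    show "\<exists>u\<in>A. \<forall>a\<in>C. u \<le> a"
    proof (cases "C = {}")
      case True
      then show ?thesis using q by (auto simp: A_def)
    next
      case False
      define u where "u x = (INF c\<in>C. c x)" for x
      have "- q (- x) \<le> c x" if "c \<in> C" for c x
      proof -
        have "sublinear c" "c (- x) \<le> q (- x)" using that CA by (auto simp: A_def)
        then show ?thesis using sublinear_neg[of c x] by simp
      qed
      then have bdd: "bdd_below ((\<lambda>c. c x) ` C)" for x by fast
      have le: "u x \<le> c x" if "c \<in> C" for c x
        unfolding u_def by (rule cINF_lower[OF bdd that])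
      have "u (x + y) \<le> u x + u y" for x y
      proof -
        have *: "u (x + y) - c x \<le> d y" if cd: "c \<in> C" "d \<in> C" for c d
        proof -
          obtain b where b: "b \<in> C" "b \<le> c" "b \<le> d" using chain[OF cd] cd by blast
          have "u (x + y) \<le> b (x + y)" using le b by blast
          also have "\<dots> \<le> b x + b y" using b CA by (auto simp: A_def sublinear_def)
          also have "\<dots> \<le> c x + d y" using b by (simp add: add_mono le_funD)
          finally show ?thesis by simp
        qed
        have "u (x + y) - c x \<le> u y" if "c \<in> C" for c
          unfolding u_def[of y] using that * False by (intro cINF_greatest) auto
        from this have "u (x + y) - u y \<le> c x" if "c \<in> C" for c
          using that by (metis diff_le_eq add.commute)
        then have "u (x + y) - u y \<le> u x"
          unfolding u_def[of x] using False by (intro cINF_greatest) auto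
        then show ?thesis by simp
      qed
      moreover have "u (t *\<^sub>R x) \<le> t * u x" if t: "t > 0" for t x
      proof -
        have "u (t *\<^sub>R x) / t \<le> c x" if "c \<in> C" for c
        proof -
          have "u (t *\<^sub>R x) \<le> c (t *\<^sub>R x)" using le that by blast
          also have "\<dots> \<le> t * c x" using that CA t by (auto simp: A_def sublinear_def)
          finally show ?thesis using t by (simp add: field_simps)
        qed
        then have "u (t *\<^sub>R x) / t \<le> u x"
          unfolding u_def[of x] using False by (intro cINF_greatest) auto
        then show ?thesis using t by (simp add: field_simps)
      qed
      moreover have "u x \<le> q x" for x
      proof -
        obtain c where "c \<in> C" using False by blast
        then have "c x \<le> q x" using CA by (auto simp: A_def)
        then show ?thesis using le[OF \<open>c \<in> C\<close>, of x] by simp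
      qed
      ultimately have "u \<in> A" by (auto simp: A_def sublinear_def)
      moreover have "\<forall>a\<in>C. u \<le> a" using le by (auto simp: le_fun_def)
      ultimately show ?thesis by blast
    qed
  qed
  then obtain m where m: "m \<in> A" and min: "\<And>a. a \<in> A \<Longrightarrow> a \<le> m \<Longrightarrow> a = m" by blast
  have sm: "sublinear m" and mq: "\<And>x. m x \<le> q x" using m by (auto simp: A_def)
  have neg: "m (- a) = - m a" for a
  proof -
    let ?P = "{(t *\<^sub>R a, t * m a) | t. t \<ge> 0}"
    have "\<exists>q'. sublinear q' \<and> (\<forall>x. q' x \<le> m x) \<and> (\<forall>(u, r)\<in>?P. q' (- u) \<le> - r)"
    proof (rule sublinear_improve[OF sm])
      show "(0, 0) \<in> ?P" by (auto intro!: exI[of _ 0])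
      show "(u + v, r + s) \<in> ?P" if "(u, r) \<in> ?P" "(v, s) \<in> ?P" for u r v s
        using that by (auto simp: scaleR_add_left[symmetric] distrib_right[symmetric])
      show "(t *\<^sub>R u, t * r) \<in> ?P" if "(u, r) \<in> ?P" "t > 0" for u r t
        using that by clarsimp (metis mult_nonneg_nonneg less_imp_le mult.assoc)
      show "r \<le> m u" if "(u, r) \<in> ?P" for u r
        using that by (auto simp: sublinear_scale[OF sm])
    qed
    then obtain q' where q': "sublinear q'" "\<And>x. q' x \<le> m x" "\<And>u r. (u, r) \<in> ?P \<Longrightarrow> q' (- u) \<le> - r"
      by blast
    have "q' = m"
      using q'(1,2) mq by (intro min) (auto simp: A_def le_fun_def intro: order_trans)
    moreover have "(a, m a) \<in> ?P" by (auto intro!: exI[of _ 1])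
    ultimately have "m (- a) \<le> - m a" using q'(3) by blast
    then show ?thesis using sublinear_neg[OF sm, of a] by simp
  qed
  have "linear m"
  proof (rule linearI)
    show "m (x + y) = m x + m y" for x y
      using sublinear_add[OF sm, of x y] sublinear_add[OF sm, of "x + y" "- y"] neg[of y] by simp
    show "m (t *\<^sub>R x) = t *\<^sub>R m x" for t x
    proof (cases "t \<ge> 0")
      case True
      then show ?thesis by (simp add: sublinear_scale[OF sm])
    next
      case False
      then have "m ((- t) *\<^sub>R x) = (- t) * m x" by (intro sublinear_scale[OF sm]) simp
      then show ?thesis using neg[of "t *\<^sub>R x"] by simp
    qed
  qed
  with mq show ?thesis by blast
qed

lemma Mazur_Orlicz:
  fixes q :: "'a::real_vector \<Rightarrow> real" and P :: "('a \<times> real) set"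
  assumes "sublinear q" "(0, 0) \<in> P"
    and "\<And>u r v s. (u, r) \<in> P \<Longrightarrow> (v, s) \<in> P \<Longrightarrow> (u + v, r + s) \<in> P"
    and "\<And>u r t. (u, r) \<in> P \<Longrightarrow> t > 0 \<Longrightarrow> (t *\<^sub>R u, t * r) \<in> P"
    and "\<And>u r. (u, r) \<in> P \<Longrightarrow> r \<le> q u"
  shows "\<exists>\<psi>. linear \<psi> \<and> (\<forall>x. \<psi> x \<le> q x) \<and> (\<forall>(u, r)\<in>P. r \<le> \<psi> u)"
proof -
  obtain q' where q': "sublinear q'" "\<And>x. q' x \<le> q x" "\<And>u r. (u, r) \<in> P \<Longrightarrow> q' (- u) \<le> - r"
    using sublinear_improve[OF assms] by blast
  obtain \<psi> where \<psi>: "linear \<psi>" "\<And>x. \<psi> x \<le> q' x"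
    using Hahn_Banach_sublinear[OF q'(1)] by blast
  have "r \<le> \<psi> u" if "(u, r) \<in> P" for u r
    using \<psi>(2)[of "- u"] q'(3)[OF that] linear_neg[OF \<psi>(1), of u] by simp
  then show ?thesis using \<psi> q'(2) by (blast intro: order_trans)
qed

lemma Hahn_Banach_point:
  assumes q: "sublinear q"
  shows "\<exists>\<psi>. linear \<psi> \<and> (\<forall>x. \<psi> x \<le> q x) \<and> \<psi> e = q e"
proof -
  let ?P = "{(t *\<^sub>R e, t * q e) | t. t \<ge> 0}"
  have "\<exists>\<psi>. linear \<psi> \<and> (\<forall>x. \<psi> x \<le> q x) \<and> (\<forall>(u, r)\<in>?P. r \<le> \<psi> u)"
  proof (rule Mazur_Orlicz[OF q])
    show "(0, 0) \<in> ?P" by (auto intro!: exI[of _ 0])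
    show "(u + v, r + s) \<in> ?P" if "(u, r) \<in> ?P" "(v, s) \<in> ?P" for u r v s
      using that by (auto simp: scaleR_add_left[symmetric] distrib_right[symmetric])
    show "(t *\<^sub>R u, t * r) \<in> ?P" if "(u, r) \<in> ?P" "t > 0" for u r t
      using that by clarsimp (metis mult_nonneg_nonneg less_imp_le mult.assoc)
    show "r \<le> q u" if "(u, r) \<in> ?P" for u r
      using that by (auto simp: sublinear_scale[OF q])
  qed
  moreover have "(e, q e) \<in> ?P" by (auto intro!: exI[of _ 1])
  ultimately show ?thesis by (metis (no_types, lifting) case_prodD order_antisym)
qed

lemma convex_separation:
  fixes p :: "'a::real_vector \<Rightarrow> real"
  assumes p: "sublinear p" and C: "convex C" "C \<noteq> {}" and far: "\<And>c. c \<in> C \<Longrightarrow> e \<le> p (z - c)"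
  shows "\<exists>\<psi>. linear \<psi> \<and> (\<forall>x. \<psi> x \<le> p x) \<and> (\<forall>c\<in>C. \<psi> c + e \<le> \<psi> z)"
proof -
  let ?P = "{(t *\<^sub>R (z - c), t * e) | t c. t \<ge> 0 \<and> c \<in> C}"
  have "\<exists>\<psi>. linear \<psi> \<and> (\<forall>x. \<psi> x \<le> p x) \<and> (\<forall>(u, r)\<in>?P. r \<le> \<psi> u)"
  proof (rule Mazur_Orlicz[OF p])
    obtain c where "c \<in> C" using C(2) by blast
    then show "(0, 0) \<in> ?P" by (auto intro!: exI[of _ 0] exI[of _ c])
    show "(u + v, r + s) \<in> ?P" if ur: "(u, r) \<in> ?P" "(v, s) \<in> ?P" for u r v s
    proof -
      obtain t c t' c' where tc: "u = t *\<^sub>R (z - c)" "r = t * e" "t \<ge> 0" "c \<in> C"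
        "v = t' *\<^sub>R (z - c')" "s = t' * e" "t' \<ge> 0" "c' \<in> C"
        using ur by auto
      show ?thesis
      proof (cases "t + t' = 0")
        case True
        then have "t = 0" "t' = 0" using tc by auto
        then show ?thesis using tc by (auto intro!: exI[of _ 0] exI[of _ c])
      next
        case False
        define d where "d = (t / (t + t')) *\<^sub>R c + (t' / (t + t')) *\<^sub>R c'"
        have "d \<in> C"
          unfolding d_def using tc False by (intro convexD[OF C(1)]) (auto simp: add_divide_distrib[symmetric])
        moreover have "u + v = (t + t') *\<^sub>R (z - d)"
        proof -
          have "(t + t') *\<^sub>R d = t *\<^sub>R c + t' *\<^sub>R c'"
            unfolding d_def scaleR_add_right using False by simp
          then show ?thesis unfolding tc by (simp add: algebra_simps)
        qed
        moreover have "r + s = (t + t') * e" using tc by (simp add: distrib_right)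
        ultimately show ?thesis using tc by (auto intro!: exI[of _ "t + t'"])
      qed
    qed
    show "(t *\<^sub>R u, t * r) \<in> ?P" if "(u, r) \<in> ?P" "t > 0" for u r t
      using that by clarsimp (metis mult_nonneg_nonneg less_imp_le mult.assoc)
    show "r \<le> p u" if "(u, r) \<in> ?P" for u r
      using that far by (auto simp: sublinear_scale[OF p] intro!: mult_left_mono)
  qed
  then obtain \<psi> where \<psi>: "linear \<psi>" "\<And>x. \<psi> x \<le> p x" "\<And>u r. (u, r) \<in> ?P \<Longrightarrow> r \<le> \<psi> u" by blast
  have "\<psi> c + e \<le> \<psi> z" if "c \<in> C" for c
  proof -
    have "(z - c, e) \<in> ?P" using that by (auto intro!: exI[of _ 1])
    from \<psi>(3)[OF this] show ?thesis by (simp add: linear_diff[OF \<psi>(1)])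
  qed
  with \<psi> show ?thesis by blast
qed

lemma Helly_approx:
  fixes C :: "('d \<Rightarrow> real) set" and z :: "'d \<Rightarrow> real"
  assumes D: "finite D" and C: "convex C"
    and bd: "\<And>k r. (\<And>c. c \<in> C \<Longrightarrow> (\<Sum>d\<in>D. k d * c d) \<le> r) \<Longrightarrow> (\<Sum>d\<in>D. k d * z d) \<le> r"
    and e: "e > 0"
  shows "\<exists>c\<in>C. \<forall>d\<in>D. \<bar>c d - z d\<bar> < e"
proof (rule ccontr)
  assume contra: "\<not> ?thesis"
  have ne: "C \<noteq> {}" using bd[of "\<lambda>_. 0" "-1"] by auto
  define p where "p x = (\<Sum>d\<in>D. \<bar>x d\<bar>)" for x :: "'d \<Rightarrow> real"
  have p: "sublinear p"
    unfolding sublinear_def p_def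
    by (auto simp: sum.distrib[symmetric] scaleR_fun_def abs_mult sum_distrib_left intro!: sum_mono)
  have far: "e \<le> p (z - c)" if c: "c \<in> C" for c
  proof -
    obtain d where d: "d \<in> D" "\<bar>c d - z d\<bar> \<ge> e" using contra c by force
    then have "e \<le> \<bar>(z - c) d\<bar>" by (simp add: abs_minus_commute)
    also have "\<dots> \<le> p (z - c)" unfolding p_def by (rule member_le_sum[OF d(1)]) (auto simp: D)
    finally show ?thesis .
  qed
  have "\<exists>\<psi>. linear \<psi> \<and> (\<forall>x. \<psi> x \<le> p x) \<and> (\<forall>c\<in>C. \<psi> c + e \<le> \<psi> z)"
    by (rule convex_separation[OF p C ne]) (rule far)
  then obtain \<psi> where
    \<psi>: "linear \<psi>" "\<And>x. \<psi> x \<le> p x" "\<And>c. c \<in> C \<Longrightarrow> \<psi> c + e \<le> \<psi> z" by blast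
  define k where "k d = \<psi> (\<lambda>d'. if d' = d then 1 else 0)" for d
  have \<psi>k: "\<psi> x = (\<Sum>d\<in>D. k d * x d)" for x
  proof -
    define y where "y = (\<Sum>d\<in>D. x d *\<^sub>R (\<lambda>d'. if d' = d then 1 else 0 :: real))"
    have "(\<Sum>d\<in>E. x d *\<^sub>R (\<lambda>d'. if d' = d then 1 else 0 :: real)) d' = (if d' \<in> E then x d' else 0)"
      if "finite E" for E d'
      using that by (induction E) (auto simp: scaleR_fun_def)
    then have y: "y d' = (if d' \<in> D then x d' else 0)" for d' unfolding y_def using D by blast
    have "p (x - y) = 0" "p (y - x) = 0" by (auto simp: p_def y)
    with \<psi>(2)[of "x - y"] \<psi>(2)[of "y - x"] have "\<psi> x = \<psi> y" by (simp add: linear_diff[OF \<psi>(1)])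
    also have "\<dots> = (\<Sum>d\<in>D. k d * x d)"
      unfolding y_def k_def by (simp add: linear_sum[OF \<psi>(1)] linear_scale[OF \<psi>(1)] mult.commute)
    finally show ?thesis .
  qed
  have "\<psi> z \<le> \<psi> z - e"
    unfolding \<psi>k[of z] by (rule bd) (use \<psi>(3) \<psi>k in force)
  with e show False by simp
qed

section \<open>Relative weak compactness\<close>

lemma topspace_initial_topology [simp]: "topspace (initial_topology A \<F>) = A"
  unfolding initial_topology_def topology_generated_by_topspace by auto

lemma continuous_map_into_initial_topology:
  assumes "\<And>x. x \<in> topspace T \<Longrightarrow> g x \<in> A"
    and "\<And>f. f \<in> \<F> \<Longrightarrow> continuous_map T euclideanreal (\<lambda>x. f (g x))"
  shows "continuous_map T (initial_topology A \<F>) g"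
  unfolding initial_topology_def
proof (rule continuous_on_generated_topo)
  show "g ` topspace T \<subseteq> \<Union> (insert A {A \<inter> f -` U |f U. f \<in> \<F> \<and> open U})"
    using assms(1) by auto
  fix W assume "W \<in> insert A {A \<inter> f -` U |f U. f \<in> \<F> \<and> open U}"
  then consider "W = A" | f U where "W = A \<inter> f -` U" "f \<in> \<F>" "open U" by blast
  then show "openin T (g -` W \<inter> topspace T)"
  proof cases
    case 1
    then have "g -` W \<inter> topspace T = topspace T" using assms(1) by auto
    then show ?thesis by simp
  next
    case 2
    then have "g -` W \<inter> topspace T = {x \<in> topspace T. f (g x) \<in> U}" using assms(1) by auto
    then show ?thesis
      using openin_continuous_map_preimage[OF assms(2)[OF 2(2)], of U] 2(3) by simp
  qed
qed

lemma openin_initial_topology_basic: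
  assumes "f \<in> \<F>" "open U"
  shows "openin (initial_topology A \<F>) (A \<inter> f -` U)"
  unfolding initial_topology_def by (rule topology_generated_by_Basis) (use assms in blast)

lemma continuous_map_initial_topology_coordinate:
  assumes "f \<in> \<F>"
  shows "continuous_map (initial_topology A \<F>) euclideanreal f"
  unfolding continuous_map_def
proof (intro conjI allI impI)
  fix U :: "real set" assume "openin euclideanreal U"
  then have "openin (initial_topology A \<F>) (A \<inter> f -` U)"
    using openin_initial_topology_basic[OF assms] by simp
  moreover have "A \<inter> f -` U = {x \<in> topspace (initial_topology A \<F>). f x \<in> U}" by auto
  ultimately show "openin (initial_topology A \<F>) {x \<in> topspace (initial_topology A \<F>). f x \<in> U}"
    by simp
qed auto

lemma eventually_in_initial_topology:
  assumes "openin (initial_topology A \<F>) U" "x \<in> U"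
    and A: "eventually (\<lambda>i. g i \<in> A) F" and lim: "\<And>f. f \<in> \<F> \<Longrightarrow> ((\<lambda>i. f (g i)) \<longlongrightarrow> f x) F"
  shows "eventually (\<lambda>i. g i \<in> U) F"
proof -
  have "generate_topology_on (insert A {A \<inter> f -` U |f U. f \<in> \<F> \<and> open U}) U"
    using assms(1) unfolding initial_topology_def by (rule openin_topology_generated_by)
  then show ?thesis using assms(2)
  proof (induction U rule: generate_topology_on.induct)
    case (Int a b)
    then show ?case by (auto intro: eventually_conj)
  next
    case (UN K)
    then obtain k where k: "k \<in> K" "x \<in> k" by blast
    from UN.IH[OF k] show ?case by (rule eventually_mono) (use k in blast)
  next
    case (Basis s)
    then consider "s = A" | f U where "s = A \<inter> f -` U" "f \<in> \<F>" "open U" by blast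
    then show ?case
    proof cases
      case 1
      then show ?thesis using A by simp
    next
      case 2
      have "eventually (\<lambda>i. f (g i) \<in> U) F"
        using lim[OF 2(2)] 2(3) by (rule topological_tendstoD) (use 2 Basis in auto)
      with A show ?thesis unfolding 2(1) by eventually_elim simp
    qed
  qed simp
qed

lemma topspace_weak_topology [simp]: "topspace weak_topology = UNIV"
  by (simp add: weak_topology_def)

lemma relatively_weakly_compact_lim:
  fixes a :: "'i \<Rightarrow> 'a::real_normed_vector"
  assumes A: "relatively_weakly_compact A" and F: "ultra F" and a: "\<And>i. a i \<in> A"
  shows "\<exists>x. \<forall>\<phi>::'a \<Rightarrow> real. bounded_linear \<phi> \<longrightarrow> ((\<lambda>i. \<phi> (a i)) \<longlongrightarrow> \<phi> x) F"
proof -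
  define K where "K = weak_topology closure_of A"
  have K: "compactin weak_topology K" using A unfolding relatively_weakly_compact_def K_def .
  have AK: "A \<subseteq> K" unfolding K_def by (rule closure_of_subset) simp
  have "\<exists>x\<in>K. \<forall>U. openin weak_topology U \<and> x \<in> U \<longrightarrow> eventually (\<lambda>i. a i \<in> U) F"
  proof (rule ccontr)
    assume "\<not> ?thesis"
    then have "\<forall>x\<in>K. \<exists>U. openin weak_topology U \<and> x \<in> U \<and> \<not> eventually (\<lambda>i. a i \<in> U) F" by blast
    then obtain U where U: "\<And>x. x \<in> K \<Longrightarrow> openin weak_topology (U x)" "\<And>x. x \<in> K \<Longrightarrow> x \<in> U x"
      "\<And>x. x \<in> K \<Longrightarrow> \<not> eventually (\<lambda>i. a i \<in> U x) F"
      by metis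
    have "\<exists>\<V>. finite \<V> \<and> \<V> \<subseteq> U ` K \<and> K \<subseteq> \<Union>\<V>"
      using K U(1,2) unfolding compactin_def by (metis (no_types, lifting) UN_I image_iff subsetI)
    then obtain X where X: "finite X" "X \<subseteq> K" "K \<subseteq> \<Union>(U ` X)"
      by (metis finite_subset_image)
    have "eventually (\<lambda>i. \<forall>x\<in>X. a i \<notin> U x) F"
      using U(3) ultra_cases[OF F] X(2) by (intro eventually_ball_finite[OF X(1)]) blast
    then obtain i where "\<forall>x\<in>X. a i \<notin> U x"
      using eventually_happens'[OF ultra_nontrivial[OF F]] by blast
    then show False using X(3) AK a[of i] by blast
  qed
  then obtain x where x: "\<And>U. openin weak_topology U \<Longrightarrow> x \<in> U \<Longrightarrow> eventually (\<lambda>i. a i \<in> U) F" by blast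
  have "((\<lambda>i. \<phi> (a i)) \<longlongrightarrow> \<phi> x) F" if "bounded_linear \<phi>" for \<phi> :: "'a \<Rightarrow> real"
  proof (rule topological_tendstoI)
    fix S :: "real set" assume S: "open S" "\<phi> x \<in> S"
    have "openin weak_topology (UNIV \<inter> \<phi> -` S)"
      unfolding weak_topology_def by (rule openin_initial_topology_basic) (use that S in auto)
    from x[OF this] S show "eventually (\<lambda>i. \<phi> (a i) \<in> S) F" by simp
  qed
  then show ?thesis by blast
qed

lemma relatively_weakly_compactI:
  fixes A :: "'a::real_normed_vector set"
  assumes bd: "\<And>a. a \<in> A \<Longrightarrow> norm a \<le> M"
    and cl: "\<And>(F :: 'a filter) (\<Phi> :: ('a \<Rightarrow> real) \<Rightarrow> real). ultra F \<Longrightarrow> eventually (\<lambda>a. a \<in> A) F \<Longrightarrow>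
      (\<And>\<phi>. bounded_linear \<phi> \<Longrightarrow> (\<phi> \<longlongrightarrow> \<Phi> \<phi>) F) \<Longrightarrow> \<exists>x. \<forall>\<phi>. bounded_linear \<phi> \<longrightarrow> \<Phi> \<phi> = \<phi> x"
  shows "relatively_weakly_compact A"
proof -
  define K where "K = weak_topology closure_of A"
  have near: "\<exists>a\<in>A. \<forall>\<phi>\<in>Z. \<bar>\<phi> a - \<phi> x\<bar> < e"
    if x: "x \<in> K" and Z: "finite Z" "Z \<subseteq> Collect bounded_linear" and e: "e > 0" for x Z and e :: real
  proof -
    have "openin weak_topology (topspace weak_topology \<inter> (\<Inter>\<phi>\<in>Z. UNIV \<inter> \<phi> -` ball (\<phi> x) e))"
    proof (cases "Z = {}")
      case False
      have "openin weak_topology (\<Inter>\<phi>\<in>Z. UNIV \<inter> \<phi> -` ball (\<phi> x) e)"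
        unfolding weak_topology_def
        by (rule openin_INT2[OF Z(1) False], rule openin_initial_topology_basic) (use Z in auto)
      then show ?thesis by simp
    qed (use openin_topspace[of weak_topology] in simp)
    moreover have "x \<in> topspace weak_topology \<inter> (\<Inter>\<phi>\<in>Z. UNIV \<inter> \<phi> -` ball (\<phi> x) e)" using e by simp
    ultimately obtain a where "a \<in> A" "a \<in> topspace weak_topology \<inter> (\<Inter>\<phi>\<in>Z. UNIV \<inter> \<phi> -` ball (\<phi> x) e)"
      using x unfolding K_def in_closure_of by blast
    then show ?thesis by (auto simp: dist_real_def abs_minus_commute)
  qed
  have "compactin weak_topology K"
    unfolding compactin_def
  proof (intro conjI allI impI)
    fix \<U> :: "'a set set" assume \<U>: "Ball \<U> (openin weak_topology) \<and> K \<subseteq> \<Union>\<U>"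
    show "\<exists>\<V>. finite \<V> \<and> \<V> \<subseteq> \<U> \<and> K \<subseteq> \<Union>\<V>"
    proof (rule ccontr)
      assume contra: "\<not> ?thesis"
      define F0 where "F0 = (INF \<V>\<in>{\<V>. finite \<V> \<and> \<V> \<subseteq> \<U>}. principal (K - \<Union>\<V>))"
      have ev: "eventually P F0 \<longleftrightarrow> (\<exists>\<V>\<in>{\<V>. finite \<V> \<and> \<V> \<subseteq> \<U>}. \<forall>x\<in>K - \<Union>\<V>. P x)" for P
        unfolding F0_def
      proof (subst eventually_INF_base)
        show "{\<V>. finite \<V> \<and> \<V> \<subseteq> \<U>} \<noteq> {}" by blast
        fix \<V> \<W> assume "\<V> \<in> {\<V>. finite \<V> \<and> \<V> \<subseteq> \<U>}" "\<W> \<in> {\<V>. finite \<V> \<and> \<V> \<subseteq> \<U>}"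
        then show "\<exists>x\<in>{\<V>. finite \<V> \<and> \<V> \<subseteq> \<U>}.
            principal (K - \<Union>x) \<le> inf (principal (K - \<Union>\<V>)) (principal (K - \<Union>\<W>))"
          by (intro bexI[of _ "\<V> \<union> \<W>"]) auto
      qed (auto simp: eventually_principal)
      have "F0 \<noteq> bot"
      proof
        assume "F0 = bot"
        then have "eventually (\<lambda>_. False) F0" by simp
        with contra show False unfolding ev by blast
      qed
      then obtain F where F: "F \<le> F0" "ultra F" using ex_ultra_le by blast
      note Fbot = ultra_nontrivial[OF F(2)]
      have FK: "eventually (\<lambda>x. x \<in> K) F"
        by (rule filter_leD[OF F(1)]) (auto simp: ev)
      have "\<exists>l. (\<phi> \<longlongrightarrow> l) F" if \<phi>: "bounded_linear \<phi>" for \<phi> :: "'a \<Rightarrow> real"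
      proof -
        obtain C where C: "C \<ge> 0" "\<And>x. \<bar>\<phi> x\<bar> \<le> norm x * C"
          using bounded_linear.nonneg_bounded[OF \<phi>] by (auto simp: real_norm_def)
        define B where "B = \<bar>M\<bar> * C + 1"
        have B: "\<bar>\<phi> x\<bar> \<le> B" if xK: "x \<in> K" for x
        proof -
          obtain a where a: "a \<in> A" "\<bar>\<phi> a - \<phi> x\<bar> < 1" using near[OF xK, of "{\<phi>}" 1] \<phi> by auto
          have "\<bar>\<phi> a\<bar> \<le> \<bar>M\<bar> * C"
            using C(2)[of a] mult_right_mono[OF order_trans[OF bd[OF a(1)] abs_ge_self] C(1)] by simp
          with a(2) show ?thesis unfolding B_def by linarith
        qed
        have "B \<ge> 0" using C by (simp add: B_def)
        then have "\<bar>if x \<in> K then \<phi> x else 0\<bar> \<le> B" for x using B by auto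
        from ultra_lim_ex[OF F(2), where f="\<lambda>x. if x \<in> K then \<phi> x else 0", OF this]
        obtain l where l: "((\<lambda>x. if x \<in> K then \<phi> x else 0) \<longlongrightarrow> l) F" by blast
        have "(\<phi> \<longlongrightarrow> l) F"
          by (rule Lim_transform_eventually[OF l]) (use FK in \<open>auto elim: eventually_mono\<close>)
        then show ?thesis by blast
      qed
      then have \<Phi>: "(\<phi> \<longlongrightarrow> Lim F \<phi>) F" if "bounded_linear \<phi>" for \<phi> :: "'a \<Rightarrow> real"
        using that tendsto_Lim[OF Fbot] by metis
      let ?\<Phi> = "\<lambda>\<phi>::'a \<Rightarrow> real. Lim F \<phi>"
      have "\<exists>a\<in>A. \<forall>\<phi>\<in>Z. \<bar>\<phi> a - Lim F \<phi>\<bar> < e"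
        if Z: "finite Z" "Z \<subseteq> Collect bounded_linear" and e: "e > 0" for Z and e :: real
      proof -
        have "eventually (\<lambda>x. \<forall>\<phi>\<in>Z. \<bar>\<phi> x - Lim F \<phi>\<bar> < e/2) F"
        proof (intro eventually_ball_finite[OF Z(1)] ballI)
          fix \<phi> assume "\<phi> \<in> Z"
          then have "(\<phi> \<longlongrightarrow> Lim F \<phi>) F" using \<Phi> Z by blast
          from tendstoD[OF this, of "e/2"] e
          show "eventually (\<lambda>x. \<bar>\<phi> x - Lim F \<phi>\<bar> < e/2) F" by (simp add: dist_real_def)
        qed
        with FK have "eventually (\<lambda>x. x \<in> K \<and> (\<forall>\<phi>\<in>Z. \<bar>\<phi> x - Lim F \<phi>\<bar> < e/2)) F"
          by (rule eventually_conj)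
        then obtain x where x: "x \<in> K" "\<forall>\<phi>\<in>Z. \<bar>\<phi> x - Lim F \<phi>\<bar> < e/2"
          using eventually_happens'[OF Fbot] by blast
        obtain a where "a \<in> A" "\<forall>\<phi>\<in>Z. \<bar>\<phi> a - \<phi> x\<bar> < e/2" using near[OF x(1) Z, of "e/2"] e by auto
        with x(2) show ?thesis by (intro bexI[of _ a]) (auto, smt (verit) field_sum_of_halves)
      qed
      then obtain G where G: "ultra G" "eventually (\<lambda>a. a \<in> A) G"
          "\<And>\<phi> :: 'a \<Rightarrow> real. bounded_linear \<phi> \<Longrightarrow> (\<phi> \<longlongrightarrow> Lim F \<phi>) G"
        using ex_ultra_approx[of "Collect bounded_linear" A "\<lambda>a \<phi>. \<phi> a" ?\<Phi>] by auto
      have "\<exists>x. \<forall>\<phi>::'a \<Rightarrow> real. bounded_linear \<phi> \<longrightarrow> Lim F \<phi> = \<phi> x"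
        by (rule cl[OF G(1,2)]) (rule G(3))
      then obtain x where x: "\<And>\<phi>::'a \<Rightarrow> real. bounded_linear \<phi> \<Longrightarrow> Lim F \<phi> = \<phi> x" by blast
      have ev_open: "eventually (\<lambda>y. y \<in> U) F" if "openin weak_topology U" "x \<in> U" for U
        using that unfolding weak_topology_def
        by (rule eventually_in_initial_topology) (use \<Phi> x in auto)
      have "x \<in> K"
      proof (rule ccontr)
        assume "x \<notin> K"
        then have "eventually (\<lambda>y. y \<in> UNIV - K) F"
          using openin_diff[OF openin_topspace[of weak_topology] closedin_closure_of[of weak_topology A]]
            by (intro ev_open) (auto simp: K_def)
        then show False using FK eventually_happens'[OF Fbot eventually_conj] by blast
      qed
      then obtain U where U: "U \<in> \<U>" "x \<in> U" using \<U> by blast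
      then have "eventually (\<lambda>y. y \<in> U) F" using \<U> ev_open by blast
      moreover have "eventually (\<lambda>y. y \<notin> U) F0"
        unfolding ev by (rule bexI[of _ "{U}"]) (use U in auto)
      then have "eventually (\<lambda>y. y \<notin> U) F" by (rule filter_leD[OF F(1)])
      ultimately have "eventually (\<lambda>_. False) F" by eventually_elim simp
      then show False using Fbot by (simp add: eventually_False)
    qed
  qed simp
  then show ?thesis by (simp add: relatively_weakly_compact_def K_def)
qed

section \<open>Weak compactness in spaces of bounded continuous functions\<close>

lemma stable_scale:
  assumes stab: "stable A Y p" and bd: "\<And>a y. a \<in> A \<Longrightarrow> y \<in> Y \<Longrightarrow> \<bar>p a y\<bar> \<le> M"
    and A': "\<And>a'. a' \<in> A' \<Longrightarrow> \<exists>a\<in>A. \<exists>s. \<bar>s\<bar> \<le> C \<and> (\<forall>y\<in>Y. p' a' y = s * p a y)"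
  shows "stable A' Y p'"
  unfolding stable_def
proof (intro allI impI)
  fix a' :: "nat \<Rightarrow> _" and y :: "nat \<Rightarrow> _" assume "range a' \<subseteq> A' \<and> range y \<subseteq> Y"
  then have a': "\<And>i. a' i \<in> A'" and y: "\<And>j. y j \<in> Y" by auto
  have "\<forall>i::nat. \<exists>a s. a \<in> A \<and> \<bar>s\<bar> \<le> C \<and> (\<forall>y\<in>Y. p' (a' i) y = s * p a y)"
    using A'[OF a'] by blast
  then obtain a s where a: "\<And>i. a i \<in> A" and s: "\<And>i::nat. \<bar>s i\<bar> \<le> C"
    and eq: "\<And>i y. y \<in> Y \<Longrightarrow> p' (a' i) y = s i * p (a i) y"
    by metis
  have pb: "\<bar>p (a i) (y j)\<bar> \<le> M" for i j using bd a y by blast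
  define r where "r = (\<lambda>i. Lim \<omega> (\<lambda>j. p (a i) (y j)))"
  define q where "q = (\<lambda>j. Lim \<omega> (\<lambda>i. p (a i) (y j)))"
  have r: "((\<lambda>j. p (a i) (y j)) \<longlongrightarrow> r i) \<omega>" for i
    unfolding r_def by (rule tendsto_\<omega>_Lim) (rule pb)
  have q: "((\<lambda>i. p (a i) (y j)) \<longlongrightarrow> q j) \<omega>" for j
    unfolding q_def by (rule tendsto_\<omega>_Lim) (rule pb)
  have "\<bar>r i\<bar> \<le> M" for i unfolding r_def by (rule abs_Lim_\<omega>_le) (rule pb)
  then have R: "(r \<longlongrightarrow> Lim \<omega> r) \<omega>" by (rule tendsto_\<omega>_Lim)
  have "\<bar>q j\<bar> \<le> M" for j unfolding q_def by (rule abs_Lim_\<omega>_le) (rule pb)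
  then have Q: "(q \<longlongrightarrow> Lim \<omega> q) \<omega>" by (rule tendsto_\<omega>_Lim)
  have S: "(s \<longlongrightarrow> Lim \<omega> s) \<omega>" by (rule tendsto_\<omega>_Lim) (rule s)
  have 1: "Lim \<omega> (\<lambda>j. s i * p (a i) (y j)) = s i * r i" for i
    by (intro Lim_\<omega>_eq tendsto_mult tendsto_const r)
  have 2: "Lim \<omega> (\<lambda>i. s i * p (a i) (y j)) = Lim \<omega> s * q j" for j
    by (intro Lim_\<omega>_eq tendsto_mult S q)
  have "Lim \<omega> (\<lambda>i. s i * r i) = Lim \<omega> s * Lim \<omega> r" "Lim \<omega> (\<lambda>j. Lim \<omega> s * q j) = Lim \<omega> s * Lim \<omega> q"
    by (intro Lim_\<omega>_eq tendsto_mult tendsto_const S R Q)+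
  moreover have "Lim \<omega> r = Lim \<omega> q"
    using stableD[OF stab a y r R q Q] .
  ultimately show "Lim \<omega> (\<lambda>i. Lim \<omega> (\<lambda>j. p' (a' i) (y j))) = Lim \<omega> (\<lambda>j. Lim \<omega> (\<lambda>i. p' (a' i) (y j)))"
    by (simp add: eq[OF y] 1 2)
qed

lemma abs_apply_le_norm: "\<bar>apply_bcontfun h x\<bar> \<le> norm h"
  using norm_bounded[of h x] by simp

lemma bounded_linear_eval: "bounded_linear (\<lambda>h :: 'x::topological_space \<Rightarrow>\<^sub>C real. apply_bcontfun h x)"
  by (rule bounded_linear_intro[where K=1]) (use abs_apply_le_norm in auto)

lemma stable_imp_relatively_weakly_compact:
  fixes H :: "('x::topological_space \<Rightarrow>\<^sub>C real) set"
  assumes stab: "stable H UNIV apply_bcontfun" and bd: "\<And>h. h \<in> H \<Longrightarrow> norm h \<le> M"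
  shows "relatively_weakly_compact H"
proof (rule relatively_weakly_compactI)
  show "norm h \<le> M" if "h \<in> H" for h using bd that .
next
  fix F :: "('x \<Rightarrow>\<^sub>C real) filter" and \<Phi> :: "(('x \<Rightarrow>\<^sub>C real) \<Rightarrow> real) \<Rightarrow> real"
  assume F: "ultra F" and FH: "eventually (\<lambda>h. h \<in> H) F"
    and \<Phi>: "\<And>\<phi>. bounded_linear \<phi> \<Longrightarrow> (\<phi> \<longlongrightarrow> \<Phi> \<phi>) F"
  note Fbot = ultra_nontrivial[OF F]
  obtain h0 where h0: "h0 \<in> H" using eventually_happens'[OF Fbot FH] by blast
  have hM: "\<bar>apply_bcontfun h x\<bar> \<le> M" if "h \<in> H" for h x
    using norm_bounded[of h x] bd[OF that] by simp
  define f0 where "f0 x = \<Phi> (\<lambda>h. apply_bcontfun h x)" for x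
  have f0: "((\<lambda>h. apply_bcontfun h x) \<longlongrightarrow> f0 x) F" for x
    unfolding f0_def by (rule \<Phi>[OF bounded_linear_eval])
  have f0M: "\<bar>f0 x\<bar> \<le> M" for x
    by (rule tendsto_upperbound[OF tendsto_rabs[OF f0] _ Fbot])
      (use FH hM in \<open>auto elim: eventually_mono\<close>)
  have "(f0 \<longlongrightarrow> f0 x) (at x)" for x
  proof (rule tendstoI, rule ccontr)
    fix e :: real assume e: "e > 0" and nev: "\<not> eventually (\<lambda>y. dist (f0 y) (f0 x) < e) (at x)"
    define G where "G = {y. \<bar>f0 y - f0 x\<bar> \<ge> e}"
    have appr: "\<exists>g\<in>G. \<forall>a\<in>Z. \<bar>apply_bcontfun a g - apply_bcontfun a x\<bar> < r"
      if Z: "finite Z" and r: "r > 0" for Z :: "('x \<Rightarrow>\<^sub>C real) set" and r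
    proof (rule ccontr)
      assume no: "\<not> ?thesis"
      have "eventually (\<lambda>y. \<forall>a\<in>Z. \<bar>apply_bcontfun a y - apply_bcontfun a x\<bar> < r) (at x)"
      proof (intro eventually_ball_finite[OF Z] ballI)
        fix a assume "a \<in> Z"
        have "(apply_bcontfun a \<longlongrightarrow> apply_bcontfun a x) (at x)"
          using continuous_on_apply_bcontfun[of UNIV a] by (simp add: continuous_on_def)
        from tendstoD[OF this r]
        show "eventually (\<lambda>y. \<bar>apply_bcontfun a y - apply_bcontfun a x\<bar> < r) (at x)"
          by (simp add: dist_real_def)
      qed
      then have "eventually (\<lambda>y. dist (f0 y) (f0 x) < e) (at x)"
        by (rule eventually_mono) (use no in \<open>auto simp: G_def dist_real_def not_le[symmetric]\<close>)
      with nev show False by blast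
    qed
    let ?c = "\<lambda>h. if h \<in> H then h else h0"
    have cH: "?c i \<in> convex hull H" for i using h0 by (auto intro: hull_inc)
    have "\<exists>g\<in>G. eventually (\<lambda>h. \<bar>apply_bcontfun (?c h) g - apply_bcontfun (?c h) x\<bar> < e/2) F"
    proof (rule stable_convex_hull_approx[OF stab])
      show "\<bar>apply_bcontfun a y\<bar> \<le> M" if "a \<in> H" for a y by (rule hM[OF that])
      show "\<exists>g\<in>G. \<forall>a\<in>Z. \<bar>apply_bcontfun a g - apply_bcontfun a x\<bar> < r"
        if "finite Z" "r > 0" for Z :: "('x \<Rightarrow>\<^sub>C real) set" and r
        by (rule appr[OF that])
    qed (use e F cH bounded_linear.linear[OF bounded_linear_eval] in auto)
    then obtain g where g: "g \<in> G"
      "eventually (\<lambda>h. \<bar>apply_bcontfun (?c h) g - apply_bcontfun (?c h) x\<bar> < e/2) F" by blast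
    have "\<bar>f0 g - f0 x\<bar> \<le> e/2"
    proof (rule tendsto_upperbound[OF tendsto_rabs[OF tendsto_diff[OF f0 f0]] _ Fbot])
      show "eventually (\<lambda>h. \<bar>apply_bcontfun h g - apply_bcontfun h x\<bar> \<le> e/2) F"
        using g(2) FH by eventually_elim simp
    qed
    then show False using g(1) e by (simp add: G_def)
  qed
  then have "continuous_on UNIV f0" by (simp add: continuous_on_def)
  then have "f0 \<in> bcontfun"
    by (rule bcontfun_normI) (use f0M in \<open>auto simp: real_norm_def\<close>)
  define F0 where "F0 = Bcontfun f0"
  have F0: "apply_bcontfun F0 x = f0 x" for x
    unfolding F0_def using Bcontfun_inverse[OF \<open>f0 \<in> bcontfun\<close>] by simp
  define T :: "(('x \<Rightarrow>\<^sub>C real) \<Rightarrow> real) set" where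
    "T = {\<lambda>h. s * apply_bcontfun h x | s x. \<bar>s\<bar> \<le> 1}"
  have TI: "(\<lambda>h. s * apply_bcontfun h x) \<in> T" if "\<bar>s\<bar> \<le> 1" for s x
    unfolding T_def using that by blast
  have T_lim: "(t \<longlongrightarrow> t F0) F" if "t \<in> T" for t
    using that f0 unfolding T_def by (auto simp: F0 intro!: tendsto_intros)
  have tM: "\<bar>t h\<bar> \<le> M" if t: "t \<in> T" and h: "h \<in> H" for t h
  proof -
    obtain s x where t: "t = (\<lambda>h. s * apply_bcontfun h x)" "\<bar>s\<bar> \<le> 1" using t unfolding T_def by blast
    then have "\<bar>t h\<bar> \<le> 1 * M"
      unfolding t(1) abs_mult using hM[OF h] by (intro mult_mono) auto
    then show ?thesis by simp
  qed
  have stabT: "stable T H (\<lambda>t h. t h)"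
    by (rule stable_scale[OF stable_flip[OF stab], of M _ 1]) (use hM in \<open>auto simp: T_def\<close>)
  have "\<Phi> \<phi> = \<phi> F0" if \<phi>: "bounded_linear \<phi>" for \<phi>
  proof -
    obtain K where K: "K > 0" "\<And>x. \<bar>\<phi> x\<bar> \<le> norm x * K"
      using bounded_linear.pos_bounded[OF \<phi>] by (auto simp: real_norm_def)
    define \<psi> where "\<psi> u = \<phi> u / K" for u
    have \<psi>: "\<bar>\<psi> u\<bar> \<le> norm u" for u
      using K(2)[of u] K(1) by (simp add: \<psi>_def field_simps)
    have lin: "linear \<psi>"
      unfolding \<psi>_def using bounded_linear.linear[OF \<phi>]
      by (auto intro!: linearI simp: linear_add linear_scale add_divide_distrib)
    have \<psi>F: "(\<psi> \<longlongrightarrow> \<Phi> \<phi> / K) F"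
      unfolding \<psi>_def[abs_def] using K(1) by (intro tendsto_intros \<Phi> \<phi>) simp
    have "\<exists>t\<in>convex hull T. \<forall>u\<in>D. \<bar>t u - \<psi> u\<bar> < e" if D: "finite D" and e: "e > 0" for D and e :: real
    proof (rule Helly_approx[OF D convex_convex_hull _ e])
      fix k r assume kr: "\<And>t. t \<in> convex hull T \<Longrightarrow> (\<Sum>d\<in>D. k d * t d) \<le> r"
      define w where "w = (\<Sum>d\<in>D. k d *\<^sub>R d)"
      have wx: "apply_bcontfun w x = (\<Sum>d\<in>D. k d * apply_bcontfun d x)" for x
      proof -
        have "linear (\<lambda>h :: 'x \<Rightarrow>\<^sub>C real. apply_bcontfun h x)"
          by (rule bounded_linear.linear[OF bounded_linear_eval])
        from linear_sum[OF this, of "\<lambda>d. k d *\<^sub>R d" D] show ?thesis by (simp add: w_def)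
      qed
      have "\<bar>apply_bcontfun w x\<bar> \<le> r" for x
      proof -
        have "s * apply_bcontfun w x \<le> r" if "\<bar>s\<bar> \<le> 1" for s
          using kr[OF hull_inc[OF TI[OF that, of x]]]
          by (simp add: wx sum_distrib_left mult.left_commute)
        from this[of 1] this[of "-1"] show ?thesis by simp
      qed
      then have "norm w \<le> r" by (intro norm_bound) (simp add: real_norm_def)
      moreover have "(\<Sum>d\<in>D. k d * \<psi> d) = \<psi> w"
        unfolding w_def by (simp add: linear_sum[OF lin] linear_scale[OF lin])
      ultimately show "(\<Sum>d\<in>D. k d * \<psi> d) \<le> r" using \<psi>[of w] by simp
    qed
    then obtain U where U: "ultra U" "eventually (\<lambda>t. t \<in> convex hull T) U"
        "\<And>u. ((\<lambda>t. t u) \<longlongrightarrow> \<psi> u) U"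
      using ex_ultra_approx[of UNIV "convex hull T" "\<lambda>t u. t u" \<psi>] by auto
    note Ubot = ultra_nontrivial[OF U(1)]
    obtain t0 where t0: "t0 \<in> T" using TI[of 1] by auto
    let ?c = "\<lambda>t. if t \<in> convex hull T then t else t0"
    have cT: "?c i \<in> convex hull T" for i using t0 by (auto intro: hull_inc)
    have lin_ev: "linear (\<lambda>t::('x \<Rightarrow>\<^sub>C real) \<Rightarrow> real. t y)" for y
      by (rule linearI) (simp_all add: scaleR_fun_def)
    have "\<bar>\<Phi> \<phi> / K - \<psi> F0\<bar> \<le> 2 * r" if r: "r > 0" for r
    proof -
      define G where "G = {h\<in>H. \<bar>\<psi> h - \<Phi> \<phi> / K\<bar> < r}"
      have FG: "eventually (\<lambda>h. h \<in> G) F"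
        using FH tendstoD[OF \<psi>F r] by eventually_elim (simp add: G_def dist_real_def)
      have "\<exists>g\<in>G. eventually (\<lambda>t. \<bar>(?c t) g - (?c t) F0\<bar> < r) U"
      proof (rule stable_convex_hull_approx[OF stabT, where \<xi>="\<lambda>t. t F0"])
        show "\<bar>a y\<bar> \<le> M" if "a \<in> T" "y \<in> H" for a y by (rule tM[OF that])
        show "\<exists>g\<in>G. \<forall>a\<in>Z. \<bar>a g - a F0\<bar> < q" if Z: "finite Z" "Z \<subseteq> T" and q: "q > 0" for Z q
        proof -
          have "eventually (\<lambda>h. \<forall>a\<in>Z. \<bar>a h - a F0\<bar> < q) F"
            using tendstoD[OF T_lim q] Z(2)
            by (intro eventually_ball_finite[OF Z(1)]) (auto simp: dist_real_def)
          from eventually_happens'[OF Fbot eventually_conj[OF FG this]] show ?thesis by blast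
        qed
      qed (use U r cT lin_ev in \<open>auto simp: G_def\<close>)
      then obtain g where g: "g \<in> G" "eventually (\<lambda>t. \<bar>(?c t) g - (?c t) F0\<bar> < r) U" by blast
      have "\<bar>\<psi> g - \<psi> F0\<bar> \<le> r"
      proof (rule tendsto_upperbound[OF tendsto_rabs[OF tendsto_diff[OF U(3) U(3)]] _ Ubot])
        show "eventually (\<lambda>t. \<bar>t g - t F0\<bar> \<le> r) U"
          using g(2) U(2) by eventually_elim simp
      qed
      moreover have "\<bar>\<psi> g - \<Phi> \<phi> / K\<bar> < r" using g(1) by (simp add: G_def)
      ultimately show ?thesis by linarith
    qed
    from this[of "\<bar>\<Phi> \<phi> / K - \<psi> F0\<bar> / 4"] have "\<Phi> \<phi> / K = \<psi> F0" by fastforce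
    then show ?thesis using K(1) by (simp add: \<psi>_def)
  qed
  then show "\<exists>x. \<forall>\<phi>. bounded_linear \<phi> \<longrightarrow> \<Phi> \<phi> = \<phi> x" by blast
qed

lemma relatively_weakly_compact_imp_stable:
  fixes H :: "('x::topological_space \<Rightarrow>\<^sub>C real) set"
  assumes H: "relatively_weakly_compact H" and bd: "\<And>h. h \<in> H \<Longrightarrow> norm h \<le> M"
  shows "stable H UNIV apply_bcontfun"
  unfolding stable_def
proof (intro allI impI)
  fix a :: "nat \<Rightarrow> 'x \<Rightarrow>\<^sub>C real" and y :: "nat \<Rightarrow> 'x"
  assume "range a \<subseteq> H \<and> range y \<subseteq> UNIV"
  then have a: "\<And>i. a i \<in> H" by auto
  obtain e where e: "\<And>\<phi>::('x \<Rightarrow>\<^sub>C real) \<Rightarrow> real. bounded_linear \<phi> \<Longrightarrow> ((\<lambda>i. \<phi> (a i)) \<longlongrightarrow> \<phi> e) \<omega>"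
    using relatively_weakly_compact_lim[OF H \<omega>_props(2), of a] a by blast
  define \<Delta> where "\<Delta> u = Lim \<omega> (\<lambda>j. apply_bcontfun u (y j))" for u :: "'x \<Rightarrow>\<^sub>C real"
  have \<Delta>: "((\<lambda>j. apply_bcontfun u (y j)) \<longlongrightarrow> \<Delta> u) \<omega>" for u
    unfolding \<Delta>_def by (rule tendsto_\<omega>_Lim) (rule abs_apply_le_norm)
  have "bounded_linear \<Delta>"
  proof (rule bounded_linear_intro)
    show "\<Delta> (u + v) = \<Delta> u + \<Delta> v" for u v
      using tendsto_unique[OF \<omega>_bot \<Delta>[of "u + v"]] tendsto_add[OF \<Delta>[of u] \<Delta>[of v]] by simp
    show "\<Delta> (c *\<^sub>R u) = c *\<^sub>R \<Delta> u" for c u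
      using tendsto_unique[OF \<omega>_bot \<Delta>[of "c *\<^sub>R u"]] tendsto_mult[OF tendsto_const[of c] \<Delta>[of u]] by simp
    show "norm (\<Delta> u) \<le> norm u * 1" for u
      unfolding \<Delta>_def real_norm_def mult_1_right
      by (rule abs_Lim_\<omega>_le) (rule abs_apply_le_norm)
  qed
  then have "((\<lambda>i. \<Delta> (a i)) \<longlongrightarrow> \<Delta> e) \<omega>" by (rule e)
  moreover have "Lim \<omega> (\<lambda>i. apply_bcontfun (a i) (y j)) = apply_bcontfun e (y j)" for j
    by (rule Lim_\<omega>_eq) (rule e[OF bounded_linear_eval])
  ultimately show "Lim \<omega> (\<lambda>i. Lim \<omega> (\<lambda>j. apply_bcontfun (a i) (y j))) =
      Lim \<omega> (\<lambda>j. Lim \<omega> (\<lambda>i. apply_bcontfun (a i) (y j)))"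
    using Lim_\<omega>_eq[of "\<lambda>i. \<Delta> (a i)" "\<Delta> e"] by (simp add: \<Delta>_def)
qed

lemma stable_insert:
  assumes stab: "stable A Y p" and A: "A \<noteq> {}"
    and bd: "\<And>a y. a \<in> insert f A \<Longrightarrow> y \<in> Y \<Longrightarrow> \<bar>p a y\<bar> \<le> M"
  shows "stable (insert f A) Y p"
  unfolding stable_def
proof (intro allI impI)
  fix a :: "nat \<Rightarrow> _" and y :: "nat \<Rightarrow> _"
  assume ay: "range a \<subseteq> insert f A \<and> range y \<subseteq> Y"
  have pb: "\<bar>p (a i) (y j)\<bar> \<le> M" for i j using bd ay by blast
  have cong: "Lim \<omega> u = Lim \<omega> v" if "eventually (\<lambda>i. u i = v i) \<omega>" "\<And>i. \<bar>u i\<bar> \<le> M" for u v :: "nat \<Rightarrow> real"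
    using Lim_transform_eventually[OF tendsto_\<omega>_Lim[of u, OF that(2)] that(1)] by (simp add: Lim_\<omega>_eq)
  have key: "Lim \<omega> (\<lambda>i. Lim \<omega> (\<lambda>j. p (a i) (y j))) = Lim \<omega> (\<lambda>j. Lim \<omega> (\<lambda>i. p (a i) (y j)))"
    if ev: "eventually (\<lambda>i. a i = b i) \<omega>"
      and b: "Lim \<omega> (\<lambda>i. Lim \<omega> (\<lambda>j. p (b i) (y j))) = Lim \<omega> (\<lambda>j. Lim \<omega> (\<lambda>i. p (b i) (y j)))" for b
  proof -
    have "Lim \<omega> (\<lambda>i. Lim \<omega> (\<lambda>j. p (a i) (y j))) = Lim \<omega> (\<lambda>i. Lim \<omega> (\<lambda>j. p (b i) (y j)))"
    proof (rule cong)
      show "eventually (\<lambda>i. Lim \<omega> (\<lambda>j. p (a i) (y j)) = Lim \<omega> (\<lambda>j. p (b i) (y j))) \<omega>"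
        using ev by eventually_elim simp
      show "\<bar>Lim \<omega> (\<lambda>j. p (a i) (y j))\<bar> \<le> M" for i by (rule abs_Lim_\<omega>_le) (rule pb)
    qed
    moreover have "Lim \<omega> (\<lambda>i. p (a i) (y j)) = Lim \<omega> (\<lambda>i. p (b i) (y j))" for j
    proof (rule cong)
      show "eventually (\<lambda>i. p (a i) (y j) = p (b i) (y j)) \<omega>" using ev by eventually_elim simp
    qed (rule pb)
    ultimately show ?thesis using b by simp
  qed
  show "Lim \<omega> (\<lambda>i. Lim \<omega> (\<lambda>j. p (a i) (y j))) = Lim \<omega> (\<lambda>j. Lim \<omega> (\<lambda>i. p (a i) (y j)))"
  proof (cases "eventually (\<lambda>i. a i = f) \<omega>")
    case True
    then show ?thesis by (rule key) (simp add: Lim_\<omega>_eq[OF tendsto_const])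
  next
    case False
    then have ev: "eventually (\<lambda>i. a i \<noteq> f) \<omega>" using ultra_cases[OF \<omega>_props(2)] by blast
    obtain a0 where a0: "a0 \<in> A" using A by blast
    let ?b = "\<lambda>i. if a i = f then a0 else a i"
    show ?thesis
    proof (rule key)
      show "eventually (\<lambda>i. a i = ?b i) \<omega>" using ev by eventually_elim simp
      have "range ?b \<subseteq> A" using ay a0 by auto
      then show "Lim \<omega> (\<lambda>i. Lim \<omega> (\<lambda>j. p (?b i) (y j))) = Lim \<omega> (\<lambda>j. Lim \<omega> (\<lambda>i. p (?b i) (y j)))"
        using stab ay unfolding stable_def by blast
    qed
  qed
qed

section \<open>Duals and Goldstine's theorem\<close>

lemma normed_spaceD:
  assumes "normed_space V N"
  shows "subspace V" "\<And>v. v \<in> V \<Longrightarrow> N v \<ge> 0" "N 0 = 0" "\<And>v. v \<in> V \<Longrightarrow> N v = 0 \<Longrightarrow> v = 0"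
    "\<And>v w. v \<in> V \<Longrightarrow> w \<in> V \<Longrightarrow> N (v + w) \<le> N v + N w"
    "\<And>c v. v \<in> V \<Longrightarrow> N (c *\<^sub>R v) = \<bar>c\<bar> * N v"
proof -
  show V: "subspace V" using assms by (simp add: normed_space_def)
  show "\<And>v. v \<in> V \<Longrightarrow> N v \<ge> 0" "\<And>v. v \<in> V \<Longrightarrow> N v = 0 \<Longrightarrow> v = 0"
    "\<And>v w. v \<in> V \<Longrightarrow> w \<in> V \<Longrightarrow> N (v + w) \<le> N v + N w"
    "\<And>c v. v \<in> V \<Longrightarrow> N (c *\<^sub>R v) = \<bar>c\<bar> * N v"
    using assms by (auto simp: normed_space_def)
  show "N 0 = 0" using assms subspace_0[OF V] by (auto simp: normed_space_def)
qed

lemma normed_space_real: "normed_space UNIV (abs :: real \<Rightarrow> real)"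
  by (auto simp: normed_space_def abs_mult)

lemma operator_norm_bound:
  assumes V: "normed_space V N" and W: "normed_space W M" and T: "T \<in> bounded_linear_maps V N W M"
    and v: "v \<in> V"
  shows "M (T v) \<le> operator_norm V N M T * N v"
proof -
  have Tscale: "T (c *\<^sub>R u) = c *\<^sub>R T u" and TW: "T u \<in> W" if "u \<in> V" for c u
    using T that by (auto simp: bounded_linear_maps_def)
  obtain K where K: "\<And>u. u \<in> V \<Longrightarrow> M (T u) \<le> K * N u"
    using T unfolding bounded_linear_maps_def by blast
  show ?thesis
  proof (cases "N v = 0")
    case True
    then have "v = 0" using normed_spaceD(4)[OF V v] by simp
    then have "T v = 0" using Tscale[OF v, of 0] by simp
    then show ?thesis using True normed_spaceD(3)[OF W] by simp
  next
    case False
    then have pos: "N v > 0" using normed_spaceD(2)[OF V v] by simp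
    define u where "u = (1 / N v) *\<^sub>R v"
    have u: "u \<in> V" "N u = 1"
      unfolding u_def using pos normed_spaceD(6)[OF V v] subspace_scale[OF normed_spaceD(1)[OF V] v] by auto
    have "bdd_above ((\<lambda>v. M (T v)) ` {v\<in>V. N v \<le> 1})"
    proof (rule bdd_aboveI2)
      fix w assume w: "w \<in> {v\<in>V. N v \<le> 1}"
      then have "M (T w) \<le> K * N w" using K by simp
      also have "\<dots> \<le> \<bar>K\<bar> * 1" using w normed_spaceD(2)[OF V] by (intro mult_mono) auto
      finally show "M (T w) \<le> \<bar>K\<bar>" by simp
    qed
    then have "M (T u) \<le> operator_norm V N M T"
      unfolding operator_norm_def by (rule cSUP_upper2[where x=u]) (use u in auto)
    moreover have "M (T u) = (1 / N v) * M (T v)"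
      unfolding u_def using pos Tscale[OF v] normed_spaceD(6)[OF W TW[OF v]] by simp
    ultimately show ?thesis using pos by (simp add: field_simps)
  qed
qed

lemma operator_norm_le:
  assumes V: "normed_space V N" and "\<And>v. v \<in> V \<Longrightarrow> N v \<le> 1 \<Longrightarrow> M (T v) \<le> K"
  shows "operator_norm V N M T \<le> K"
  unfolding operator_norm_def
  by (rule cSUP_least)
    (use assms(2) subspace_0[OF normed_spaceD(1)[OF V]] normed_spaceD(3)[OF V] in \<open>auto intro!: exI[of _ 0]\<close>)

lemma dual_space_add: "\<phi> \<in> dual_space V N \<Longrightarrow> v \<in> V \<Longrightarrow> w \<in> V \<Longrightarrow> \<phi> (v + w) = \<phi> v + \<phi> w"
  and dual_space_scale: "\<phi> \<in> dual_space V N \<Longrightarrow> v \<in> V \<Longrightarrow> \<phi> (c *\<^sub>R v) = c * \<phi> v"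
  and dual_space_outside: "\<phi> \<in> dual_space V N \<Longrightarrow> v \<notin> V \<Longrightarrow> \<phi> v = 0"
  by (auto simp: dual_space_def bounded_linear_maps_def)

lemma dual_spaceI:
  assumes "\<And>v w. v \<in> V \<Longrightarrow> w \<in> V \<Longrightarrow> \<phi> (v + w) = \<phi> v + \<phi> w"
    "\<And>v c. v \<in> V \<Longrightarrow> \<phi> (c *\<^sub>R v) = c * \<phi> v" "\<And>v. v \<notin> V \<Longrightarrow> \<phi> v = 0"
    "\<And>v. v \<in> V \<Longrightarrow> \<bar>\<phi> v\<bar> \<le> K * N v"
  shows "\<phi> \<in> dual_space V N"
  unfolding dual_space_def bounded_linear_maps_def using assms by (simp, blast)

lemma dual_space_bound:
  assumes "normed_space V N" "\<phi> \<in> dual_space V N" "v \<in> V"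
  shows "\<bar>\<phi> v\<bar> \<le> dual_norm V N \<phi> * N v"
  using operator_norm_bound[OF assms(1) normed_space_real _ assms(3), of \<phi>] assms(2)
  by (simp add: dual_space_def dual_norm_def)

lemma subspace_dual_space:
  assumes V: "normed_space V N"
  shows "subspace (dual_space V N)"
proof (rule subspaceI)
  show "0 \<in> dual_space V N" by (rule dual_spaceI[where K=0]) auto
  fix \<phi> \<psi> :: "'a \<Rightarrow> real" and c :: real assume \<phi>: "\<phi> \<in> dual_space V N"
  show "c *\<^sub>R \<phi> \<in> dual_space V N"
  proof (rule dual_spaceI[where K="\<bar>c\<bar> * dual_norm V N \<phi>"])
    show "\<bar>(c *\<^sub>R \<phi>) v\<bar> \<le> \<bar>c\<bar> * dual_norm V N \<phi> * N v" if "v \<in> V" for v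
      using mult_left_mono[OF dual_space_bound[OF V \<phi> that], of "\<bar>c\<bar>"]
      by (simp add: scaleR_fun_def abs_mult mult.assoc)
  qed (auto simp: scaleR_fun_def dual_space_add[OF \<phi>] dual_space_scale[OF \<phi>] dual_space_outside[OF \<phi>] algebra_simps)
  assume \<psi>: "\<psi> \<in> dual_space V N"
  show "\<phi> + \<psi> \<in> dual_space V N"
  proof (rule dual_spaceI[where K="dual_norm V N \<phi> + dual_norm V N \<psi>"])
    show "\<bar>(\<phi> + \<psi>) v\<bar> \<le> (dual_norm V N \<phi> + dual_norm V N \<psi>) * N v" if "v \<in> V" for v
      using dual_space_bound[OF V \<phi> that] dual_space_bound[OF V \<psi> that] by (simp add: distrib_right)
  qed (auto simp: dual_space_add[OF \<phi>] dual_space_scale[OF \<phi>] dual_space_outside[OF \<phi>]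
      dual_space_add[OF \<psi>] dual_space_scale[OF \<psi>] dual_space_outside[OF \<psi>] algebra_simps)
qed

lemma dual_norm_nonneg:
  assumes V: "normed_space V N" and \<phi>: "\<phi> \<in> dual_space V N"
  shows "dual_norm V N \<phi> \<ge> 0"
proof -
  have "bdd_above ((\<lambda>v. \<bar>\<phi> v\<bar>) ` {v\<in>V. N v \<le> 1})"
  proof (rule bdd_aboveI2)
    fix w assume w: "w \<in> {v\<in>V. N v \<le> 1}"
    then have "\<bar>\<phi> w\<bar> \<le> dual_norm V N \<phi> * N w" using dual_space_bound[OF V \<phi>] by simp
    also have "\<dots> \<le> \<bar>dual_norm V N \<phi>\<bar> * 1" using w normed_spaceD(2)[OF V] by (intro mult_mono) auto
    finally show "\<bar>\<phi> w\<bar> \<le> \<bar>dual_norm V N \<phi>\<bar>" by simp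
  qed
  then show ?thesis
    unfolding dual_norm_def operator_norm_def
    by (rule cSUP_upper2[where x=0])
      (use subspace_0[OF normed_spaceD(1)[OF V]] normed_spaceD(3)[OF V] in auto)
qed

lemma Goldstine:
  fixes V :: "'v::real_vector set"
  assumes V: "normed_space V N" and \<Phi>: "\<Phi> \<in> dual_space (dual_space V N) (dual_norm V N)"
    and K: "K > 0" "\<And>\<phi>. \<phi> \<in> dual_space V N \<Longrightarrow> \<bar>\<Phi> \<phi>\<bar> \<le> K * dual_norm V N \<phi>"
  shows "\<exists>U. ultra U \<and> eventually (\<lambda>v. v \<in> V \<and> N v \<le> K) U \<and>
    (\<forall>\<phi>\<in>dual_space V N. (\<phi> \<longlongrightarrow> \<Phi> \<phi>) U)"
proof -
  let ?V' = "dual_space V N"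
  note sub = normed_spaceD(1)[OF V]
  define G where "G = {v\<in>V. N v \<le> K}"
  have convG: "x *\<^sub>R u + y *\<^sub>R v \<in> G" if "u \<in> G" "v \<in> G" "x \<ge> 0" "y \<ge> 0" "x + y = 1" for u v x y
  proof -
    have uv: "u \<in> V" "v \<in> V" "N u \<le> K" "N v \<le> K" using that by (auto simp: G_def)
    have "N (x *\<^sub>R u + y *\<^sub>R v) \<le> N (x *\<^sub>R u) + N (y *\<^sub>R v)"
      using uv by (intro normed_spaceD(5)[OF V] subspace_scale[OF sub])
    also have "\<dots> = x * N u + y * N v" using uv that by (simp add: normed_spaceD(6)[OF V])
    also have "\<dots> \<le> x * K + y * K" using uv that by (intro add_mono mult_left_mono) auto
    also have "\<dots> = K" using that by (simp add: distrib_right[symmetric])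
    finally show ?thesis using uv by (simp add: G_def subspace_add[OF sub] subspace_scale[OF sub])
  qed
  define ev where "ev v = (\<lambda>\<phi>. if \<phi> \<in> ?V' then \<phi> v else 0)" for v :: 'v
  have conv: "convex (ev ` G)"
  proof (rule convexI)
    fix a b x y assume ab: "a \<in> ev ` G" "b \<in> ev ` G" and xy: "0 \<le> x" "0 \<le> y" "x + y = (1::real)"
    then obtain u v where uv: "u \<in> G" "v \<in> G" "a = ev u" "b = ev v" by blast
    then have "u \<in> V" "v \<in> V" by (auto simp: G_def)
    then have "x *\<^sub>R a + y *\<^sub>R b = ev (x *\<^sub>R u + y *\<^sub>R v)"
      by (auto simp: uv ev_def scaleR_fun_def fun_eq_iff dual_space_add dual_space_scale subspace_scale[OF sub])
    then show "x *\<^sub>R a + y *\<^sub>R b \<in> ev ` G" using convG[OF uv(1,2) xy] by blast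
  qed
  have "\<exists>v\<in>G. \<forall>\<phi>\<in>D. \<bar>\<phi> v - \<Phi> \<phi>\<bar> < e" if D: "finite D" "D \<subseteq> ?V'" and e: "e > 0" for D e
  proof -
    have evD: "ev v \<phi> = \<phi> v" if "\<phi> \<in> D" for v \<phi> using that D by (auto simp: ev_def)
    have "\<exists>c\<in>ev ` G. \<forall>\<phi>\<in>D. \<bar>c \<phi> - \<Phi> \<phi>\<bar> < e"
    proof (rule Helly_approx[OF D(1) conv _ e])
      fix k r assume kr: "\<And>c. c \<in> ev ` G \<Longrightarrow> (\<Sum>\<phi>\<in>D. k \<phi> * c \<phi>) \<le> r"
      define \<rho> where "\<rho> = (\<Sum>\<phi>\<in>D. k \<phi> *\<^sub>R \<phi>)"
      have *: "(\<Sum>\<phi>\<in>E. k \<phi> *\<^sub>R \<phi>) \<in> ?V' \<and> \<Phi> (\<Sum>\<phi>\<in>E. k \<phi> *\<^sub>R \<phi>) = (\<Sum>\<phi>\<in>E. k \<phi> * \<Phi> \<phi>) \<and>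
          (\<forall>v. (\<Sum>\<phi>\<in>E. k \<phi> *\<^sub>R \<phi>) v = (\<Sum>\<phi>\<in>E. k \<phi> * \<phi> v))"
        if "finite E" "E \<subseteq> ?V'" for E
        using that
      proof (induction E)
        case empty
        have "0 \<in> ?V'" by (rule subspace_0[OF subspace_dual_space[OF V]])
        moreover from this have "\<Phi> 0 = 0" using dual_space_scale[OF \<Phi>, of 0 0] by simp
        ultimately show ?case by (simp flip: zero_fun_def)
      next
        case (insert \<phi> E)
        then have \<phi>: "\<phi> \<in> ?V'" by blast
        then have "k \<phi> *\<^sub>R \<phi> \<in> ?V'" by (rule subspace_scale[OF subspace_dual_space[OF V]])
        let ?f = "\<Sum>\<phi>\<in>E. k \<phi> *\<^sub>R \<phi>"
        have f: "?f \<in> ?V'" "\<Phi> ?f = (\<Sum>\<phi>\<in>E. k \<phi> * \<Phi> \<phi>)" "\<And>v. ?f v = (\<Sum>\<phi>\<in>E. k \<phi> * \<phi> v)"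
          using insert by auto
        have eq: "(\<Sum>\<phi>\<in>insert \<phi> E. k \<phi> *\<^sub>R \<phi>) = k \<phi> *\<^sub>R \<phi> + ?f"
          using insert by (intro sum.insert)
        have g1: "k \<phi> *\<^sub>R \<phi> + ?f \<in> ?V'"
          using \<open>k \<phi> *\<^sub>R \<phi> \<in> ?V'\<close> f(1) by (rule subspace_add[OF subspace_dual_space[OF V]])
        have g2: "\<Phi> (k \<phi> *\<^sub>R \<phi> + ?f) = k \<phi> * \<Phi> \<phi> + \<Phi> ?f"
          using dual_space_add[OF \<Phi> \<open>k \<phi> *\<^sub>R \<phi> \<in> ?V'\<close> f(1)] dual_space_scale[OF \<Phi> \<phi>] by metis
        have g3: "(k \<phi> *\<^sub>R \<phi> + ?f) v = k \<phi> * \<phi> v + ?f v" for v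
          by (simp add: scaleR_fun_def)
        show ?case
          unfolding eq sum.insert[OF insert(1,2)] by (intro conjI allI g1) (simp only: g2 f(2), simp only: g3 f(3))
      qed
      have \<rho>: "\<rho> \<in> ?V'" "\<Phi> \<rho> = (\<Sum>\<phi>\<in>D. k \<phi> * \<Phi> \<phi>)" "\<And>v. \<rho> v = (\<Sum>\<phi>\<in>D. k \<phi> * \<phi> v)"
        unfolding \<rho>_def using *[OF D] by auto
      have \<rho>G: "\<rho> v \<le> r" if "v \<in> G" for v
        using kr[of "ev v"] that by (simp add: \<rho>(3) evD cong: sum.cong)
      have "dual_norm V N \<rho> \<le> r / K"
        unfolding dual_norm_def
      proof (rule operator_norm_le[OF V])
        fix v assume v: "v \<in> V" "N v \<le> 1"
        have sG: "(s * K) *\<^sub>R v \<in> G" if "\<bar>s\<bar> = 1" for s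
          using v K(1) that by (simp add: G_def subspace_scale[OF sub] normed_spaceD(6)[OF V] abs_mult)
        have "s * K * \<rho> v \<le> r" if "\<bar>s\<bar> = 1" for s
          using \<rho>G[OF sG[OF that]] v by (simp add: dual_space_scale[OF \<rho>(1)])
        from this[of 1] this[of "-1"] have "K * \<bar>\<rho> v\<bar> \<le> r" by (simp add: abs_if)
        then show "\<bar>\<rho> v\<bar> \<le> r / K" using K(1) by (simp add: field_simps)
      qed
      then have "K * dual_norm V N \<rho> \<le> r" using K(1) by (simp add: field_simps)
      then show "(\<Sum>\<phi>\<in>D. k \<phi> * \<Phi> \<phi>) \<le> r" using K(2)[OF \<rho>(1)] \<rho>(2) by simp
    qed
    then show ?thesis by (auto simp: evD)
  qed
  from ex_ultra_approx[of ?V' G "\<lambda>v \<phi>. \<phi> v" \<Phi>, OF this] show ?thesis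
    by (auto simp: G_def)
qed

section \<open>The Davis-Figiel-Johnson-Pelczynski construction\<close>

locale interpolation =
  fixes H :: "'a::real_normed_vector set"
  assumes complete: "complete (UNIV :: 'a set)"
    and conv: "convex H" and neg: "\<And>h. h \<in> H \<Longrightarrow> - h \<in> H" and ne: "H \<noteq> {}"
    and bd: "\<And>h. h \<in> H \<Longrightarrow> norm h \<le> 1" and rwc: "relatively_weakly_compact H"
begin

(* A K-functional between norm H, the gauge of H, and the norm of the space. *)
definition k :: "nat \<Rightarrow> 'a \<Rightarrow> real"
  where "k n v = (INF (t, w)\<in>{0..} \<times> H. t / 2^n + 2^n * norm (v - t *\<^sub>R w))"

lemma k_bdd: "bdd_below ((\<lambda>(t, w). t / 2^n + 2^n * norm (v - t *\<^sub>R w)) ` ({0..} \<times> H))"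
  by (rule bdd_belowI[of _ 0]) auto

lemma k_ne: "{0::real..} \<times> H \<noteq> {}" using ne by auto

lemma k_le: "t \<ge> 0 \<Longrightarrow> w \<in> H \<Longrightarrow> k n v \<le> t / 2^n + 2^n * norm (v - t *\<^sub>R w)"
  unfolding k_def by (rule cINF_lower2[OF k_bdd, of "(t, w)"]) auto

lemma k_greatest:
  assumes "\<And>t w. t \<ge> 0 \<Longrightarrow> w \<in> H \<Longrightarrow> c \<le> t / 2^n + 2^n * norm (v - t *\<^sub>R w)"
  shows "c \<le> k n v"
  unfolding k_def by (rule cINF_greatest[OF k_ne]) (use assms in auto)

lemma k_lessD:
  assumes "k n v < r"
  shows "\<exists>t\<ge>0. \<exists>w\<in>H. t / 2^n + 2^n * norm (v - t *\<^sub>R w) < r"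
proof (rule ccontr)
  assume "\<not> ?thesis"
  then have "r \<le> k n v" by (intro k_greatest) (auto simp: not_less)
  with assms show False by simp
qed

lemma k_nonneg: "0 \<le> k n v"
  by (rule k_greatest) simp

lemma k_le_norm: "k n v \<le> 2^n * norm v"
proof -
  obtain w where "w \<in> H" using ne by blast
  from k_le[OF order_refl this, of n v] show ?thesis by simp
qed

lemma norm_le_k: "norm v \<le> 2^n * k n v"
proof -
  have "norm v / 2^n \<le> k n v"
  proof (rule k_greatest)
    fix t :: real and w assume tw: "0 \<le> t" "w \<in> H"
    have "norm v \<le> norm (t *\<^sub>R w) + norm (v - t *\<^sub>R w)"
      using norm_triangle_ineq[of "t *\<^sub>R w" "v - t *\<^sub>R w"] by simp
    also have "norm (t *\<^sub>R w) \<le> t" using tw bd[OF tw(2)] by (simp add: mult_left_le)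
    also have "norm (v - t *\<^sub>R w) \<le> (2^n * 2^n) * norm (v - t *\<^sub>R w)"
      using mult_right_mono[of 1 "2^n * 2^n :: real" "norm (v - t *\<^sub>R w)"]
        mult_mono[of 1 "2^n :: real" 1 "2^n"] by simp
    finally show "norm v / 2^n \<le> t / 2^n + 2^n * norm (v - t *\<^sub>R w)" by (simp add: field_simps)
  qed
  then show ?thesis by (simp add: field_simps)
qed

lemma k_add: "k n (u + v) \<le> k n u + k n v"
proof -
  have *: "k n (u + v) - (t / 2^n + 2^n * norm (u - t *\<^sub>R w)) \<le> k n v" if tw: "t \<ge> 0" "w \<in> H" for t w
  proof (rule k_greatest)
    fix t' :: real and w' assume tw': "0 \<le> t'" "w' \<in> H"
    have "\<exists>z\<in>H. (t + t') *\<^sub>R z = t *\<^sub>R w + t' *\<^sub>R w'"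
    proof (cases "t + t' = 0")
      case True
      then have "t = 0" "t' = 0" using tw tw' by auto
      then show ?thesis using tw by auto
    next
      case False
      show ?thesis
      proof
        show "(t / (t + t')) *\<^sub>R w + (t' / (t + t')) *\<^sub>R w' \<in> H"
          using tw tw' False by (intro convexD[OF conv]) (auto simp: add_divide_distrib[symmetric])
        show "(t + t') *\<^sub>R ((t / (t + t')) *\<^sub>R w + (t' / (t + t')) *\<^sub>R w') = t *\<^sub>R w + t' *\<^sub>R w'"
          unfolding scaleR_add_right using False by simp
      qed
    qed
    then obtain z where z: "z \<in> H" "(t + t') *\<^sub>R z = t *\<^sub>R w + t' *\<^sub>R w'" by blast
    have "k n (u + v) \<le> (t + t') / 2^n + 2^n * norm ((u + v) - (t + t') *\<^sub>R z)"
      using tw tw' z by (intro k_le) auto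
    also have "(u + v) - (t + t') *\<^sub>R z = (u - t *\<^sub>R w) + (v - t' *\<^sub>R w')" using z(2) by simp
    also have "2^n * norm ((u - t *\<^sub>R w) + (v - t' *\<^sub>R w')) \<le> 2^n * (norm (u - t *\<^sub>R w) + norm (v - t' *\<^sub>R w'))"
      by (intro mult_left_mono norm_triangle_ineq) simp
    finally show "k n (u + v) - (t / 2^n + 2^n * norm (u - t *\<^sub>R w)) \<le> t' / 2^n + 2^n * norm (v - t' *\<^sub>R w')"
      by (simp add: add_divide_distrib distrib_left)
  qed
  have "k n (u + v) - k n v \<le> k n u"
    by (rule k_greatest) (use * in \<open>simp add: algebra_simps\<close>)
  then show ?thesis by simp
qed

lemma k_scale_le:
  assumes c: "c \<noteq> 0"
  shows "k n (c *\<^sub>R v) \<le> \<bar>c\<bar> * k n v"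
proof -
  have "k n (c *\<^sub>R v) / \<bar>c\<bar> \<le> k n v"
  proof (rule k_greatest)
    fix t :: real and w assume tw: "0 \<le> t" "w \<in> H"
    have "sgn c *\<^sub>R w \<in> H" using c tw neg by (auto simp: sgn_if)
    then have "k n (c *\<^sub>R v) \<le> (\<bar>c\<bar> * t) / 2^n + 2^n * norm (c *\<^sub>R v - (\<bar>c\<bar> * t) *\<^sub>R (sgn c *\<^sub>R w))"
      using tw by (intro k_le) auto
    also have "c *\<^sub>R v - (\<bar>c\<bar> * t) *\<^sub>R (sgn c *\<^sub>R w) = c *\<^sub>R (v - t *\<^sub>R w)"
      using mult_sgn_abs[of c] by (simp add: scaleR_diff_right mult.commute mult.left_commute)
    also have "norm (c *\<^sub>R (v - t *\<^sub>R w)) = \<bar>c\<bar> * norm (v - t *\<^sub>R w)" by simp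
    also have "(\<bar>c\<bar> * t) / 2^n + 2^n * (\<bar>c\<bar> * norm (v - t *\<^sub>R w)) = \<bar>c\<bar> * (t / 2^n + 2^n * norm (v - t *\<^sub>R w))"
      by (simp add: distrib_left)
    finally have "k n (c *\<^sub>R v) \<le> \<bar>c\<bar> * (t / 2^n + 2^n * norm (v - t *\<^sub>R w))" .
    then show "k n (c *\<^sub>R v) / \<bar>c\<bar> \<le> t / 2^n + 2^n * norm (v - t *\<^sub>R w)"
      using c by (simp add: divide_le_eq mult.commute)
  qed
  then show ?thesis using c by (simp add: field_simps)
qed

lemma k_scale: "k n (c *\<^sub>R v) = \<bar>c\<bar> * k n v"
proof (cases "c = 0")
  case True
  then show ?thesis using k_nonneg[of n 0] k_le_norm[of n 0] by simp
next
  case False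
  have "\<bar>c\<bar> * k n v \<le> \<bar>c\<bar> * (\<bar>inverse c\<bar> * k n (c *\<^sub>R v))"
    using k_scale_le[of "inverse c" n "c *\<^sub>R v"] False by (intro mult_left_mono) auto
  then show ?thesis using k_scale_le[OF False, of n v] False by (simp add: mult.assoc[symmetric] abs_mult[symmetric])
qed

lemma k_H: "h \<in> H \<Longrightarrow> k n h \<le> (1/2)^n"
  using k_le[of 1 h n h] by (simp add: power_one_over)

definition q :: "nat \<Rightarrow> 'a \<Rightarrow> real"
  where "q M v = L2_set (\<lambda>n. k n v) {..<M}"

lemma q_nonneg: "0 \<le> q M v" by (simp add: q_def L2_set_nonneg)

lemma q_add: "q M (u + v) \<le> q M u + q M v"
  unfolding q_def by (rule order_trans[OF L2_set_mono L2_set_triangle_ineq]) (auto simp: k_add k_nonneg)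

lemma q_scale: "q M (c *\<^sub>R v) = \<bar>c\<bar> * q M v"
  unfolding q_def k_scale by (simp add: L2_set_right_distrib)

lemma q_mono: "M \<le> M' \<Longrightarrow> q M v \<le> q M' v"
  unfolding q_def L2_set_def by (intro real_sqrt_le_mono sum_mono2) auto

lemma k_le_q: "k n v \<le> q (Suc n) v"
  unfolding q_def by (rule member_le_L2_set) auto

lemma q_sublinear: "sublinear (q M)"
  unfolding sublinear_def by (simp add: q_add q_scale)

definition qC :: "nat \<Rightarrow> real" where "qC M = (\<Sum>n<M. 2^n)"

lemma qC_nonneg: "0 \<le> qC M" by (simp add: qC_def sum_nonneg)

lemma q_le_norm: "q M v \<le> qC M * norm v"
proof -
  have "q M v \<le> (\<Sum>n<M. k n v)"
    unfolding q_def by (rule L2_set_le_sum) (simp add: k_nonneg)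
  also have "\<dots> \<le> (\<Sum>n<M. 2^n * norm v)" by (rule sum_mono) (rule k_le_norm)
  finally show ?thesis by (simp add: qC_def sum_distrib_right)
qed

definition V :: "'a set" where "V = {v. \<exists>B. \<forall>M. q M v \<le> B}"

definition N :: "'a \<Rightarrow> real" where "N v = (SUP M. q M v)"

lemma q_le_N: "v \<in> V \<Longrightarrow> q M v \<le> N v"
  unfolding V_def N_def by (rule cSUP_upper) (auto intro: bdd_aboveI)

lemma N_le: "(\<And>M. q M v \<le> B) \<Longrightarrow> N v \<le> B"
  unfolding N_def by (rule cSUP_least) auto

lemma V_I: "(\<And>M. q M v \<le> B) \<Longrightarrow> v \<in> V"
  unfolding V_def by blast

lemma norm_le_N: "v \<in> V \<Longrightarrow> norm v \<le> N v"
  using norm_le_k[of v 0] k_le_q[of 0 v] q_le_N[of v 1] by simp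

lemma N_nonneg: "v \<in> V \<Longrightarrow> 0 \<le> N v"
  using norm_le_N[of v] norm_ge_zero[of v] by linarith

lemma V_add: assumes "u \<in> V" "v \<in> V" shows "u + v \<in> V" "N (u + v) \<le> N u + N v"
proof -
  have *: "q M (u + v) \<le> N u + N v" for M
    using q_add[of M u v] q_le_N[OF assms(1), of M] q_le_N[OF assms(2), of M] by simp
  show "u + v \<in> V" "N (u + v) \<le> N u + N v" using V_I[OF *] N_le[OF *] by auto
qed

lemma V_scale_le: assumes "v \<in> V" shows "c *\<^sub>R v \<in> V" "N (c *\<^sub>R v) \<le> \<bar>c\<bar> * N v"
proof -
  have *: "q M (c *\<^sub>R v) \<le> \<bar>c\<bar> * N v" for M
    unfolding q_scale using q_le_N[OF assms, of M] by (intro mult_left_mono) auto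
  show "c *\<^sub>R v \<in> V" "N (c *\<^sub>R v) \<le> \<bar>c\<bar> * N v" using V_I[OF *] N_le[OF *] by auto
qed

lemma zero_V: "0 \<in> V" "N 0 = 0"
proof -
  have "q M 0 \<le> 0" for M using q_le_norm[of M 0] by simp
  then show "0 \<in> V" "N 0 = 0" using V_I[of 0 0] N_le[of 0 0] N_nonneg[of 0] by auto
qed

lemma N_scale: assumes "v \<in> V" shows "N (c *\<^sub>R v) = \<bar>c\<bar> * N v"
proof (cases "c = 0")
  case False
  have "\<bar>c\<bar> * N v \<le> \<bar>c\<bar> * (\<bar>inverse c\<bar> * N (c *\<^sub>R v))"
    using V_scale_le(2)[OF V_scale_le(1)[OF assms, of c], of "inverse c"] False
    by (intro mult_left_mono) auto
  then show ?thesis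
    using V_scale_le(2)[OF assms, of c] False by (simp add: mult.assoc[symmetric] abs_mult[symmetric])
qed (simp add: zero_V)

lemma subspace_V: "subspace V"
  by (rule subspaceI) (use zero_V V_add V_scale_le in auto)

lemma normed_space_V: "normed_space V N"
  unfolding normed_space_def
proof (intro conjI ballI allI subspace_V)
  show "N v = 0 \<longleftrightarrow> v = 0" if "v \<in> V" for v
    using norm_le_N[OF that] zero_V by auto
qed (auto simp: N_nonneg V_add N_scale)

lemma banach_space_V: "banach_space V N"
  unfolding banach_space_def
proof (intro conjI allI impI normed_space_V)
  fix \<sigma> :: "nat \<Rightarrow> 'a"
  assume "range \<sigma> \<subseteq> V \<and> (\<forall>\<epsilon>>0. \<exists>K. \<forall>m\<ge>K. \<forall>n\<ge>K. N (\<sigma> m - \<sigma> n) < \<epsilon>)"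
  then have \<sigma>V: "\<And>n. \<sigma> n \<in> V" and cau: "\<And>\<epsilon>. \<epsilon> > 0 \<Longrightarrow> \<exists>K. \<forall>m\<ge>K. \<forall>n\<ge>K. N (\<sigma> m - \<sigma> n) < \<epsilon>" by auto
  have diffV: "\<sigma> m - \<sigma> n \<in> V" for m n using subspace_diff[OF subspace_V \<sigma>V \<sigma>V] .
  have "Cauchy \<sigma>"
    unfolding Cauchy_def dist_norm using cau norm_le_N[OF diffV] by (meson le_less_trans)
  then obtain v where v: "\<sigma> \<longlonglongrightarrow> v"
    using complete unfolding complete_def by auto
  have close: "\<exists>K. \<forall>m\<ge>K. \<forall>M. q M (\<sigma> m - v) \<le> \<epsilon>" if \<epsilon>: "\<epsilon> > 0" for \<epsilon>
  proof -
    obtain K where K: "\<And>m n. m \<ge> K \<Longrightarrow> n \<ge> K \<Longrightarrow> N (\<sigma> m - \<sigma> n) < \<epsilon>" using cau[OF \<epsilon>] by blast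
    have "q M (\<sigma> m - v) \<le> \<epsilon>" if m: "m \<ge> K" for m M
    proof (rule tendsto_lowerbound)
      have "(\<lambda>n. \<sigma> n - v) \<longlonglongrightarrow> 0" using v by (rule LIM_zero)
      then show "(\<lambda>n. \<epsilon> + qC M * norm (\<sigma> n - v)) \<longlonglongrightarrow> \<epsilon>"
        using tendsto_add[OF tendsto_const[of \<epsilon>] tendsto_mult[OF tendsto_const[of "qC M"] tendsto_norm_zero]]
        by fastforce
      show "eventually (\<lambda>n. q M (\<sigma> m - v) \<le> \<epsilon> + qC M * norm (\<sigma> n - v)) sequentially"
        using eventually_ge_at_top[of K]
      proof eventually_elim
        case (elim n)
        have "q M (\<sigma> m - v) \<le> q M (\<sigma> m - \<sigma> n) + q M (\<sigma> n - v)"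
          using q_add[of M "\<sigma> m - \<sigma> n" "\<sigma> n - v"] by simp
        also have "q M (\<sigma> m - \<sigma> n) \<le> \<epsilon>" using q_le_N[OF diffV, of M m n] K[OF m elim] by simp
        also have "q M (\<sigma> n - v) \<le> qC M * norm (\<sigma> n - v)" by (rule q_le_norm)
        finally show ?case by simp
      qed
    qed simp
    then show ?thesis by blast
  qed
  obtain K where "\<And>M. q M (\<sigma> K - v) \<le> 1" using close[of 1] by auto
  then have "\<sigma> K - v \<in> V" by (rule V_I)
  then have vV: "v \<in> V" using subspace_diff[OF subspace_V \<sigma>V[of K]] by fastforce
  have "(\<lambda>n. N (\<sigma> n - v)) \<longlonglongrightarrow> 0"
  proof (rule LIMSEQ_I)
    fix r :: real assume r: "r > 0"
    obtain K where K: "\<And>m M. m \<ge> K \<Longrightarrow> q M (\<sigma> m - v) \<le> r/2" using close[of "r/2"] r by auto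
    have "norm (N (\<sigma> m - v) - 0) < r" if "m \<ge> K" for m
      using N_le[OF K[OF that]] N_nonneg[OF V_I[OF K[OF that]]] r by simp
    then show "\<exists>no. \<forall>n\<ge>no. norm (N (\<sigma> n - v) - 0) < r" by blast
  qed
  with vV show "\<exists>v\<in>V. (\<lambda>n. N (\<sigma> n - v)) \<longlonglongrightarrow> 0" by blast
qed

lemma N_add_small:
  assumes v: "v \<in> V" and R: "R \<ge> 0"
  shows "\<exists>\<delta>>0. \<forall>u\<in>V. N u \<le> R \<and> norm u < \<delta> \<longrightarrow> (N (v + u))\<^sup>2 \<le> (N v)\<^sup>2 + R\<^sup>2 + 1"
proof -
  define \<eta> where "\<eta> = 1 / (4 * (R + 1))"
  have \<eta>: "\<eta> > 0" "\<eta> * R \<le> 1/4" using R by (auto simp: \<eta>_def field_simps)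
  have qsq: "(q M x)\<^sup>2 = (\<Sum>n<M. (k n x)\<^sup>2)" for M x
    unfolding q_def L2_set_def by (simp add: sum_nonneg)
  have "\<exists>M0. (N v)\<^sup>2 - \<eta>\<^sup>2 \<le> (q M0 v)\<^sup>2"
  proof (cases "(N v)\<^sup>2 - \<eta>\<^sup>2 \<le> 0")
    case True
    then show ?thesis using order_trans[OF True zero_le_power2] by blast
  next
    case False
    let ?s = "sqrt ((N v)\<^sup>2 - \<eta>\<^sup>2)"
    have "?s < sqrt ((N v)\<^sup>2)" using \<eta>(1) by (intro real_sqrt_less_mono) simp
    then have "?s < N v" using N_nonneg[OF v] by simp
    then obtain M0 where "?s < q M0 v"
      using N_le[of v ?s] by (meson not_le)
    then have "?s\<^sup>2 \<le> (q M0 v)\<^sup>2" using False by (intro power_mono) auto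
    then show ?thesis using False by auto
  qed
  then obtain M0 where M0: "(N v)\<^sup>2 - \<eta>\<^sup>2 \<le> (q M0 v)\<^sup>2" by blast
  define \<delta> where "\<delta> = 1 / (4 * (N v * qC M0 + 1))"
  have pos: "N v * qC M0 \<ge> 0" using N_nonneg[OF v] qC_nonneg by simp
  have \<delta>: "\<delta> > 0" "N v * qC M0 * \<delta> \<le> 1/4" using pos by (auto simp: \<delta>_def field_simps)
  have "(N (v + u))\<^sup>2 \<le> (N v)\<^sup>2 + R\<^sup>2 + 1" if u: "u \<in> V" "N u \<le> R" "norm u < \<delta>" for u
  proof -
    have bound: "(q M (v + u))\<^sup>2 \<le> (N v)\<^sup>2 + R\<^sup>2 + 1" if M: "M \<ge> M0" for M
    proof -
      have split: "{..<M} = {..<M0} \<union> {M0..<M}" using M by auto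
      have qv: "q M v \<le> N v" and qu: "q M u \<le> R" using q_le_N[OF v] q_le_N[OF u(1), of M] u(2) by auto
      have "(L2_set (\<lambda>n. k n v) {M0..<M})\<^sup>2 = (q M v)\<^sup>2 - (q M0 v)\<^sup>2"
        unfolding qsq split by (subst sum.union_disjoint) (auto simp: L2_set_def sum_nonneg)
      also have "\<dots> \<le> \<eta>\<^sup>2" using M0 power_mono[OF qv q_nonneg, of 2] by simp
      finally have tail: "L2_set (\<lambda>n. k n v) {M0..<M} \<le> \<eta>" using less_imp_le[OF \<eta>(1)] by (rule power2_le_imp_le)
      have tailu: "L2_set (\<lambda>n. k n u) {M0..<M} \<le> R"
      proof -
        have "L2_set (\<lambda>n. k n u) {M0..<M} \<le> q M u"
          unfolding q_def L2_set_def by (intro real_sqrt_le_mono sum_mono2) auto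
        with qu show ?thesis by simp
      qed
      have "(\<Sum>n<M. k n v * k n u) = (\<Sum>n<M0. k n v * k n u) + (\<Sum>n\<in>{M0..<M}. k n v * k n u)"
        unfolding split by (rule sum.union_disjoint) auto
      also have "(\<Sum>n<M0. k n v * k n u) \<le> q M0 v * q M0 u"
        using L2_set_mult_ineq[of "\<lambda>n. k n v" "\<lambda>n. k n u" "{..<M0}"] by (simp add: q_def k_nonneg)
      also have "\<dots> \<le> N v * (qC M0 * \<delta>)"
      proof (rule mult_mono[OF q_le_N[OF v]])
        show "q M0 u \<le> qC M0 * \<delta>"
          using q_le_norm[of M0 u] mult_left_mono[OF less_imp_le[OF u(3)] qC_nonneg[of M0]] by simp
      qed (auto simp: q_nonneg N_nonneg[OF v])
      also have "\<dots> \<le> 1/4" using \<delta>(2) by (simp add: mult.assoc)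
      also have "(\<Sum>n\<in>{M0..<M}. k n v * k n u) \<le> L2_set (\<lambda>n. k n v) {M0..<M} * L2_set (\<lambda>n. k n u) {M0..<M}"
        using L2_set_mult_ineq[of "\<lambda>n. k n v" "\<lambda>n. k n u" "{M0..<M}"] by (simp add: k_nonneg)
      also have "\<dots> \<le> \<eta> * R"
        using tail tailu \<eta>(1) by (intro mult_mono) (auto simp: L2_set_nonneg)
      also have "\<dots> \<le> 1/4" by (rule \<eta>(2))
      finally have cross: "(\<Sum>n<M. k n v * k n u) \<le> 1/2" by simp
      have "(q M (v + u))\<^sup>2 \<le> (\<Sum>n<M. (k n v + k n u)\<^sup>2)"
        unfolding qsq by (intro sum_mono power_mono k_add k_nonneg)
      also have "\<dots> = (q M v)\<^sup>2 + (q M u)\<^sup>2 + 2 * (\<Sum>n<M. k n v * k n u)"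
        unfolding qsq power2_sum by (simp add: sum.distrib sum_distrib_left mult.assoc)
      also have "\<dots> \<le> (N v)\<^sup>2 + R\<^sup>2 + 1"
        using power_mono[OF qv q_nonneg, of 2] power_mono[OF qu q_nonneg, of 2] cross by simp
      finally show ?thesis .
    qed
    have vu: "v + u \<in> V" using V_add(1)[OF v u(1)] .
    have "q M (v + u) \<le> sqrt ((N v)\<^sup>2 + R\<^sup>2 + 1)" for M
      using q_mono[of M "max M M0" "v + u"] real_le_rsqrt[OF bound[of "max M M0"]] by simp
    then have "N (v + u) \<le> sqrt ((N v)\<^sup>2 + R\<^sup>2 + 1)" by (rule N_le)
    from power_mono[OF this N_nonneg[OF vu], of 2] show ?thesis by simp
  qed
  with \<delta>(1) show ?thesis by blast
qed

definition restr :: "('a \<Rightarrow> real) \<Rightarrow> 'a \<Rightarrow> real"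
  where "restr \<psi> v = (if v \<in> V then \<psi> v else 0)"

lemma restr_dual:
  assumes "bounded_linear \<psi>"
  shows "restr \<psi> \<in> dual_space V N"
proof -
  obtain K where K: "K \<ge> 0" "\<And>x. norm (\<psi> x) \<le> norm x * K"
    using bounded_linear.nonneg_bounded[OF assms] by blast
  note lin = bounded_linear.linear[OF assms]
  show ?thesis
  proof (rule dual_spaceI[where K=K])
    show "\<bar>restr \<psi> v\<bar> \<le> K * N v" if "v \<in> V" for v
      using K(2)[of v] mult_right_mono[OF norm_le_N[OF that] K(1)] that by (simp add: restr_def mult.commute)
  qed (auto simp: restr_def V_add V_scale_le linear_add[OF lin] linear_scale[OF lin])
qed

lemma bounded_linearI_le:
  assumes "linear \<psi>" "\<And>x. \<psi> x \<le> C * norm x"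
  shows "bounded_linear \<psi>"
proof (rule bounded_linear_intro[where K=C])
  show "norm (\<psi> x) \<le> norm x * C" for x
    using assms(2)[of x] assms(2)[of "- x"] linear_neg[OF assms(1), of x] by (simp add: abs_le_iff mult.commute)
qed (use assms(1) in \<open>auto simp: linear_add linear_scale\<close>)

lemma norm_sublinear: "sublinear (norm :: 'a \<Rightarrow> real)"
  by (auto simp: sublinear_def norm_triangle_ineq)

lemma bidual_point:
  fixes \<Psi> :: "('a \<Rightarrow> real) \<Rightarrow> real"
  assumes U: "ultra U" and UV: "eventually (\<lambda>v. v \<in> V \<and> N v \<le> R) U"
    and \<Psi>: "\<And>\<psi>. bounded_linear \<psi> \<Longrightarrow> (\<psi> \<longlongrightarrow> \<Psi> \<psi>) U"
  shows "\<exists>e. e \<in> V \<and> N e \<le> R \<and> (\<forall>\<psi>. bounded_linear \<psi> \<longrightarrow> \<Psi> \<psi> = \<psi> e)"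
proof -
  note Ubot = ultra_nontrivial[OF U]
  have R: "R \<ge> 0" using eventually_happens'[OF Ubot UV] N_nonneg by (metis order_trans)
  define r where "r = R + 1"
  have r: "r > 0" using R by (simp add: r_def)
  have "\<exists>y. \<forall>\<psi> C. linear \<psi> \<and> C \<ge> 0 \<and> (\<forall>x. \<psi> x \<le> C * norm x) \<longrightarrow> \<bar>\<Psi> \<psi> - \<psi> y\<bar> \<le> C * (r / 2^n)" for n
  proof -
    define g where "g v = (if v \<in> V \<and> N v \<le> R then v else 0)" for v
    have gV: "g v \<in> V" "N (g v) \<le> R" for v using zero_V R by (auto simp: g_def)
    have "k n (g v) < r" for v
      using k_le_q[of n "g v"] q_le_N[OF gV(1), of "Suc n" v] gV(2)[of v] by (simp add: r_def)
    from k_lessD[OF this] have "\<forall>v. \<exists>t w. t \<ge> 0 \<and> w \<in> H \<and> t / 2^n + 2^n * norm (g v - t *\<^sub>R w) < r" by blast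
    then obtain t w where t0: "\<And>v. t v \<ge> 0" and w: "\<And>v. w v \<in> H"
      and tw: "\<And>v. t v / 2^n + 2^n * norm (g v - t v *\<^sub>R w v) < r" by metis
    have t1: "\<bar>t v\<bar> \<le> r * 2^n" for v
    proof -
      have "t v / 2^n < r" using tw[of v] by (smt (verit) mult_nonneg_nonneg norm_ge_zero zero_le_power)
      then show ?thesis using t0[of v] by (simp add: field_simps)
    qed
    have rest: "norm (g v - t v *\<^sub>R w v) \<le> r / 2^n" for v
    proof -
      have "2^n * norm (g v - t v *\<^sub>R w v) < r" using tw[of v] t0[of v] by (smt (verit) divide_nonneg_nonneg zero_le_power)
      then show ?thesis by (simp add: field_simps)
    qed
    obtain x where x: "\<And>\<psi>::'a \<Rightarrow> real. bounded_linear \<psi> \<Longrightarrow> ((\<lambda>v. \<psi> (w v)) \<longlongrightarrow> \<psi> x) U"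
      using relatively_weakly_compact_lim[OF rwc U, of w] w by blast
    have \<tau>: "(t \<longlongrightarrow> Lim U t) U" by (rule ultra_tendsto_Lim[OF U t1])
    have "\<bar>\<Psi> \<psi> - \<psi> (Lim U t *\<^sub>R x)\<bar> \<le> C * (r / 2^n)"
      if \<psi>: "linear \<psi>" "C \<ge> 0" "\<forall>x. \<psi> x \<le> C * norm x" for \<psi> C
    proof (rule tendsto_upperbound[OF _ _ Ubot])
      have bl: "bounded_linear \<psi>" using \<psi> by (intro bounded_linearI_le) auto
      show "((\<lambda>v. \<bar>\<psi> v - t v * \<psi> (w v)\<bar>) \<longlongrightarrow> \<bar>\<Psi> \<psi> - \<psi> (Lim U t *\<^sub>R x)\<bar>) U"
        unfolding linear_scale[OF \<psi>(1)] real_scaleR_def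
        by (intro tendsto_rabs tendsto_diff tendsto_mult \<tau> \<Psi>[OF bl] x[OF bl])
      show "eventually (\<lambda>v. \<bar>\<psi> v - t v * \<psi> (w v)\<bar> \<le> C * (r / 2^n)) U"
        using UV
      proof eventually_elim
        case (elim v)
        then have "g v = v" by (simp add: g_def)
        have "\<bar>\<psi> z\<bar> \<le> C * norm z" for z
          using \<psi>(3)[rule_format, of z] \<psi>(3)[rule_format, of "- z"] linear_neg[OF \<psi>(1), of z] by (simp add: abs_le_iff)
        then have "\<bar>\<psi> (g v - t v *\<^sub>R w v)\<bar> \<le> C * norm (g v - t v *\<^sub>R w v)" .
        also have "\<dots> \<le> C * (r / 2^n)" using rest \<psi>(2) by (rule mult_left_mono)
        finally show ?case using \<open>g v = v\<close> by (simp add: linear_diff[OF \<psi>(1)] linear_scale[OF \<psi>(1)])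
      qed
    qed
    then show ?thesis by blast
  qed
  then obtain y where y: "\<And>n \<psi> C. linear \<psi> \<Longrightarrow> C \<ge> 0 \<Longrightarrow> (\<And>x. \<psi> x \<le> C * norm x) \<Longrightarrow>
      \<bar>\<Psi> \<psi> - \<psi> (y n)\<bar> \<le> C * (r / 2^n)"
    by metis
  have yd: "dist (y m) (y n) \<le> r / 2^m + r / 2^n" for m n
  proof -
    obtain \<psi> where \<psi>: "linear \<psi>" "\<And>x. \<psi> x \<le> norm x" "\<psi> (y m - y n) = norm (y m - y n)"
      using Hahn_Banach_point[OF norm_sublinear, of "y m - y n"] by blast
    have "dist (y m) (y n) = \<psi> (y m) - \<psi> (y n)"
      using \<psi>(3) by (simp add: linear_diff[OF \<psi>(1)] dist_norm)
    then show ?thesis using y[OF \<psi>(1), of 1 m] y[OF \<psi>(1), of 1 n] \<psi>(2) by (simp add: abs_le_iff)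
  qed
  have r0: "(\<lambda>n. r / 2^n) \<longlonglongrightarrow> 0"
    using tendsto_mult[OF tendsto_const[of r] LIMSEQ_power_zero[of "1/2::real"]]
    by (simp add: power_one_over)
  have "Cauchy y"
  proof (rule metric_CauchyI)
    fix e :: real assume e: "e > 0"
    have "eventually (\<lambda>n. r / 2^n < e/2) sequentially"
      using r0 by (rule order_tendstoD) (use e in simp)
    then obtain M where M: "\<And>n. n \<ge> M \<Longrightarrow> r / 2^n < e/2" by (auto simp: eventually_sequentially)
    have "dist (y m) (y n) < e" if "m \<ge> M" "n \<ge> M" for m n
      using le_less_trans[OF yd add_strict_mono[OF M[OF that(1)] M[OF that(2)]]]
      by (simp only: field_sum_of_halves)
    then show "\<exists>M. \<forall>m\<ge>M. \<forall>n\<ge>M. dist (y m) (y n) < e" by blast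
  qed
  then obtain e where e: "y \<longlonglongrightarrow> e" using complete unfolding complete_def by auto
  have eq: "\<Psi> \<psi> = \<psi> e" if bl: "bounded_linear \<psi>" for \<psi> :: "'a \<Rightarrow> real"
  proof -
    obtain C where C: "C \<ge> 0" "\<And>x. \<bar>\<psi> x\<bar> \<le> norm x * C"
      using bounded_linear.nonneg_bounded[OF bl] by auto
    have C': "\<psi> x \<le> C * norm x" for x using C(2)[of x] by (simp add: mult.commute abs_le_iff)
    have near: "\<bar>\<Psi> \<psi> - \<psi> (y n)\<bar> \<le> C * (r / 2^n)" for n
      by (rule y[OF bounded_linear.linear[OF bl] C(1) C'])
    have lim0: "(\<lambda>n. \<Psi> \<psi> - \<psi> (y n)) \<longlonglongrightarrow> 0"
    proof (rule Lim_null_comparison)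
      show "eventually (\<lambda>n. norm (\<Psi> \<psi> - \<psi> (y n)) \<le> C * (r / 2^n)) sequentially"
        unfolding real_norm_def by (rule always_eventually, rule allI, rule near)
      show "(\<lambda>n. C * (r / 2^n)) \<longlonglongrightarrow> 0"
        using tendsto_mult[OF tendsto_const[of C] r0] unfolding mult_zero_right .
    qed
    have "(\<lambda>n. \<Psi> \<psi> - \<psi> (y n)) \<longlonglongrightarrow> \<Psi> \<psi> - \<psi> e"
      by (intro tendsto_diff tendsto_const bounded_linear.tendsto[OF bl] e)
    from LIMSEQ_unique[OF lim0 this] show ?thesis by simp
  qed
  have qe: "q M e \<le> R" for M
  proof -
    obtain \<psi> where \<psi>: "linear \<psi>" "\<And>x. \<psi> x \<le> q M x" "\<psi> e = q M e"
      using Hahn_Banach_point[OF q_sublinear, of M e] by blast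
    have bl: "bounded_linear \<psi>"
      by (rule bounded_linearI_le[OF \<psi>(1) order_trans[OF \<psi>(2) q_le_norm]])
    have "\<Psi> \<psi> \<le> R"
    proof (rule tendsto_upperbound[OF \<Psi>[OF bl] _ Ubot])
      show "eventually (\<lambda>v. \<psi> v \<le> R) U"
        using UV by eventually_elim (rule order_trans[OF \<psi>(2) order_trans[OF q_le_N]], auto)
    qed
    then show ?thesis using eq[OF bl] \<psi>(3) by simp
  qed
  show ?thesis
    using V_I[OF qe] N_le[OF qe] eq by blast
qed

lemma reflexive_V: "reflexive_banach_space V N"
  unfolding reflexive_banach_space_def
proof (intro conjI ballI banach_space_V)
  fix \<Phi> assume \<Phi>: "\<Phi> \<in> dual_space (dual_space V N) (dual_norm V N)"
  then obtain K0 where K0: "\<And>\<phi>. \<phi> \<in> dual_space V N \<Longrightarrow> \<bar>\<Phi> \<phi>\<bar> \<le> K0 * dual_norm V N \<phi>"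
    unfolding dual_space_def[of "dual_space V N"] bounded_linear_maps_def by blast
  define K where "K = \<bar>K0\<bar> + 1"
  have K: "K > 0" by (simp add: K_def)
  have "\<bar>\<Phi> \<phi>\<bar> \<le> K * dual_norm V N \<phi>" if "\<phi> \<in> dual_space V N" for \<phi>
  proof (rule order_trans[OF K0[OF that] mult_right_mono])
    show "K0 \<le> K" by (simp add: K_def)
    show "0 \<le> dual_norm V N \<phi>" by (rule dual_norm_nonneg[OF normed_space_V that])
  qed
  from Goldstine[OF normed_space_V \<Phi> K this] obtain U where U: "ultra U"
      "eventually (\<lambda>v. v \<in> V \<and> N v \<le> K) U" "\<And>\<phi>. \<phi> \<in> dual_space V N \<Longrightarrow> (\<phi> \<longlongrightarrow> \<Phi> \<phi>) U" by blast
  note Ubot = ultra_nontrivial[OF U(1)]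
  have Ures: "(\<psi> \<longlongrightarrow> \<Phi> (restr \<psi>)) U" if "bounded_linear \<psi>" for \<psi>
  proof (rule Lim_transform_eventually[OF U(3)[OF restr_dual[OF that]]])
    show "eventually (\<lambda>v. restr \<psi> v = \<psi> v) U"
      using U(2) by eventually_elim (simp add: restr_def)
  qed
  obtain e where e: "e \<in> V" "N e \<le> K" "\<And>\<psi>. bounded_linear \<psi> \<Longrightarrow> \<Phi> (restr \<psi>) = \<psi> e"
    using bidual_point[OF U(1,2), of "\<lambda>\<psi>. \<Phi> (restr \<psi>)"] Ures by blast
  have "\<Phi> \<phi> = \<phi> e" if \<phi>: "\<phi> \<in> dual_space V N" for \<phi>
  proof (rule ccontr)
    assume neq: "\<Phi> \<phi> \<noteq> \<phi> e"
    define c where "c = \<bar>\<Phi> \<phi> - \<phi> e\<bar>"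
    define s where "s = sgn (\<Phi> \<phi> - \<phi> e)"
    have c: "c > 0" and s: "\<bar>s\<bar> = 1" "s * (\<Phi> \<phi> - \<phi> e) = c"
      using neq by (auto simp: c_def s_def sgn_if)
    define R where "R = 2 * K"
    have R: "R > 0" using K by (simp add: R_def)
    define G where "G = {u\<in>V. N u \<le> R \<and> c/2 \<le> s * \<phi> u}"
    have UG: "eventually (\<lambda>v. v - e \<in> G) U"
    proof -
      have lim: "((\<lambda>v. s * (\<phi> v - \<phi> e)) \<longlongrightarrow> c) U"
        unfolding s(2)[symmetric] by (intro tendsto_mult tendsto_diff tendsto_const U(3) \<phi>)
      have "eventually (\<lambda>v. c/2 < s * (\<phi> v - \<phi> e)) U"
        using lim by (rule order_tendstoD) (use c in simp)
      with U(2) show ?thesis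
      proof eventually_elim
        case (elim v)
        have me: "- e \<in> V" "N (- e) \<le> K" using V_scale_le[OF e(1), of "-1"] e(2) by auto
        have "\<phi> (v + - e) = \<phi> v - \<phi> e"
          using dual_space_add[OF \<phi> _ me(1), of v] dual_space_scale[OF \<phi> e(1), of "-1"] elim by simp
        then show ?case
          using elim me V_add[of v "- e"] by (simp add: G_def R_def)
      qed
    qed
    have Gne: "G \<noteq> {}" using eventually_happens'[OF Ubot UG] by blast
    have Gconv: "convex G"
    proof (rule convexI)
      fix u v x y assume uv: "u \<in> G" "v \<in> G" and xy: "0 \<le> x" "0 \<le> y" "x + y = (1::real)"
      have V: "u \<in> V" "v \<in> V" "x *\<^sub>R u \<in> V" "y *\<^sub>R v \<in> V" using uv V_scale_le by (auto simp: G_def)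
      have "N (x *\<^sub>R u + y *\<^sub>R v) \<le> x * N u + y * N v"
        using V_add(2)[OF V(3,4)] V xy by (simp add: N_scale)
      also have "\<dots> \<le> x * R + y * R"
        using uv xy by (intro add_mono mult_left_mono) (auto simp: G_def)
      also have "\<dots> = R" using xy by (simp add: distrib_right[symmetric])
      finally have 1: "N (x *\<^sub>R u + y *\<^sub>R v) \<le> R" .
      have "c/2 = x * (c/2) + y * (c/2)" using xy by (simp add: distrib_right[symmetric])
      also have "\<dots> \<le> x * (s * \<phi> u) + y * (s * \<phi> v)"
        using uv xy by (intro add_mono mult_left_mono) (auto simp: G_def)
      also have "\<dots> = s * \<phi> (x *\<^sub>R u + y *\<^sub>R v)"
        using V by (simp add: dual_space_add[OF \<phi>] dual_space_scale[OF \<phi>] algebra_simps)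
      finally show "x *\<^sub>R u + y *\<^sub>R v \<in> G" using 1 V V_add by (simp add: G_def)
    qed
    have small: "\<exists>u\<in>G. norm u < \<delta>" if \<delta>: "\<delta> > 0" for \<delta>
    proof (rule ccontr)
      assume "\<not> ?thesis"
      then have far: "\<delta> \<le> norm (0 - u)" if "u \<in> G" for u using that by (simp add: not_less)
      obtain \<psi> where \<psi>: "linear \<psi>" "\<And>x. \<psi> x \<le> norm x" "\<And>u. u \<in> G \<Longrightarrow> \<psi> u + \<delta> \<le> \<psi> 0"
        using convex_separation[OF norm_sublinear Gconv Gne, of \<delta> 0] far by blast
      have bl: "bounded_linear \<psi>" by (rule bounded_linearI_le[of _ 1]) (use \<psi> in auto)
      have "\<psi> e + \<delta> \<le> \<psi> e"
      proof (rule tendsto_upperbound[OF _ _ Ubot])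
        show "((\<lambda>v. \<psi> v + \<delta>) \<longlongrightarrow> \<psi> e + \<delta>) U"
          using Ures[OF bl] e(3)[OF bl] by (intro tendsto_intros) simp
        show "eventually (\<lambda>v. \<psi> v + \<delta> \<le> \<psi> e) U"
          using UG
        proof eventually_elim
          case (elim v)
          from \<psi>(3)[OF elim] show ?case by (simp add: linear_diff[OF \<psi>(1)] linear_0[OF \<psi>(1)])
        qed
      qed
      then show False using \<delta> by simp
    qed
    have grow: "\<exists>u\<in>V. (N u)\<^sup>2 \<le> real m * (R\<^sup>2 + 1) \<and> real m * (c/2) \<le> s * \<phi> u" for m :: nat
    proof (induction m)
      case 0
      have "\<phi> 0 = 0" using dual_space_scale[OF \<phi> zero_V(1), of 0] by simp
      then show ?case using zero_V by auto
    next
      case (Suc m)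
      then obtain u where u: "u \<in> V" "(N u)\<^sup>2 \<le> real m * (R\<^sup>2 + 1)" "real m * (c/2) \<le> s * \<phi> u" by blast
      obtain \<delta> where \<delta>: "\<delta> > 0" "\<And>w. w \<in> V \<Longrightarrow> N w \<le> R \<Longrightarrow> norm w < \<delta> \<Longrightarrow> (N (u + w))\<^sup>2 \<le> (N u)\<^sup>2 + R\<^sup>2 + 1"
        using N_add_small[OF u(1) less_imp_le[OF R]] by blast
      obtain w where w: "w \<in> G" "norm w < \<delta>" using small[OF \<delta>(1)] by blast
      then have wV: "w \<in> V" "N w \<le> R" "c/2 \<le> s * \<phi> w" by (auto simp: G_def)
      have "(N (u + w))\<^sup>2 \<le> real (Suc m) * (R\<^sup>2 + 1)" using \<delta>(2)[OF wV(1,2) w(2)] u(2) by (simp add: algebra_simps)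
      moreover have "real (Suc m) * (c/2) \<le> s * \<phi> (u + w)"
        using u(3) wV(3) by (simp add: dual_space_add[OF \<phi> u(1) wV(1)] algebra_simps)
      ultimately show ?case using V_add(1)[OF u(1) wV(1)] by blast
    qed
    have bound: "real m * (c/2)\<^sup>2 \<le> (dual_norm V N \<phi>)\<^sup>2 * (R\<^sup>2 + 1)" if m: "m > 0" for m :: nat
    proof -
      obtain u where u: "u \<in> V" "(N u)\<^sup>2 \<le> real m * (R\<^sup>2 + 1)" "real m * (c/2) \<le> s * \<phi> u"
        using grow[of m] by blast
      have "s * \<phi> u \<le> \<bar>\<phi> u\<bar>" using s(1) by (metis abs_ge_self abs_mult mult_1)
      then have "real m * (c/2) \<le> dual_norm V N \<phi> * N u"
        using u(3) dual_space_bound[OF normed_space_V \<phi> u(1)] by simp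
      from power_mono[OF this, of 2] have "(real m)\<^sup>2 * (c/2)\<^sup>2 \<le> (dual_norm V N \<phi>)\<^sup>2 * (N u)\<^sup>2"
        using c unfolding power_mult_distrib by auto
      also have "\<dots> \<le> (dual_norm V N \<phi>)\<^sup>2 * (real m * (R\<^sup>2 + 1))" using u(2) by (intro mult_left_mono) auto
      finally have "real m * (real m * (c/2)\<^sup>2) \<le> real m * ((dual_norm V N \<phi>)\<^sup>2 * (R\<^sup>2 + 1))"
        by (simp only: power2_eq_square[of "real m"] mult_ac)
      then show ?thesis using m by (subst (asm) mult_le_cancel_left_pos) auto
    qed
    have "(c/2)\<^sup>2 > 0" using c by simp
    then obtain m :: nat where m: "(dual_norm V N \<phi>)\<^sup>2 * (R\<^sup>2 + 1) < real m * (c/2)\<^sup>2"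
      using ex_less_of_nat_mult by blast
    have "(dual_norm V N \<phi>)\<^sup>2 * (R\<^sup>2 + 1) \<ge> 0" by simp
    from le_less_trans[OF this m] have "m > 0" by (cases m) simp_all
    from bound[OF this] m show False by simp
  qed
  with e(1) show "\<exists>v\<in>V. \<forall>\<phi>\<in>dual_space V N. \<Phi> \<phi> = \<phi> v" by blast
qed

lemma H_subset_V: "h \<in> H \<Longrightarrow> h \<in> V"
proof (rule V_I[where B=2])
  fix M assume h: "h \<in> H"
  have "q M h \<le> (\<Sum>n<M. k n h)" unfolding q_def by (rule L2_set_le_sum) (simp add: k_nonneg)
  also have "\<dots> \<le> (\<Sum>n<M. (1/2)^n)" by (rule sum_mono) (rule k_H[OF h])
  also have "\<dots> = (1 - (1/2)^M) / (1 - 1/2)" by (subst sum_gp_strict) simp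
  also have "\<dots> \<le> 2" by simp
  finally show "q M h \<le> 2" .
qed

lemma contraction:
  assumes L: "linear L" and LH: "\<And>h. h \<in> H \<Longrightarrow> L h \<in> H" and Ln: "\<And>v. norm (L v) \<le> norm v" and v: "v \<in> V"
  shows "L v \<in> V" "N (L v) \<le> N v"
proof -
  have kL: "k n (L v) \<le> k n v" for n v
  proof (rule k_greatest)
    fix t :: real and w assume tw: "0 \<le> t" "w \<in> H"
    have "k n (L v) \<le> t / 2^n + 2^n * norm (L v - t *\<^sub>R L w)" using tw LH by (intro k_le)
    also have "L v - t *\<^sub>R L w = L (v - t *\<^sub>R w)" by (simp add: linear_diff[OF L] linear_scale[OF L])
    also have "2^n * norm (L (v - t *\<^sub>R w)) \<le> 2^n * norm (v - t *\<^sub>R w)" using Ln by (intro mult_left_mono) auto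
    finally show "k n (L v) \<le> t / 2^n + 2^n * norm (v - t *\<^sub>R w)" by simp
  qed
  have "q M (L v) \<le> N v" for M
  proof (rule order_trans[OF _ q_le_N[OF v]])
    show "q M (L v) \<le> q M v" unfolding q_def by (rule L2_set_mono) (auto simp: kL k_nonneg)
  qed
  then show "L v \<in> V" "N (L v) \<le> N v" using V_I N_le by blast+
qed

end

section \<open>Reflexive representations give weakly almost periodic functions\<close>

lemma reflexive_lim:
  assumes V: "reflexive_banach_space V N" and F: "ultra F"
    and u: "\<And>i. u i \<in> V" "\<And>i. N (u i) \<le> R"
  shows "\<exists>e\<in>V. \<forall>\<psi>\<in>dual_space V N. ((\<lambda>i. \<psi> (u i)) \<longlongrightarrow> \<psi> e) F"
proof -
  have nV: "normed_space V N" using V by (simp add: reflexive_banach_space_def banach_space_def)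
  note Fbot = ultra_nontrivial[OF F]
  let ?V' = "dual_space V N"
  note sub' = subspace_dual_space[OF nV]
  have ub: "\<bar>\<psi> (u i)\<bar> \<le> R * dual_norm V N \<psi>" if "\<psi> \<in> ?V'" for \<psi> i
    using dual_space_bound[OF nV that u(1), of i] mult_right_mono[OF u(2)[of i] dual_norm_nonneg[OF nV that]]
    by (simp add: mult.commute)
  define \<Phi> where "\<Phi> \<psi> = (if \<psi> \<in> ?V' then Lim F (\<lambda>i. \<psi> (u i)) else 0)" for \<psi>
  have \<Phi>: "((\<lambda>i. \<psi> (u i)) \<longlongrightarrow> \<Phi> \<psi>) F" if "\<psi> \<in> ?V'" for \<psi>
    using that ultra_tendsto_Lim[OF F ub[OF that]] by (simp add: \<Phi>_def)
  have "\<Phi> \<in> dual_space ?V' (dual_norm V N)"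
  proof (rule dual_spaceI[where K=R])
    fix \<psi> \<psi>' and c :: real assume \<psi>: "\<psi> \<in> ?V'"
    have "((\<lambda>i. (c *\<^sub>R \<psi>) (u i)) \<longlongrightarrow> c * \<Phi> \<psi>) F"
      unfolding scaleR_fun_def real_scaleR_def by (intro tendsto_mult tendsto_const \<Phi> \<psi>)
    from tendsto_unique[OF Fbot \<Phi>[OF subspace_scale[OF sub' \<psi>]] this]
    show "\<Phi> (c *\<^sub>R \<psi>) = c * \<Phi> \<psi>" .
    show "\<bar>\<Phi> \<psi>\<bar> \<le> R * dual_norm V N \<psi>"
      by (rule tendsto_upperbound[OF tendsto_rabs[OF \<Phi>[OF \<psi>]] _ Fbot]) (simp add: ub[OF \<psi>])
    assume \<psi>': "\<psi>' \<in> ?V'"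
    have "((\<lambda>i. (\<psi> + \<psi>') (u i)) \<longlongrightarrow> \<Phi> \<psi> + \<Phi> \<psi>') F"
      unfolding plus_fun_apply by (intro tendsto_add \<Phi> \<psi> \<psi>')
    from tendsto_unique[OF Fbot \<Phi>[OF subspace_add[OF sub' \<psi> \<psi>']] this]
    show "\<Phi> (\<psi> + \<psi>') = \<Phi> \<psi> + \<Phi> \<psi>'" .
  qed (simp add: \<Phi>_def)
  then obtain e where "e \<in> V" "\<And>\<psi>. \<psi> \<in> ?V' \<Longrightarrow> \<Phi> \<psi> = \<psi> e"
    using V unfolding reflexive_banach_space_def by blast
  with \<Phi> show ?thesis by metis
qed

lemma reflexive_double_limit:
  assumes V: "reflexive_banach_space V N"
    and u: "\<And>i. u i \<in> V" "\<And>i. N (u i) \<le> R"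
    and \<phi>: "\<And>j. \<phi> j \<in> dual_space V N" "\<And>j. dual_norm V N (\<phi> j) \<le> 1"
  shows "\<exists>r s l. (\<forall>i. ((\<lambda>j. \<phi> j (u i)) \<longlongrightarrow> r i) \<omega>) \<and> (r \<longlongrightarrow> l) \<omega> \<and>
    (\<forall>j. ((\<lambda>i. \<phi> j (u i)) \<longlongrightarrow> s j) \<omega>) \<and> (s \<longlongrightarrow> l) \<omega>"
proof -
  have nV: "normed_space V N" using V by (simp add: reflexive_banach_space_def banach_space_def)
  have \<phi>N: "\<bar>\<phi> j v\<bar> \<le> N v" if "v \<in> V" for j v
    using dual_space_bound[OF nV \<phi>(1) that, of j] mult_right_mono[OF \<phi>(2)[of j] normed_spaceD(2)[OF nV that]]
    by simp
  define \<Delta> where "\<Delta> v = (if v \<in> V then Lim \<omega> (\<lambda>j. \<phi> j v) else 0)" for v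
  have \<Delta>: "((\<lambda>j. \<phi> j v) \<longlongrightarrow> \<Delta> v) \<omega>" if "v \<in> V" for v
    using that tendsto_\<omega>_Lim[OF \<phi>N[OF that]] by (simp add: \<Delta>_def)
  have "\<Delta> \<in> dual_space V N"
  proof (rule dual_spaceI[where K=1])
    fix v w and c :: real assume v: "v \<in> V"
    have "((\<lambda>j. \<phi> j (c *\<^sub>R v)) \<longlongrightarrow> c * \<Delta> v) \<omega>"
      unfolding dual_space_scale[OF \<phi>(1) v] by (intro tendsto_mult tendsto_const \<Delta> v)
    from tendsto_unique[OF \<omega>_bot \<Delta>[OF subspace_scale[OF normed_spaceD(1)[OF nV] v]] this]
    show "\<Delta> (c *\<^sub>R v) = c * \<Delta> v" .
    show "\<bar>\<Delta> v\<bar> \<le> 1 * N v"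
      using v abs_Lim_\<omega>_le[OF \<phi>N[OF v]] by (simp add: \<Delta>_def)
    assume w: "w \<in> V"
    have "((\<lambda>j. \<phi> j (v + w)) \<longlongrightarrow> \<Delta> v + \<Delta> w) \<omega>"
      unfolding dual_space_add[OF \<phi>(1) v w] by (intro tendsto_add \<Delta> v w)
    from tendsto_unique[OF \<omega>_bot \<Delta>[OF subspace_add[OF normed_spaceD(1)[OF nV] v w]] this]
    show "\<Delta> (v + w) = \<Delta> v + \<Delta> w" .
  qed (simp add: \<Delta>_def)
  moreover obtain e where e: "e \<in> V" "\<And>\<psi>. \<psi> \<in> dual_space V N \<Longrightarrow> ((\<lambda>i. \<psi> (u i)) \<longlongrightarrow> \<psi> e) \<omega>"
    using reflexive_lim[OF V \<omega>_props(2), of u, OF u] by blast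
  ultimately have "((\<lambda>i. \<Delta> (u i)) \<longlongrightarrow> \<Delta> e) \<omega>" by blast
  with \<Delta>[OF u(1)] e(2)[OF \<phi>(1)] \<Delta>[OF e(1)] show ?thesis
    by (intro exI[of _ "\<lambda>i. \<Delta> (u i)"] exI[of _ "\<lambda>j. \<phi> j e"] exI[of _ "\<Delta> e"]) auto
qed

lemma representationD:
  assumes "representation act V N h \<alpha>"
  shows "h s \<in> bounded_linear_maps V N V N" "operator_norm V N N (h s) \<le> 1"
    "\<alpha> x \<in> dual_space V N" "dual_norm V N (\<alpha> x) \<le> 1"
    "v \<in> V \<Longrightarrow> \<alpha> (act s x) v = \<alpha> x (h s v)"
    "v \<in> V \<Longrightarrow> continuous_on UNIV (\<lambda>x. \<alpha> x v)"
proof -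
  have h: "continuous_map euclidean (\<Theta>_wot V N) h"
    and \<alpha>: "continuous_map euclidean (weak_star_dual_ball V N) \<alpha>"
    using assms by (auto simp: representation_def)
  have "h s \<in> topspace (\<Theta>_wot V N)" "\<alpha> x \<in> topspace (weak_star_dual_ball V N)"
    using continuous_map_image_subset_topspace[OF h] continuous_map_image_subset_topspace[OF \<alpha>] by auto
  then show "h s \<in> bounded_linear_maps V N V N" "operator_norm V N N (h s) \<le> 1"
    "\<alpha> x \<in> dual_space V N" "dual_norm V N (\<alpha> x) \<le> 1"
    by (auto simp: \<Theta>_wot_def weak_star_dual_ball_def)
  show "v \<in> V \<Longrightarrow> \<alpha> (act s x) v = \<alpha> x (h s v)"
    using assms by (auto simp: representation_def)
  assume "v \<in> V"
  then have "continuous_map (weak_star_dual_ball V N) euclideanreal (\<lambda>\<phi>. \<phi> v)"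
    unfolding weak_star_dual_ball_def by (intro continuous_map_initial_topology_coordinate) blast
  from continuous_map_compose[OF \<alpha> this] show "continuous_on UNIV (\<lambda>x. \<alpha> x v)"
    by (simp add: o_def)
qed

(* Products of matrix coefficients are weakly almost periodic because the double limits of the
   factors can be interchanged; sums of squares suffice to separate points from closed sets. *)
lemma WAP_sum_squares:
  fixes act :: "'s::{semigroup_mult, topological_space} \<Rightarrow> 'x::topological_space \<Rightarrow> 'x"
  assumes V: "reflexive_banach_space V N" and rep: "representation act V N h \<alpha>"
    and D: "finite D" "D \<subseteq> V"
  shows "\<exists>g\<in>WAP act. \<forall>x. apply_bcontfun g x = (\<Sum>v\<in>D. (\<alpha> x v - c v)\<^sup>2)"
proof -
  note R = representationD[OF rep]
  have nV: "normed_space V N" using V by (simp add: reflexive_banach_space_def banach_space_def)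
  have \<alpha>N: "\<bar>\<alpha> x v\<bar> \<le> N v" if "v \<in> V" for x v
    using dual_space_bound[OF nV R(3) that, of x] mult_right_mono[OF R(4)[of x] normed_spaceD(2)[OF nV that]]
    by simp
  have hV: "h s v \<in> V" "N (h s v) \<le> N v" if "v \<in> V" for s v
  proof -
    show "h s v \<in> V" using R(1)[of s] that by (auto simp: bounded_linear_maps_def)
    show "N (h s v) \<le> N v"
      using operator_norm_bound[OF nV nV R(1) that, of s]
        mult_right_mono[OF R(2)[of s] normed_spaceD(2)[OF nV that]] by simp
  qed
  define g0 where "g0 x = (\<Sum>v\<in>D. (\<alpha> x v - c v)\<^sup>2)" for x
  have "g0 \<in> bcontfun"
  proof (rule bcontfun_normI)
    show "continuous_on UNIV g0"
      unfolding g0_def using D(2) by (intro continuous_intros R(6)) auto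
    show "norm (g0 x) \<le> (\<Sum>v\<in>D. (N v + \<bar>c v\<bar>)\<^sup>2)" for x
    proof -
      have "(\<alpha> x v - c v)\<^sup>2 \<le> (N v + \<bar>c v\<bar>)\<^sup>2" if "v \<in> D" for v
        using \<alpha>N[of v x] that D(2) by (intro power2_le_iff_abs_le[THEN iffD2]) auto
      then have "g0 x \<le> (\<Sum>v\<in>D. (N v + \<bar>c v\<bar>)\<^sup>2)" unfolding g0_def by (rule sum_mono)
      moreover have "g0 x \<ge> 0" by (simp add: g0_def sum_nonneg)
      ultimately show ?thesis by simp
    qed
  qed
  define g where "g = Bcontfun g0"
  have g: "apply_bcontfun g x = (\<Sum>v\<in>D. (\<alpha> x v - c v)\<^sup>2)" for x
    unfolding g_def Bcontfun_inverse[OF \<open>g0 \<in> bcontfun\<close>] g0_def ..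
  have "relatively_weakly_compact (orbit act g)"
  proof (rule stable_imp_relatively_weakly_compact)
    show "norm k \<le> norm g" if "k \<in> orbit act g" for k
      using that by (intro norm_bound) (auto simp: orbit_def abs_apply_le_norm)
    show "stable (orbit act g) UNIV apply_bcontfun"
      unfolding stable_def
    proof (intro allI impI)
      fix a :: "nat \<Rightarrow> 'x \<Rightarrow>\<^sub>C real" and y :: "nat \<Rightarrow> 'x"
      assume "range a \<subseteq> orbit act g \<and> range y \<subseteq> UNIV"
      then have "\<forall>i. \<exists>s. \<forall>x. apply_bcontfun (a i) x = apply_bcontfun g (act s x)"
        unfolding orbit_def by blast
      then obtain s where s: "\<And>i x. apply_bcontfun (a i) x = apply_bcontfun g (act (s i) x)" by metis
      have a: "apply_bcontfun (a i) (y j) = (\<Sum>v\<in>D. (\<alpha> (y j) (h (s i) v) - c v)\<^sup>2)" for i j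
        unfolding s g using D(2) R(5) by (intro sum.cong) auto
      have "\<forall>v\<in>D. \<exists>r q l. (\<forall>i. ((\<lambda>j. \<alpha> (y j) (h (s i) v)) \<longlongrightarrow> r i) \<omega>) \<and> (r \<longlongrightarrow> l) \<omega> \<and>
          (\<forall>j. ((\<lambda>i. \<alpha> (y j) (h (s i) v)) \<longlongrightarrow> q j) \<omega>) \<and> (q \<longlongrightarrow> l) \<omega>"
      proof
        fix v assume "v \<in> D"
        then have v: "v \<in> V" using D(2) by blast
        show "\<exists>r q l. (\<forall>i. ((\<lambda>j. \<alpha> (y j) (h (s i) v)) \<longlongrightarrow> r i) \<omega>) \<and> (r \<longlongrightarrow> l) \<omega> \<and>
          (\<forall>j. ((\<lambda>i. \<alpha> (y j) (h (s i) v)) \<longlongrightarrow> q j) \<omega>) \<and> (q \<longlongrightarrow> l) \<omega>"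
          by (rule reflexive_double_limit[OF V, where R="N v"]) (use hV[OF v] R(3,4) in auto)
      qed
      then obtain r q l where rql: "\<And>v i. v \<in> D \<Longrightarrow> ((\<lambda>j. \<alpha> (y j) (h (s i) v)) \<longlongrightarrow> r v i) \<omega>"
          "\<And>v. v \<in> D \<Longrightarrow> (r v \<longlongrightarrow> l v) \<omega>"
          "\<And>v j. v \<in> D \<Longrightarrow> ((\<lambda>i. \<alpha> (y j) (h (s i) v)) \<longlongrightarrow> q v j) \<omega>"
          "\<And>v. v \<in> D \<Longrightarrow> (q v \<longlongrightarrow> l v) \<omega>"
        by metis
      have "Lim \<omega> (\<lambda>j. apply_bcontfun (a i) (y j)) = (\<Sum>v\<in>D. (r v i - c v)\<^sup>2)" for i
        unfolding a by (intro Lim_\<omega>_eq tendsto_sum tendsto_power tendsto_diff tendsto_const rql)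
      moreover have "Lim \<omega> (\<lambda>i. apply_bcontfun (a i) (y j)) = (\<Sum>v\<in>D. (q v j - c v)\<^sup>2)" for j
        unfolding a by (intro Lim_\<omega>_eq tendsto_sum tendsto_power tendsto_diff tendsto_const rql)
      moreover have "Lim \<omega> (\<lambda>i. \<Sum>v\<in>D. (r v i - c v)\<^sup>2) = (\<Sum>v\<in>D. (l v - c v)\<^sup>2)"
        "Lim \<omega> (\<lambda>j. \<Sum>v\<in>D. (q v j - c v)\<^sup>2) = (\<Sum>v\<in>D. (l v - c v)\<^sup>2)"
        by (intro Lim_\<omega>_eq tendsto_sum tendsto_power tendsto_diff tendsto_const rql; simp)+
      ultimately show "Lim \<omega> (\<lambda>i. Lim \<omega> (\<lambda>j. apply_bcontfun (a i) (y j))) =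
          Lim \<omega> (\<lambda>j. Lim \<omega> (\<lambda>i. apply_bcontfun (a i) (y j)))"
        by simp
    qed
  qed
  then have "g \<in> WAP act" by (simp add: WAP_def)
  with g show ?thesis by blast
qed

lemma notin_weak_star_closure:
  assumes rep: "representation act V N h \<alpha>"
    and x: "\<alpha> x \<notin> weak_star_dual_ball V N closure_of (\<alpha> ` F)"
  shows "\<exists>D e. finite D \<and> D \<subseteq> V \<and> e > 0 \<and> (\<forall>y\<in>F. \<exists>v\<in>D. e \<le> \<bar>\<alpha> y v - \<alpha> x v\<bar>)"
proof (rule ccontr)
  note R = representationD[OF rep]
  assume contra: "\<not> ?thesis"
  have "\<exists>y\<in>F. \<forall>v\<in>D. \<bar>\<alpha> y v - \<alpha> x v\<bar> < e" if "finite D" "D \<subseteq> V" "e > 0" for D e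
    using contra that by (meson not_le)
  from ex_ultra_approx[of V F \<alpha> "\<alpha> x", OF this] obtain U where U: "ultra U"
      "eventually (\<lambda>y. y \<in> F) U" "\<And>v. v \<in> V \<Longrightarrow> ((\<lambda>y. \<alpha> y v) \<longlongrightarrow> \<alpha> x v) U" by blast
  have "\<exists>z\<in>\<alpha> ` F. z \<in> T" if T: "openin (weak_star_dual_ball V N) T" "\<alpha> x \<in> T" for T
  proof -
    have "eventually (\<lambda>y. \<alpha> y \<in> T) U"
      using T unfolding weak_star_dual_ball_def
      by (rule eventually_in_initial_topology) (use R(3,4) U(3) in auto)
    from eventually_happens'[OF ultra_nontrivial[OF U(1)] eventually_conj[OF U(2) this]]
    show ?thesis by blast
  qed
  moreover have "\<alpha> x \<in> topspace (weak_star_dual_ball V N)"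
    using R(3,4) by (simp add: weak_star_dual_ball_def)
  ultimately show False using x unfolding in_closure_of by blast
qed

lemma REFL_approximable_imp_wap:
  fixes act :: "'s::{semigroup_mult, topological_space} \<Rightarrow> 'x::topological_space \<Rightarrow> 'x"
  assumes "REFL_approximable TYPE('v::real_vector) act"
  shows "wap_flow act"
proof -
  obtain R :: "('v set \<times> ('v \<Rightarrow> real) \<times> ('s \<Rightarrow> 'v \<Rightarrow> 'v) \<times> ('x \<Rightarrow> 'v \<Rightarrow> real)) set" where
    R: "\<And>V N h \<alpha>. (V, N, h, \<alpha>) \<in> R \<Longrightarrow> reflexive_banach_space V N \<and> representation act V N h \<alpha>"
    and sep: "separates_points_and_closed_sets R
        (\<lambda>(V, N, h, \<alpha>). weak_star_dual_ball V N) (\<lambda>(V, N, h, \<alpha>). \<alpha>)"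
    using assms unfolding REFL_approximable_def by fast
  show ?thesis
    unfolding wap_flow_def separates_points_and_closed_sets_def
  proof (intro conjI allI impI)
    fix x y :: 'x assume "x \<noteq> y"
    with sep obtain i where i: "i \<in> R" "(case i of (V, N, h, \<alpha>) \<Rightarrow> \<alpha>) x \<noteq> (case i of (V, N, h, \<alpha>) \<Rightarrow> \<alpha>) y"
      unfolding separates_points_and_closed_sets_def by blast
    obtain V N h \<alpha> where i_eq: "i = (V, N, h, \<alpha>)" by (cases i)
    have V: "reflexive_banach_space V N" and rep: "representation act V N h \<alpha>" using R i i_eq by auto
    obtain v where v: "\<alpha> x v \<noteq> \<alpha> y v" using i(2) unfolding i_eq by auto
    then have "v \<in> V" using dual_space_outside[OF representationD(3)[OF rep]] by metis
    then obtain g where "g \<in> WAP act" "\<And>z. apply_bcontfun g z = (\<Sum>v\<in>{v}. (\<alpha> z v - \<alpha> x v)\<^sup>2)"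
      using WAP_sum_squares[OF V rep, of "{v}" "\<alpha> x"] by auto
    with v show "\<exists>g\<in>WAP act. apply_bcontfun g x \<noteq> apply_bcontfun g y" by (intro bexI[of _ g]) auto
  next
    fix F and x :: 'x assume F: "closed F \<and> x \<notin> F"
    with sep obtain i where i: "i \<in> R" "(case i of (V, N, h, \<alpha>) \<Rightarrow> \<alpha>) x \<notin>
        (case i of (V, N, h, \<alpha>) \<Rightarrow> weak_star_dual_ball V N) closure_of ((case i of (V, N, h, \<alpha>) \<Rightarrow> \<alpha>) ` F)"
      unfolding separates_points_and_closed_sets_def by blast
    obtain V N h \<alpha> where i_eq: "i = (V, N, h, \<alpha>)" by (cases i)
    have V: "reflexive_banach_space V N" and rep: "representation act V N h \<alpha>" using R i i_eq by auto
    obtain D e where D: "finite D" "D \<subseteq> V" "e > 0" "\<And>y. y \<in> F \<Longrightarrow> \<exists>v\<in>D. e \<le> \<bar>\<alpha> y v - \<alpha> x v\<bar>"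
      using notin_weak_star_closure[OF rep, of x F] i(2) unfolding i_eq by auto
    obtain g where g: "g \<in> WAP act" "\<And>z. apply_bcontfun g z = (\<Sum>v\<in>D. (\<alpha> z v - \<alpha> x v)\<^sup>2)"
      using WAP_sum_squares[OF V rep D(1,2), of "\<alpha> x"] by blast
    have "apply_bcontfun g y \<in> {e\<^sup>2..}" if y: "y \<in> F" for y
    proof -
      obtain v where v: "v \<in> D" "e \<le> \<bar>\<alpha> y v - \<alpha> x v\<bar>" using D(4)[OF y] by blast
      have "e\<^sup>2 \<le> \<bar>\<alpha> y v - \<alpha> x v\<bar>\<^sup>2" using v(2) D(3) by (intro power_mono) auto
      also have "\<dots> = (\<alpha> y v - \<alpha> x v)\<^sup>2" by simp
      also have "\<dots> \<le> apply_bcontfun g y" unfolding g(2) by (rule member_le_sum[OF v(1)]) (auto simp: D(1))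
      finally show ?thesis by simp
    qed
    then have "closure (apply_bcontfun g ` F) \<subseteq> {e\<^sup>2..}"
      by (intro closure_minimal) auto
    moreover have "apply_bcontfun g x = 0" by (simp add: g(2))
    ultimately have "apply_bcontfun g x \<notin> closure (apply_bcontfun g ` F)" using D(3) by auto
    with g(1) show "\<exists>g\<in>WAP act. apply_bcontfun g x \<notin> euclidean closure_of (apply_bcontfun g ` F)"
      by auto
  qed
qed

section \<open>Weakly almost periodic functions come from reflexive representations\<close>

lemma complete_bcontfun: "complete (UNIV :: ('x::topological_space \<Rightarrow>\<^sub>C real) set)"
  unfolding complete_def
proof (intro allI impI)
  fix f :: "nat \<Rightarrow> 'x \<Rightarrow>\<^sub>C real" assume "(\<forall>n. f n \<in> UNIV) \<and> Cauchy f"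
  then have f: "Cauchy f" by blast
  have "uniformly_Cauchy_on UNIV (\<lambda>n. apply_bcontfun (f n))"
    unfolding uniformly_Cauchy_on_def
  proof (intro allI impI)
    fix e :: real assume "e > 0"
    then obtain M where "\<And>m n. m \<ge> M \<Longrightarrow> n \<ge> M \<Longrightarrow> dist (f m) (f n) < e"
      using f unfolding Cauchy_def by blast
    then show "\<exists>M. \<forall>x\<in>UNIV. \<forall>m\<ge>M. \<forall>n\<ge>M. dist (apply_bcontfun (f m) x) (apply_bcontfun (f n) x) < e"
      using dist_fun_lt_imp_dist_val_lt by blast
  qed
  then have "uniformly_convergent_on UNIV (\<lambda>n. apply_bcontfun (f n))"
    by (rule Cauchy_uniformly_convergent)
  then obtain g where g: "uniform_limit UNIV (\<lambda>n. apply_bcontfun (f n)) g sequentially"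
    unfolding uniformly_convergent_on_def by blast
  from uniform_limit_bcontfunE[OF this sequentially_bot] obtain l where "f \<longlonglongrightarrow> l" by metis
  then show "\<exists>l\<in>UNIV. f \<longlonglongrightarrow> l" by blast
qed

definition translate :: "('s \<Rightarrow> 'x \<Rightarrow> 'x) \<Rightarrow> 's \<Rightarrow> ('x::topological_space \<Rightarrow>\<^sub>C real) \<Rightarrow> 'x \<Rightarrow>\<^sub>C real"
  where "translate act s v = Bcontfun (\<lambda>x. apply_bcontfun v (act s x))"

lemma apply_translate:
  assumes "flow act"
  shows "apply_bcontfun (translate act s v) x = apply_bcontfun v (act s x)"
proof -
  have "continuous_on UNIV (\<lambda>x. act s x)" using assms by (simp add: flow_def)
  then have "continuous_on UNIV (\<lambda>x. apply_bcontfun v (act s x))"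
    by (rule continuous_on_compose2[OF continuous_on_apply_bcontfun[of UNIV v]]) simp
  then have "(\<lambda>x. apply_bcontfun v (act s x)) \<in> bcontfun"
    by (rule bcontfun_normI) (rule norm_bounded)
  then show ?thesis by (simp add: translate_def Bcontfun_inverse)
qed

lemma linear_translate: "flow act \<Longrightarrow> linear (translate act s)"
  by (rule linearI) (auto intro!: bcontfun_eqI simp: apply_translate)

lemma norm_translate_le: "flow act \<Longrightarrow> norm (translate act s v) \<le> norm v"
  by (rule norm_bound) (simp add: apply_translate abs_apply_le_norm)

lemma translate_mult: "flow act \<Longrightarrow> translate act (s * t) v = translate act t (translate act s v)"
  by (rule bcontfun_eqI) (simp add: apply_translate flow_def)

lemma orbit_eq_translate: "flow act \<Longrightarrow> orbit act f = range (\<lambda>s. translate act s f)"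
  by (auto simp: orbit_def apply_translate intro!: bcontfun_eqI image_eqI)

lemma WAP_imp_representation:
  fixes act :: "'s::{semigroup_mult, topological_space} \<Rightarrow> 'x::topological_space \<Rightarrow> 'x"
  assumes flow: "flow act" and f: "f \<in> WAP act"
  shows "\<exists>V N h \<alpha>. reflexive_banach_space V N \<and> representation act V N h \<alpha> \<and> f \<in> V \<and>
    (\<forall>x. \<alpha> x f = apply_bcontfun f x)"
proof -
  let ?O = "orbit act f"
  define C where "C = 1 / (norm f + 1)"
  have C: "C > 0" by (simp add: C_def add_nonneg_pos)
  define A where "A = {c *\<^sub>R g | c g. \<bar>c\<bar> \<le> C \<and> g \<in> insert f ?O}"
  have AI: "c *\<^sub>R g \<in> A" if "\<bar>c\<bar> \<le> C" "g \<in> insert f ?O" for c g using that by (auto simp: A_def)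
  have nO: "norm g \<le> norm f" if "g \<in> insert f ?O" for g
    using that norm_translate_le[OF flow] by (auto simp: orbit_eq_translate[OF flow])
  have nA: "norm a \<le> 1" if a: "a \<in> A" for a
  proof -
    obtain c g where cg: "a = c *\<^sub>R g" "\<bar>c\<bar> \<le> C" "g \<in> insert f ?O" using a by (auto simp: A_def)
    have "norm a \<le> C * norm f" unfolding cg(1) norm_scaleR
      using cg(2) nO[OF cg(3)] C by (intro mult_mono) auto
    also have "\<dots> \<le> C * (norm f + 1)" using C by (intro mult_left_mono) auto
    also have "\<dots> = 1" using add_nonneg_pos[OF norm_ge_zero[of f] zero_less_one] by (simp add: C_def)
    finally show ?thesis .
  qed
  have trA: "translate act s a \<in> A" if a: "a \<in> A" for s a
  proof -
    obtain c g where cg: "a = c *\<^sub>R g" "\<bar>c\<bar> \<le> C" "g \<in> insert f ?O" using a by (auto simp: A_def)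
    have "translate act s g \<in> ?O"
      using cg(3) unfolding orbit_eq_translate[OF flow] by (auto simp: translate_mult[OF flow, symmetric])
    then show ?thesis
      unfolding cg(1) linear_scale[OF linear_translate[OF flow]] using cg(2) by (intro AI) auto
  qed
  define H where "H = convex hull A"
  have nH: "norm h \<le> 1" if "h \<in> H" for h
  proof -
    have "H \<subseteq> cball 0 1" unfolding H_def by (rule hull_minimal) (use nA in auto)
    then show ?thesis using that by auto
  qed
  have AH: "a \<in> H" if "a \<in> A" for a unfolding H_def using that by (rule hull_inc)
  have linH: "L h \<in> H" if "linear L" "\<And>a. a \<in> A \<Longrightarrow> L a \<in> A" "h \<in> H" for L h
  proof -
    have "L h \<in> convex hull (L ` A)" using that by (simp add: H_def in_convex_hull_linear_image)
    also have "\<dots> \<subseteq> H" unfolding H_def by (rule hull_mono) (use that in auto)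
    finally show ?thesis .
  qed
  have "stable ?O UNIV apply_bcontfun"
    using f nO by (intro relatively_weakly_compact_imp_stable[where M="norm f"]) (auto simp: WAP_def)
  then have "stable (insert f ?O) UNIV apply_bcontfun"
  proof (rule stable_insert)
    show "?O \<noteq> {}" by (simp add: orbit_eq_translate[OF flow])
    show "\<bar>apply_bcontfun a y\<bar> \<le> norm f" if "a \<in> insert f ?O" for a y
      using abs_apply_le_norm[of a y] nO[OF that] by simp
  qed
  then have "stable A UNIV apply_bcontfun"
  proof (rule stable_scale[where M="norm f" and C=C])
    show "\<bar>apply_bcontfun a y\<bar> \<le> norm f" if "a \<in> insert f ?O" for a y
      using abs_apply_le_norm[of a y] nO[OF that] by simp
    fix a assume "a \<in> A"
    then obtain c g where "a = c *\<^sub>R g" "\<bar>c\<bar> \<le> C" "g \<in> insert f ?O" by (auto simp: A_def)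
    then show "\<exists>g\<in>insert f ?O. \<exists>c. \<bar>c\<bar> \<le> C \<and>
        (\<forall>y\<in>UNIV. apply_bcontfun a y = c * apply_bcontfun g y)"
      by (intro bexI[of _ g] exI[of _ c]) simp_all
  qed
  then have "stable H UNIV apply_bcontfun"
    unfolding H_def
  proof (rule stable_convex_hull[where M=1])
    show "\<bar>apply_bcontfun a y\<bar> \<le> 1" if "a \<in> A" for a y
      using abs_apply_le_norm[of a y] nA[OF that] by simp
    show "linear (\<lambda>a :: 'x \<Rightarrow>\<^sub>C real. apply_bcontfun a y)" for y
      by (rule bounded_linear.linear[OF bounded_linear_eval])
    show "\<exists>K. \<forall>y\<in>UNIV. \<bar>apply_bcontfun a y\<bar> \<le> K" for a :: "'x \<Rightarrow>\<^sub>C real"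
      using abs_apply_le_norm[of a] by blast
  qed
  then have rwc: "relatively_weakly_compact H"
    by (rule stable_imp_relatively_weakly_compact) (rule nH)
  interpret interpolation H
  proof
    show "complete (UNIV :: ('x \<Rightarrow>\<^sub>C real) set)" by (rule complete_bcontfun)
    show "convex H" by (simp add: H_def)
    show "- h \<in> H" if h: "h \<in> H" for h
    proof (rule linH[OF _ _ h])
      show "linear (uminus :: ('x \<Rightarrow>\<^sub>C real) \<Rightarrow> _)" by (rule linearI) auto
      show "- a \<in> A" if a: "a \<in> A" for a
      proof -
        obtain c g where "a = c *\<^sub>R g" "\<bar>c\<bar> \<le> C" "g \<in> insert f ?O" using a by (auto simp: A_def)
        then show ?thesis using AI[of "- c" g] by simp
      qed
    qed
    show "H \<noteq> {}" using AH[OF AI[of 0 f]] C by auto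
  qed (use nH rwc in auto)
  have "C *\<^sub>R f \<in> V" by (rule H_subset_V[OF AH[OF AI]]) (use C in auto)
  from V_scale_le(1)[OF this, of "1 / C"] have fV: "f \<in> V" using C by simp
  have trV: "translate act s v \<in> V" "N (translate act s v) \<le> N v" if "v \<in> V" for s v
    using contraction[OF linear_translate[OF flow] linH[OF linear_translate[OF flow] trA] norm_translate_le[OF flow] that]
    by auto
  define h where "h s v = (if v \<in> V then translate act s v else 0)" for s v
  define \<alpha> where "\<alpha> x = restr (\<lambda>v. apply_bcontfun v x)" for x
  have \<alpha>_dual: "\<alpha> x \<in> dual_space V N" for x
    unfolding \<alpha>_def by (rule restr_dual[OF bounded_linear_eval])
  have \<alpha>V: "\<alpha> x v = apply_bcontfun v x" if "v \<in> V" for x v using that by (simp add: \<alpha>_def restr_def)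
  have "representation act V N h \<alpha>"
    unfolding representation_def
  proof (intro conjI allI ballI)
    show "h (s * t) = h t \<circ> h s" for s t
    proof
      fix v
      show "h (s * t) v = (h t \<circ> h s) v"
      proof (cases "v \<in> V")
        case True
        then show ?thesis using trV(1)[OF True, of s] by (simp add: h_def translate_mult[OF flow])
      next
        case False
        then show ?thesis using linear_0[OF linear_translate[OF flow, of t]] by (simp add: h_def)
      qed
    qed
    show "continuous_map euclidean (weak_star_dual_ball V N) \<alpha>"
      unfolding weak_star_dual_ball_def
    proof (rule continuous_map_into_initial_topology)
      show "\<alpha> x \<in> {\<phi> \<in> dual_space V N. dual_norm V N \<phi> \<le> 1}" for x
      proof -
        have "dual_norm V N (\<alpha> x) \<le> 1"
          unfolding dual_norm_def
        proof (rule operator_norm_le[OF normed_space_V])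
          fix v assume "v \<in> V" "N v \<le> 1"
          then show "\<bar>\<alpha> x v\<bar> \<le> 1" using abs_apply_le_norm[of v x] norm_le_N[of v] by (simp add: \<alpha>V)
        qed
        with \<alpha>_dual show ?thesis by simp
      qed
      show "continuous_map euclidean euclideanreal (\<lambda>x. \<beta> (\<alpha> x))" if "\<beta> \<in> {\<lambda>\<phi>. \<phi> v |v. v \<in> V}" for \<beta>
        using that by (auto simp: \<alpha>V)
    qed
    show "\<alpha> (act s x) v = \<alpha> x (h s v)" if "v \<in> V" for v s x
      using that by (simp add: h_def \<alpha>V trV apply_translate[OF flow])
    show "continuous_map euclidean (\<Theta>_wot V N) h"
      unfolding \<Theta>_wot_def
    proof (rule continuous_map_into_initial_topology)
      show "h s \<in> {\<sigma> \<in> bounded_linear_maps V N V N. operator_norm V N N \<sigma> \<le> 1}" for s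
      proof -
        have "h s \<in> bounded_linear_maps V N V N"
          unfolding bounded_linear_maps_def
          by (auto simp: h_def trV V_add V_scale_le linear_add[OF linear_translate[OF flow]]
              linear_scale[OF linear_translate[OF flow]] intro!: exI[of _ 1])
        moreover have "operator_norm V N N (h s) \<le> 1"
        proof (rule operator_norm_le[OF normed_space_V])
          fix v assume "v \<in> V" "N v \<le> 1"
          then show "N (h s v) \<le> 1" using trV(2)[of v s] by (simp add: h_def)
        qed
        ultimately show ?thesis by simp
      qed
      fix \<beta> :: "(('x \<Rightarrow>\<^sub>C real) \<Rightarrow> 'x \<Rightarrow>\<^sub>C real) \<Rightarrow> real"
      assume "\<beta> \<in> {\<lambda>\<sigma>. \<phi> (\<sigma> v) |\<phi> v. \<phi> \<in> dual_space V N \<and> v \<in> V}"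
      then obtain \<phi> v where \<beta>: "\<beta> = (\<lambda>\<sigma>. \<phi> (\<sigma> v))" and \<phi>: "\<phi> \<in> dual_space V N" and v: "v \<in> V" by blast
      have "((\<lambda>s. \<phi> (h s v)) \<longlongrightarrow> \<phi> (h s0 v)) (at s0)" for s0
      proof (rule tendstoI, rule ccontr)
        fix e :: real
        assume e: "e > 0" and nev: "\<not> eventually (\<lambda>s. dist (\<phi> (h s v)) (\<phi> (h s0 v)) < e) (at s0)"
        let ?B = "{s. \<not> dist (\<phi> (h s v)) (\<phi> (h s0 v)) < e}"
        have "inf (at s0) (principal ?B) \<noteq> bot"
        proof
          assume "inf (at s0) (principal ?B) = bot"
          then have "eventually (\<lambda>_. False) (inf (at s0) (principal ?B))" by simp
          then have "eventually (\<lambda>s. s \<in> ?B \<longrightarrow> False) (at s0)" unfolding eventually_inf_principal .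
          with nev show False by simp
        qed
        then obtain F where F: "F \<le> inf (at s0) (principal ?B)" "ultra F" using ex_ultra_le by blast
        note Fbot = ultra_nontrivial[OF F(2)]
        have hV: "h s v \<in> V" "N (h s v) \<le> N v" for s using v by (simp_all add: h_def trV)
        obtain w where w: "w \<in> V" "\<And>\<psi>. \<psi> \<in> dual_space V N \<Longrightarrow> ((\<lambda>s. \<psi> (h s v)) \<longlongrightarrow> \<psi> w) F"
          using reflexive_lim[OF reflexive_V F(2), of "\<lambda>s. h s v", OF hV] by blast
        have "apply_bcontfun w x = apply_bcontfun (h s0 v) x" for x
        proof -
          have "continuous_on UNIV (\<lambda>s. act s x)" using flow by (simp add: flow_def)
          then have "continuous_on UNIV (\<lambda>s. apply_bcontfun v (act s x))"
            by (rule continuous_on_compose2[OF continuous_on_apply_bcontfun[of UNIV v]]) simp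
          then have "((\<lambda>s. apply_bcontfun v (act s x)) \<longlongrightarrow> apply_bcontfun v (act s0 x)) (at s0)"
            by (simp add: continuous_on_def)
          moreover have "F \<le> at s0" using F(1) by simp
          ultimately have "((\<lambda>s. apply_bcontfun v (act s x)) \<longlongrightarrow> apply_bcontfun v (act s0 x)) F"
            using tendsto_mono by blast
          moreover have "\<alpha> x (h s v) = apply_bcontfun v (act s x)" for s
            unfolding \<alpha>V[OF hV(1)] using v by (simp add: h_def apply_translate[OF flow])
          moreover have "apply_bcontfun (h s0 v) x = apply_bcontfun v (act s0 x)"
            using v by (simp add: h_def apply_translate[OF flow])
          ultimately have "((\<lambda>s. \<alpha> x (h s v)) \<longlongrightarrow> apply_bcontfun (h s0 v) x) F"
            by simp
          from tendsto_unique[OF Fbot w(2)[OF \<alpha>_dual[of x]] this] show ?thesis unfolding \<alpha>V[OF w(1)] .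
        qed
        then have "w = h s0 v" by (rule bcontfun_eqI)
        then have "eventually (\<lambda>s. dist (\<phi> (h s v)) (\<phi> (h s0 v)) < e) F"
          using tendstoD[OF w(2)[OF \<phi>] e] by blast
        moreover have "eventually (\<lambda>s. s \<in> ?B) F"
          by (rule filter_leD[OF order_trans[OF F(1) inf_le2]]) (simp add: eventually_principal)
        ultimately have "eventually (\<lambda>_. False) F" by eventually_elim simp
        then show False using Fbot by (simp add: eventually_False)
      qed
      then show "continuous_map euclidean euclideanreal (\<lambda>s. \<beta> (h s))"
        by (simp add: \<beta> continuous_on_def)
    qed
  qed
  then show ?thesis using reflexive_V fV \<alpha>V[OF fV] by blast
qed

lemma wap_imp_REFL_approximable:
  fixes act :: "'s::{semigroup_mult, topological_space} \<Rightarrow> 'x::topological_space \<Rightarrow> 'x"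
  assumes flow: "flow act" and wap: "wap_flow act"
  shows "REFL_approximable TYPE('x \<Rightarrow>\<^sub>C real) act"
proof -
  define R :: "(('x \<Rightarrow>\<^sub>C real) set \<times> (('x \<Rightarrow>\<^sub>C real) \<Rightarrow> real) \<times> ('s \<Rightarrow> ('x \<Rightarrow>\<^sub>C real) \<Rightarrow> 'x \<Rightarrow>\<^sub>C real) \<times>
      ('x \<Rightarrow> ('x \<Rightarrow>\<^sub>C real) \<Rightarrow> real)) set"
    where "R = {(V, N, h, \<alpha>). reflexive_banach_space V N \<and> representation act V N h \<alpha>}"
  have ex: "\<exists>V N h \<alpha>. (V, N, h, \<alpha>) \<in> R \<and> f \<in> V \<and> (\<forall>x. \<alpha> x f = apply_bcontfun f x)"
    if "f \<in> WAP act" for f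
    using WAP_imp_representation[OF flow that] unfolding R_def by blast
  have "separates_points_and_closed_sets R
        (\<lambda>(V, N, h, \<alpha>). weak_star_dual_ball V N) (\<lambda>(V, N, h, \<alpha>). \<alpha>)"
    unfolding separates_points_and_closed_sets_def
  proof (intro conjI allI impI)
    fix x y :: 'x assume "x \<noteq> y"
    then obtain f where f: "f \<in> WAP act" "apply_bcontfun f x \<noteq> apply_bcontfun f y"
      using wap unfolding wap_flow_def separates_points_and_closed_sets_def by blast
    obtain V N h \<alpha> where r: "(V, N, h, \<alpha>) \<in> R" "\<forall>x. \<alpha> x f = apply_bcontfun f x"
      using ex[OF f(1)] by blast
    then have "\<alpha> x \<noteq> \<alpha> y" using f(2) by metis
    then show "\<exists>i\<in>R. (case i of (V, N, h, \<alpha>) \<Rightarrow> \<alpha>) x \<noteq> (case i of (V, N, h, \<alpha>) \<Rightarrow> \<alpha>) y"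
      by (intro bexI[OF _ r(1)]) simp
  next
    fix F and x :: 'x assume "closed F \<and> x \<notin> F"
    then obtain f where f: "f \<in> WAP act" "apply_bcontfun f x \<notin> closure (apply_bcontfun f ` F)"
      using wap unfolding wap_flow_def separates_points_and_closed_sets_def euclidean_closure_of by blast
    obtain V N h \<alpha> where r: "(V, N, h, \<alpha>) \<in> R" "f \<in> V" "\<And>x. \<alpha> x f = apply_bcontfun f x"
      using ex[OF f(1)] by blast
    have rep: "representation act V N h \<alpha>" using r(1) by (simp add: R_def)
    have "\<alpha> x \<notin> weak_star_dual_ball V N closure_of (\<alpha> ` F)"
    proof
      assume cl: "\<alpha> x \<in> weak_star_dual_ball V N closure_of (\<alpha> ` F)"
      let ?A = "{\<phi> \<in> dual_space V N. dual_norm V N \<phi> \<le> 1}"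
      let ?T = "?A \<inter> (\<lambda>\<phi>. \<phi> f) -` (- closure (apply_bcontfun f ` F))"
      have T: "openin (weak_star_dual_ball V N) ?T"
        unfolding weak_star_dual_ball_def
      proof (rule openin_initial_topology_basic)
        show "(\<lambda>\<phi>. \<phi> f) \<in> {\<lambda>\<phi>. \<phi> v |v. v \<in> V}" using r(2) by blast
      qed (simp add: open_Compl)
      have xT: "\<alpha> x \<in> ?T" using representationD(3,4)[OF rep] f(2) by (simp add: r(3))
      have "\<alpha> x \<in> ?T \<and> openin (weak_star_dual_ball V N) ?T \<longrightarrow> (\<exists>z. z \<in> \<alpha> ` F \<and> z \<in> ?T)"
        using cl[unfolded in_closure_of, THEN conjunct2] by (rule spec)
      then obtain z where z: "z \<in> \<alpha> ` F" "z \<in> ?T" using T xT by (elim impE exE conjE) simp_all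
      then obtain y where y: "y \<in> F" "z = \<alpha> y" by (elim imageE)
      have "\<alpha> y f \<notin> closure (apply_bcontfun f ` F)" using z(2) unfolding y(2) by simp
      moreover have "\<alpha> y f \<in> closure (apply_bcontfun f ` F)"
        unfolding r(3) using subsetD[OF closure_subset imageI[OF y(1)]] .
      ultimately show False by (rule notE)
    qed
    then show "\<exists>i\<in>R. (case i of (V, N, h, \<alpha>) \<Rightarrow> \<alpha>) x \<notin>
        (case i of (V, N, h, \<alpha>) \<Rightarrow> weak_star_dual_ball V N) closure_of ((case i of (V, N, h, \<alpha>) \<Rightarrow> \<alpha>) ` F)"
      by (intro bexI[OF _ r(1)]) simp
  qed
  moreover have "\<forall>(V, N, h, \<alpha>)\<in>R. reflexive_banach_space V N \<and> representation act V N h \<alpha>"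
    by (simp add: R_def)
  ultimately show ?thesis unfolding REFL_approximable_def by (intro exI[of _ R] conjI)
qed

(* The equivalence is stated for families of reflexive spaces carried by subspaces of C(X); the
   second conjunct says that families of reflexive spaces over any vector space whatsoever yield
   nothing more. Together: X is wap iff it is REFL-approximable, over no matter which universe. *)
theorem theorem4p7:
  fixes act :: "'s::{semigroup_mult, topological_space} \<Rightarrow> 'x::topological_space \<Rightarrow> 'x"
  assumes "semitopological_semigroup TYPE('s)"
    and "flow act"
  shows "(wap_flow act \<longleftrightarrow> REFL_approximable TYPE('x \<Rightarrow>\<^sub>C real) act) \<and>
    (REFL_approximable TYPE('v::real_vector) act \<longrightarrow> wap_flow act)"
proof (intro conjI iffI impI)
  show "REFL_approximable TYPE('x \<Rightarrow>\<^sub>C real) act" if "wap_flow act"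
    using assms(2) that by (rule wap_imp_REFL_approximable)
qed (rule REFL_approximable_imp_wap, assumption)+

end
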